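(* Let $0<p,q<\infty$ and $\alpha>d(1/p-1)_+$. Then there exists a function $f\in B^{\alpha q}_p$ such that $\|f\|_{B^{\alpha q}_p(H)}=\infty$ and then $f\notin B^{\alpha q}_p(H)$. Here $B^{\alpha q}_p$ and $B^{\alpha q}_p(H)$ are, respectively, the classical Besov space on $\mathbb{R}^d$ and the Hermite–Besov space.
   Context: $B^{\alpha q}_p$ is the classical (inhomogeneous) Besov space on $\mathbb{R}^d$ with smoothness $\alpha$, integrability index $p$ and summability index $q$; $(t)_+:=\max\{t,0\}$. Hermite functions and kernels: $H_n(t)=(-1)^n e^{t^2}(\frac{d}{dt})^n e^{-t^2}$, $h_n(t)=(2^n n!\sqrt\pi)^{-1/2}H_n(t)e^{-t^2/2}$, $\mathcal{H}_\beta(x)=h_{\beta_1}(x_1)\cdots h_{\beta_d}(x_d)$ for $\beta\in\mathbb{N}_0^d$, and $\mathcal{H}_\nu(x,y)=\sum_{|\beta|=\nu}\mathcal{H}_\beta(x)\mathcal{H}_\beta(y)$, with $|\beta|=\beta_1+\dots+\beta_d$. For tempered distributions $f\in\mathcal{S}'$ put $\langle f,\phi\rangle:=f(\overline\phi)$, and for a kernel $\Phi$ with $\Phi(x,\cdot)\in\mathcal{S}$ put $\Phi*f(x):=\langle f,\overline{\Phi(x,\cdot)}\rangle$. Let $\widehat a\in C^\infty[0,\infty)$, $\operatorname{supp}\widehat a\subset[1/4,4]$, $|\widehat a(t)|>c>0$ for $t\in[1/3,3]$; set $\Phi_0:=\mathcal{H}_0(\cdot,\cdot)$ and $\Phi_j:=\sum_{\nu=0}^\infty\widehat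 a(\nu/4^{j-1})\mathcal{H}_\nu(\cdot,\cdot)$, $j\ge1$. The Hermite–Besov space $B^{\alpha q}_p(H)$ is the set of all $f\in\mathcal{S}'$ with $$\|f\|_{B^{\alpha q}_p(H)}:=\Big(\sum_{j=0}^\infty\big(2^{\alpha j}\|\Phi_j*f\|_{L^p(\mathbb{R}^d)}\big)^q\Big)^{1/q}<\infty.$$ Different choices of $\widehat a$ give equivalent quasi-norms. *)

theory Defs
  imports "HOL-Analysis.Analysis"
begin

text \<open>
  The dimension \<open>d\<close> is \<open>CARD('n)\<close>. Distributions are functionals on the type of all functions
  \<open>real^'n \<Rightarrow> complex\<close>; only their values on Schwartz functions are ever used.
\<close>

section \<open>Schwartz functions and tempered distributions\<close>

definition partial :: "'n \<Rightarrow> (real^'n \<Rightarrow> complex) \<Rightarrow> real^'n \<Rightarrow> complex" where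
  "partial i g = (\<lambda>x. frechet_derivative g (at x) (axis i 1))"

text \<open>
  Partial derivatives of higher order are indexed by the list of the coordinates in which one
  differentiates; for smooth functions the order of the list is irrelevant.
\<close>

definition partials :: "'n list \<Rightarrow> (real^'n \<Rightarrow> complex) \<Rightarrow> real^'n \<Rightarrow> complex" where
  "partials is g = foldr partial is g"

text \<open>
  Differentiability of all iterated partial derivatives makes all of them continuous, so this is
  the usual class \<open>C\<^sup>\<infinity>\<close>.
\<close>

definition smooth :: "(real^'n \<Rightarrow> complex) \<Rightarrow> bool" where
  "smooth g \<longleftrightarrow> (\<forall>is x. partials is g differentiable (at x))"

definition monomial :: "('n \<Rightarrow> nat) \<Rightarrow> real^'n \<Rightarrow> real" where
  "monomial \<gamma> x = (\<Prod>i\<in>UNIV. (x $ i) ^ \<gamma> i)"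

definition schwartz :: "(real^'n \<Rightarrow> complex) set" where
  "schwartz = {\<phi>. smooth \<phi> \<and>
     (\<forall>\<gamma> is. bdd_above (range (\<lambda>x. cmod (monomial \<gamma> x *\<^sub>R partials is \<phi> x))))}"

definition schwartz_seminorm :: "('n \<Rightarrow> nat) \<Rightarrow> 'n list \<Rightarrow> (real^'n \<Rightarrow> complex) \<Rightarrow> real" where
  "schwartz_seminorm \<gamma> is \<phi> = (SUP x. cmod (monomial \<gamma> x *\<^sub>R partials is \<phi> x))"

text \<open>
  The topology of the Schwartz space is given by countably many seminorms, hence metrizable, and
  a linear functional is continuous iff it maps null sequences to null sequences.
\<close>

definition tempered_distribution :: "((real^'n \<Rightarrow> complex) \<Rightarrow> complex) \<Rightarrow> bool" where
  "tempered_distribution f \<longleftrightarrow>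
     (\<forall>\<phi>\<in>schwartz. \<forall>\<psi>\<in>schwartz. f (\<lambda>x. \<phi> x + \<psi> x) = f \<phi> + f \<psi>) \<and>
     (\<forall>c. \<forall>\<phi>\<in>schwartz. f (\<lambda>x. c * \<phi> x) = c * f \<phi>) \<and>
     (\<forall>u :: nat \<Rightarrow> real^'n \<Rightarrow> complex.
        (\<forall>k. u k \<in> schwartz) \<longrightarrow>
        (\<forall>\<gamma> is. (\<lambda>k. schwartz_seminorm \<gamma> is (u k)) \<longlonglongrightarrow> 0) \<longrightarrow>
        (\<lambda>k. f (u k)) \<longlonglongrightarrow> 0)"

text \<open>The distribution \<open>\<phi> \<mapsto> \<integral> f \<phi>\<close> given by a function \<open>f\<close>, and when it is well defined.\<close>

definition dist_of_fun :: "(real^'n \<Rightarrow> complex) \<Rightarrow> (real^'n \<Rightarrow> complex) \<Rightarrow> complex" where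
  "dist_of_fun f = (\<lambda>\<phi>. LINT x|lborel. f x * \<phi> x)"

definition tempered_function :: "(real^'n \<Rightarrow> complex) \<Rightarrow> bool" where
  "tempered_function f \<longleftrightarrow>
     f \<in> borel_measurable lborel \<and>
     (\<forall>\<phi>\<in>schwartz. integrable lborel (\<lambda>x. f x * \<phi> x)) \<and>
     tempered_distribution (dist_of_fun f)"

definition pairing :: "((real^'n \<Rightarrow> complex) \<Rightarrow> complex) \<Rightarrow> (real^'n \<Rightarrow> complex) \<Rightarrow> complex" where
  "pairing f \<phi> = f (\<lambda>y. cnj (\<phi> y))"

definition kernel_conv ::
  "(real^'n \<Rightarrow> real^'n \<Rightarrow> complex) \<Rightarrow> ((real^'n \<Rightarrow> complex) \<Rightarrow> complex) \<Rightarrow> real^'n \<Rightarrow> complex" where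
  "kernel_conv K f = (\<lambda>x. pairing f (\<lambda>y. cnj (K x y)))"

section \<open>Quasi-norms\<close>

text \<open>Real powers of extended nonnegative numbers, for exponents \<open>s > 0\<close>.\<close>

definition epow :: "ennreal \<Rightarrow> real \<Rightarrow> ennreal" where
  "epow t s = (if t = \<infinity> then \<infinity> else ennreal (enn2real t powr s))"

definition Lp_qnorm :: "real \<Rightarrow> (real^'n \<Rightarrow> complex) \<Rightarrow> ennreal" where
  "Lp_qnorm p g = epow (\<integral>\<^sup>+ x. ennreal (cmod (g x) powr p) \<partial>lborel) (1 / p)"

text \<open>The quasi-norm of a sequence of functions in \<open>\<ell>\<^sup>q(L\<^sup>p)\<close> with weights \<open>2\<^sup>\<alpha>\<^sup>j\<close>.\<close>

definition besov_seq_qnorm :: "real \<Rightarrow> real \<Rightarrow> real \<Rightarrow> (nat \<Rightarrow> real^'n \<Rightarrow> complex) \<Rightarrow> ennreal" where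
  "besov_seq_qnorm \<alpha> p q g =
     epow (\<Sum>j. epow (ennreal (2 powr (\<alpha> * real j)) * Lp_qnorm p (g j)) q) (1 / q)"

section \<open>Classical Besov spaces\<close>

text \<open>
  \<open>\<phi>\<^sub>0\<close> generates the dyadic resolution of unity \<open>\<phi>\<^sub>j(\<xi>) = \<phi>\<^sub>0(2\<^sup>-\<^sup>j \<xi>) - \<phi>\<^sub>0(2\<^sup>-\<^sup>j\<^sup>+\<^sup>1 \<xi>)\<close>, \<open>j \<ge> 1\<close>, on the
  Fourier side.
\<close>

definition resolution_generator :: "(real^'n \<Rightarrow> complex) \<Rightarrow> bool" where
  "resolution_generator \<phi>\<^sub>0 \<longleftrightarrow>
     smooth \<phi>\<^sub>0 \<and> (\<forall>\<xi>. norm \<xi> \<le> 1 \<longrightarrow> \<phi>\<^sub>0 \<xi> = 1) \<and> closure {\<xi>. \<phi>\<^sub>0 \<xi> \<noteq> 0} \<subseteq> cball 0 2"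

definition dyadic_piece :: "(real^'n \<Rightarrow> complex) \<Rightarrow> nat \<Rightarrow> real^'n \<Rightarrow> complex" where
  "dyadic_piece \<phi>\<^sub>0 j \<xi> =
     (if j = 0 then \<phi>\<^sub>0 \<xi> else \<phi>\<^sub>0 ((1 / 2 ^ j) *\<^sub>R \<xi>) - \<phi>\<^sub>0 ((1 / 2 ^ (j - 1)) *\<^sub>R \<xi>))"

text \<open>
  Inverse Fourier transform, normalised so that convolution with \<open>inv_fourier \<phi>\<close> is the Fourier
  multiplier \<open>\<phi>\<close>.
\<close>

definition inv_fourier :: "(real^'n \<Rightarrow> complex) \<Rightarrow> real^'n \<Rightarrow> complex" where
  "inv_fourier \<phi> x =
     complex_of_real (1 / (2 * pi) ^ CARD('n)) * (LINT \<xi>|lborel. \<phi> \<xi> * cis (x \<bullet> \<xi>))"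

text \<open>Littlewood-Paley pieces, given by the convolution kernels \<open>(x, y) \<mapsto> (\<phi>\<^sub>j)\<^sup>\<or>(x - y)\<close>.\<close>

definition lp_piece ::
  "(real^'n \<Rightarrow> complex) \<Rightarrow> nat \<Rightarrow> ((real^'n \<Rightarrow> complex) \<Rightarrow> complex) \<Rightarrow> real^'n \<Rightarrow> complex" where
  "lp_piece \<phi>\<^sub>0 j f = kernel_conv (\<lambda>x y. inv_fourier (dyadic_piece \<phi>\<^sub>0 j) (x - y)) f"

definition besov_qnorm ::
  "(real^'n \<Rightarrow> complex) \<Rightarrow> real \<Rightarrow> real \<Rightarrow> real \<Rightarrow> ((real^'n \<Rightarrow> complex) \<Rightarrow> complex) \<Rightarrow> ennreal" where
  "besov_qnorm \<phi>\<^sub>0 \<alpha> p q f = besov_seq_qnorm \<alpha> p q (\<lambda>j. lp_piece \<phi>\<^sub>0 j f)"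

definition besov ::
  "(real^'n \<Rightarrow> complex) \<Rightarrow> real \<Rightarrow> real \<Rightarrow> real \<Rightarrow> ((real^'n \<Rightarrow> complex) \<Rightarrow> complex) set" where
  "besov \<phi>\<^sub>0 \<alpha> p q = {f. tempered_distribution f \<and> besov_qnorm \<phi>\<^sub>0 \<alpha> p q f < \<infinity>}"

section \<open>Hermite--Besov spaces\<close>

definition hermite_poly :: "nat \<Rightarrow> real \<Rightarrow> real" where
  "hermite_poly n t = (- 1) ^ n * exp (t\<^sup>2) * (deriv ^^ n) (\<lambda>s. exp (- (s\<^sup>2))) t"

definition hermite_fun :: "nat \<Rightarrow> real \<Rightarrow> real" where
  "hermite_fun n t = (2 ^ n * fact n * sqrt pi) powr (- 1 / 2) * hermite_poly n t * exp (- (t\<^sup>2) / 2)"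

definition hermite_tensor :: "('n::finite \<Rightarrow> nat) \<Rightarrow> real^'n \<Rightarrow> real" where
  "hermite_tensor \<beta> x = (\<Prod>i\<in>UNIV. hermite_fun (\<beta> i) (x $ i))"

definition hermite_kernel :: "nat \<Rightarrow> real^'n \<Rightarrow> real^'n \<Rightarrow> real" where
  "hermite_kernel \<nu> x y =
     (\<Sum>\<beta> | (\<Sum>i\<in>UNIV. \<beta> i) = \<nu>. hermite_tensor \<beta> x * hermite_tensor \<beta> y)"

text \<open>
  \<open>C\<^sup>\<infinity>[0,\<infinity>)\<close>, with one-sided derivatives at \<open>0\<close>; \<open>D k\<close> is the \<open>k\<close>-th derivative. Values of \<open>a\<close> at
  negative arguments are irrelevant here and below.
\<close>

definition smooth_halfline :: "(real \<Rightarrow> complex) \<Rightarrow> bool" where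
  "smooth_halfline a \<longleftrightarrow>
     (\<exists>D :: nat \<Rightarrow> real \<Rightarrow> complex. (\<forall>t\<ge>0. D 0 t = a t) \<and>
        (\<forall>k. \<forall>t\<ge>0. (D k has_vector_derivative D (Suc k) t) (at t within {0..})))"

definition hermite_admissible :: "(real \<Rightarrow> complex) \<Rightarrow> bool" where
  "hermite_admissible a \<longleftrightarrow>
     smooth_halfline a \<and> closure {t. 0 \<le> t \<and> a t \<noteq> 0} \<subseteq> {1/4..4} \<and>
     (\<exists>c>0. \<forall>t\<in>{1/3..3}. cmod (a t) > c)"

text \<open>By the support condition on \<open>a\<close>, the series has finitely many nonzero terms.\<close>

definition hermite_lp_kernel ::
  "(real \<Rightarrow> complex) \<Rightarrow> nat \<Rightarrow> real^'n \<Rightarrow> real^'n \<Rightarrow> complex" where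
  "hermite_lp_kernel a j x y =
     (if j = 0 then complex_of_real (hermite_kernel 0 x y)
      else (\<Sum>\<nu>. a (real \<nu> / 4 ^ (j - 1)) * complex_of_real (hermite_kernel \<nu> x y)))"

definition hermite_besov_qnorm ::
  "(real \<Rightarrow> complex) \<Rightarrow> real \<Rightarrow> real \<Rightarrow> real \<Rightarrow> ((real^'n \<Rightarrow> complex) \<Rightarrow> complex) \<Rightarrow> ennreal" where
  "hermite_besov_qnorm a \<alpha> p q f =
     besov_seq_qnorm \<alpha> p q (\<lambda>j. kernel_conv (hermite_lp_kernel a j) f)"

definition hermite_besov ::
  "(real \<Rightarrow> complex) \<Rightarrow> real \<Rightarrow> real \<Rightarrow> real \<Rightarrow> ((real^'n \<Rightarrow> complex) \<Rightarrow> complex) set" where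
  "hermite_besov a \<alpha> p q = {f. tempered_distribution f \<and> hermite_besov_qnorm a \<alpha> p q f < \<infinity>}"

end

theory Submission
  imports Defs "HOL-Probability.Probability"
begin

text \<open>
  The Hermite operator \<open>|x|\<^sup>2 - \<Delta>\<close> sees a Gaussian centred at \<open>z\<close> at frequency \<open>|z|\<^sup>2\<close>, whereas the classical
  Besov quasi-norm is translation invariant. So take \<open>f = (\<Sum>k. 2\<^sup>-\<^sup>k g\<^sub>k)\<close> with \<open>g\<^sub>k\<close> the Gaussian centred at
  \<open>sqrt 2 * 2\<^sup>B\<^sup>k\<close> on a coordinate axis. The Littlewood-Paley pieces of one Gaussian decay rapidly in space
  and in \<open>j\<close>, so \<open>f\<close> lies in every classical Besov space. The squared Hermite coefficients of \<open>g\<^sub>k\<close> are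
  proportional to Poisson weights with mean \<open>4\<^sup>B\<^sup>k\<close>; since the standard deviation \<open>2\<^sup>B\<^sup>k\<close> is small compared to the mean, the
  piece of index \<open>j = B k + 1\<close> of \<open>f\<close> is \<open>2\<^sup>-\<^sup>k a(1) g\<^sub>k\<close> up to an error of order \<open>2\<^sup>-\<^sup>B\<^sup>k\<close> in \<open>L\<^sup>2\<close>. Hence its
  \<open>L\<^sup>p\<close> quasi-norm is at least a constant times \<open>2\<^sup>-\<^sup>k\<close>, and the weight \<open>2\<^sup>\<alpha>\<^sup>j\<close> makes the terms unbounded once
  \<open>\<alpha> B \<ge> 2\<close>.
\<close>

section \<open>Gaussian packets\<close>

text \<open>The packets have exactly the width of the ground state \<open>hermite_fun 0\<close>;
  they are coherent states, and so their expansions are explicit. All centres lie on one axis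
  because in the remaining directions a packet is a multiple of the ground state; the pieces then
  factor and the Hermite side becomes one-dimensional. The factor sqrt 2 comes from the eigenvalue 2
  \<nu> + d of the Hermite operator: frequency |z|^2 means index \<nu> near |z|^2 / 2. The obstacle
  is that the piece aimed at the k-th packet sees all the other packets too. Since the scales grow
  at least by the factor 4, an index in the window of the k-th packet differs from any other Poisson
  mean by at least a constant times the product of the two scales. Unwanted packets and the spread
  of the wanted one are therefore controlled by the same variance. With B at least 2 the error 2^(-B
  k) is at most 4^(-k), of smaller order than the signal 2^(-k). Orthonormality gives this estimate
  in L^2 only; a local comparison near the centre transfers it to a lower bound in L^p.\<close>

lemma measurable_vec_lambda_PiM [measurable]:
  "(\<lambda>f. \<chi> i. f i) \<in> (\<Pi>\<^sub>M i\<in>(UNIV::'n::finite set). lborel) \<rightarrow>\<^sub>M (borel :: (real^'n) measure)"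
proof -
  have [measurable]: "(\<lambda>f. f i) \<in> borel_measurable (\<Pi>\<^sub>M i\<in>(UNIV::'n::finite set). (lborel :: real measure))" for i
    using measurable_component_singleton[of i UNIV "\<lambda>_. lborel :: real measure"] by simp
  show ?thesis
    by (subst borel_measurable_euclidean_space) (auto simp: Basis_vec_def inner_axis)
qed

text \<open>Gaussians, Hermite tensors and weights are all products over the coordinates, and this
  identity lets their integrals factor. Both measures agree on boxes, which determines
  \<open>lborel\<close>.\<close>

lemma lborel_vec_eq_distr:
  "(lborel :: (real^'n) measure) =
     distr (\<Pi>\<^sub>M i\<in>(UNIV::'n set). lborel) borel (\<lambda>f. \<chi> i. f i)"
proof -
  have inj: "inj (\<lambda>i::'n. axis i (1::real))"
    by (simp add: axis_eq_axis inj_on_def)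
  have Basis: "(Basis :: (real^'n) set) = range (\<lambda>i. axis i 1)"
    by (auto simp: Basis_vec_def)
  have "distr (\<Pi>\<^sub>M i\<in>(UNIV::'n set). lborel) borel (\<lambda>f. \<chi> i. f i) = (lborel :: (real^'n) measure)"
  proof (rule lborel_eqI[symmetric])
    fix l u :: "real^'n"
    assume le: "\<And>b. b \<in> Basis \<Longrightarrow> l \<bullet> b \<le> u \<bullet> b"
    have le': "l $ i \<le> u $ i" for i
      using le[of "axis i 1"] by (simp add: Basis inner_axis)
    interpret product_sigma_finite "\<lambda>i::'n. lborel :: real measure" by standard
    have *: "(\<lambda>f. \<chi> i. f i) -` box l u \<inter> space (\<Pi>\<^sub>M i\<in>(UNIV::'n set). lborel)
       = (\<Pi>\<^sub>E i\<in>UNIV. {l $ i<..<u $ i})"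
      by (auto simp: space_PiM mem_box_cart PiE_iff)
    have "emeasure (distr (\<Pi>\<^sub>M i\<in>(UNIV::'n set). lborel) borel (\<lambda>f. \<chi> i. f i)) (box l u)
       = (\<Prod>i\<in>UNIV. emeasure lborel {l $ i<..<u $ i})"
      by (subst emeasure_distr) (auto simp: * emeasure_PiM)
    also have "\<dots> = (\<Prod>i\<in>UNIV. ennreal (u $ i - l $ i))"
      using le' by (intro prod.cong) auto
    also have "\<dots> = ennreal (\<Prod>b\<in>Basis. (u - l) \<bullet> b)"
      unfolding Basis using le' by (subst prod.reindex[OF inj], subst prod_ennreal[symmetric]) (auto simp: inner_axis)
    finally show "emeasure (distr (\<Pi>\<^sub>M i\<in>(UNIV::'n set). lborel) borel (\<lambda>f. \<chi> i. f i)) (box l u)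
      = ennreal (\<Prod>b\<in>Basis. (u - l) \<bullet> b)" .
  qed simp
  then show ?thesis by simp
qed

lemma
  fixes f :: "'n::finite \<Rightarrow> real \<Rightarrow> 'b::{real_normed_field,banach,second_countable_topology}"
  assumes "\<And>i. integrable lborel (f i)"
  shows integrable_vec_prod: "integrable lborel (\<lambda>x::real^'n. \<Prod>i\<in>UNIV. f i (x $ i))" (is ?A)
    and integral_vec_prod: "(LINT x|lborel. (\<Prod>i\<in>UNIV. f i ((x::real^'n) $ i))) = (\<Prod>i\<in>UNIV. LINT t|lborel. f i t)" (is ?B)
proof -
  interpret product_sigma_finite "\<lambda>i::'n. lborel :: real measure" by standard
  have [measurable]: "f i \<in> borel_measurable borel" for i
    using borel_measurable_integrable[OF assms] by simp
  show ?A
    using product_integrable_prod[of UNIV f] assms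
    by (subst lborel_vec_eq_distr, subst integrable_distr_eq) simp_all
  show ?B
    using product_integral_prod[of UNIV f] assms
    by (subst lborel_vec_eq_distr, subst integral_distr) simp_all
qed

lemma nn_integral_vec_prod:
  fixes f :: "'n::finite \<Rightarrow> real \<Rightarrow> ennreal"
  assumes [measurable]: "\<And>i. f i \<in> borel_measurable borel"
  shows "(\<integral>\<^sup>+x. (\<Prod>i\<in>UNIV. f i ((x::real^'n) $ i)) \<partial>lborel) = (\<Prod>i\<in>UNIV. \<integral>\<^sup>+t. f i t \<partial>lborel)"
proof -
  interpret product_sigma_finite "\<lambda>i::'n. lborel :: real measure" by standard
  show ?thesis
    using product_nn_integral_prod[of UNIV f]
    by (subst lborel_vec_eq_distr, subst nn_integral_distr) simp_all
qed

section \<open>Gaussian bumps and summation of packets under the integral\<close>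

text \<open>A translate of the ground state \<open>hermite_fun 0\<close> up to normalisation. This
  choice of width makes the squared Hermite coefficients exactly Poisson in
  \<open>hcoeff_square\<close>.\<close>

definition gauss :: "real \<Rightarrow> real \<Rightarrow> real" where
  "gauss r t = exp (- ((t - r)\<^sup>2) / 2)"

definition bump :: "real^'n \<Rightarrow> real^'n \<Rightarrow> real" where
  "bump z x = (\<Prod>i\<in>UNIV. gauss (z $ i) (x $ i))"

text \<open>The centres \<open>z\<close> stay arbitrary throughout the classical part, which
  reflects translation invariance; they are specialised to an axis only for the Hermite
  pieces.\<close>

definition packets :: "(nat \<Rightarrow> real^'n) \<Rightarrow> real^'n \<Rightarrow> real" where
  "packets z x = (\<Sum>k. (1/2) ^ k * bump (z k) x)"

lemma gauss_measurable [measurable]: "gauss r \<in> borel_measurable borel"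
  unfolding gauss_def by measurable

lemma gauss_pos [simp]: "gauss r t > 0" "gauss r t \<ge> 0"
  by (simp_all add: gauss_def)

lemma gauss_le_1 [simp]: "gauss r t \<le> 1"
  by (simp add: gauss_def)

lemma gauss_eq_normal_density: "gauss r t = sqrt (2 * pi) * normal_density r 1 t"
  by (simp add: gauss_def normal_density_def)

lemma integrable_gauss [simp]: "integrable lborel (gauss r)"
  unfolding gauss_eq_normal_density[abs_def] by (intro integrable_mult_right) auto

lemma integral_gauss [simp]: "(LINT t|lborel. gauss r t) = sqrt (2 * pi)"
  unfolding gauss_eq_normal_density by simp

lemma bump_measurable [measurable]: "bump z \<in> borel_measurable borel"
  unfolding bump_def by measurable

lemma bump_nonneg [simp]: "bump z x \<ge> 0"
  by (simp add: bump_def prod_nonneg)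

lemma bump_le_1 [simp]: "bump z x \<le> 1"
  by (simp add: bump_def prod_le_1)

lemma integrable_bump [simp]: "integrable lborel (bump z)"
  unfolding bump_def by (rule integrable_vec_prod) simp

lemma integral_bump: "(LINT x|lborel. bump (z::real^'n) x) = sqrt (2 * pi) ^ CARD('n)"
  unfolding bump_def by (subst integral_vec_prod) auto

lemma bump_shift: "bump z x = bump 0 (x - z)"
  by (simp add: bump_def gauss_def)

lemma summable_packets [simp]: "summable (\<lambda>k. (1/2) ^ k * bump (z k) x)"
proof (rule summable_comparison_test'[where g = "\<lambda>k. (1/2::real) ^ k" and N = 0])
  show "norm ((1/2) ^ k * bump (z k) x) \<le> (1/2) ^ k" for k
    by (simp add: mult_left_le)
qed simp

lemma packets_measurable [measurable]: "packets z \<in> borel_measurable borel"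
  unfolding packets_def by measurable

text \<open>Serves every pairing with the packet sum: \<open>K\<close> will be a Schwartz function,
  a Littlewood-Paley kernel and a Hermite kernel, all bounded. The L^1 norms of the terms decay
  geometrically, whatever the centres, so sum and integral commute.\<close>

lemma
  fixes K :: "real^'n \<Rightarrow> complex"
  assumes [measurable]: "K \<in> borel_measurable borel" and K: "\<And>y. cmod (K y) \<le> B"
  shows integrable_packets: "integrable lborel (\<lambda>y. complex_of_real (packets z y) * K y)" (is ?A)
    and packets_sums:
      "(\<lambda>k. complex_of_real ((1/2) ^ k) * (LINT y|lborel. complex_of_real (bump (z k) y) * K y))
         sums (LINT y|lborel. complex_of_real (packets z y) * K y)" (is ?B)
    and norm_integral_packets_le:
      "cmod (LINT y|lborel. complex_of_real (packets z y) * K y) \<le> 2 * sqrt (2 * pi) ^ CARD('n) * B" (is ?C)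
proof -
  let ?f = "\<lambda>k y. complex_of_real ((1/2) ^ k * bump (z k) y) * K y"
  have B: "B \<ge> 0" using K[of undefined] norm_ge_zero order_trans by blast
  have nrm: "cmod (?f k y) \<le> (1/2) ^ k * B * bump (z k) y" for k y
    using K[of y] by (auto simp: norm_mult norm_power mult.commute[of B] intro!: mult_left_mono)
  have int0: "integrable lborel (\<lambda>y. (1/2) ^ k * B * bump (z k) y)" for k
    by simp
  have int: "integrable lborel (?f k)" for k
    by (rule Bochner_Integration.integrable_bound[OF int0[of k]]) (auto simp del: of_real_mult intro!: AE_I2 order_trans[OF nrm])
  have le: "(LINT y|lborel. cmod (?f k y)) \<le> (1/2) ^ k * (B * sqrt (2 * pi) ^ CARD('n))" for k
  proof -
    have "(LINT y|lborel. cmod (?f k y)) \<le> (LINT y|lborel. (1/2) ^ k * B * bump (z k) y)"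
      by (rule integral_mono[OF integrable_norm[OF int] int0 nrm])
    then show ?thesis by (simp add: integral_bump mult_ac)
  qed
  have s1: "summable (\<lambda>k. cmod (?f k y))" for y
    by (rule summable_comparison_test'[where g = "\<lambda>k. (1/2::real) ^ k * B" and N = 0])
       (auto intro!: order_trans[OF nrm] mult_left_le summable_mult2 simp del: of_real_mult simp: B)
  have s2: "summable (\<lambda>k. LINT y|lborel. cmod (?f k y))"
    by (rule summable_comparison_test'[where g = "\<lambda>k. (1/2::real) ^ k * (B * sqrt (2 * pi) ^ CARD('n))" and N = 0])
       (use le in \<open>auto simp del: of_real_mult intro!: summable_mult2\<close>)
  have eq: "(\<Sum>k. ?f k y) = complex_of_real (packets z y) * K y" for y
  proof -
    have "(\<lambda>k. ?f k y) sums (complex_of_real (packets z y) * K y)"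
      unfolding packets_def by (intro sums_mult2 sums_of_real summable_sums summable_packets)
    then show ?thesis by (rule sums_unique[symmetric])
  qed
  show ?A
    using integrable_suminf[OF int AE_I2[OF s1] s2] unfolding eq .
  show B: ?B
    using sums_integral[OF int AE_I2[OF s1] s2] unfolding eq by (simp add: mult.assoc)
  have "cmod (LINT y|lborel. complex_of_real (packets z y) * K y)
      \<le> (\<Sum>k. (1/2) ^ k * (B * sqrt (2 * pi) ^ CARD('n)))"
    unfolding sums_unique[OF B]
  proof (rule norm_suminf_le)
    show "cmod (complex_of_real ((1/2) ^ k) * (LINT y|lborel. complex_of_real (bump (z k) y) * K y))
       \<le> (1/2) ^ k * (B * sqrt (2 * pi) ^ CARD('n))" for k
      using order_trans[OF integral_norm_bound[of lborel "?f k"] le[of k]] by (simp add: mult.assoc)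
  qed (intro summable_mult2, simp)
  also have "\<dots> = 2 * sqrt (2 * pi) ^ CARD('n) * B"
    by (subst suminf_mult2[symmetric]) (auto simp: suminf_geometric)
  finally show ?C .
qed

section \<open>The packet sum as a tempered distribution\<close>

lemma schwartz_measurable:
  assumes "\<phi> \<in> schwartz" shows "\<phi> \<in> borel_measurable borel"
proof -
  have "\<phi> differentiable (at x)" for x
    using assms by (auto simp: schwartz_def smooth_def partials_def dest!: spec[of _ "[]"])
  then have "continuous_on UNIV \<phi>"
    by (intro continuous_at_imp_continuous_on ballI differentiable_imp_continuous_within)
  then show ?thesis by (rule borel_measurable_continuous_onI)
qed

lemma schwartz_norm_le:
  assumes "\<phi> \<in> schwartz" shows "cmod (\<phi> x) \<le> schwartz_seminorm (\<lambda>_. 0) [] \<phi>"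
proof -
  have "bdd_above (range (\<lambda>x. cmod (monomial (\<lambda>_. 0) x *\<^sub>R partials [] \<phi> x)))"
    using assms by (auto simp only: schwartz_def mem_Collect_eq)
  from cSUP_upper[OF UNIV_I this, of x] show ?thesis
    by (simp add: schwartz_seminorm_def monomial_def partials_def)
qed

text \<open>The packet sum is in L^1, so the pairing is already continuous for the sup norm, which
  is the seminorm with trivial monomial and no derivatives.\<close>

lemma tempered_function_packets: "tempered_function (\<lambda>x. complex_of_real (packets z x))"
  unfolding tempered_function_def
proof (intro conjI ballI)
  have int: "integrable lborel (\<lambda>x. complex_of_real (packets z x) * \<phi> x)" if "\<phi> \<in> schwartz" for \<phi>
    using schwartz_measurable[OF that] schwartz_norm_le[OF that] by (rule integrable_packets)
  then show "\<phi> \<in> schwartz \<Longrightarrow> integrable lborel (\<lambda>x. complex_of_real (packets z x) * \<phi> x)" for \<phi> .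
  show "tempered_distribution (dist_of_fun (\<lambda>x. complex_of_real (packets z x)))"
    unfolding tempered_distribution_def dist_of_fun_def
  proof (intro conjI ballI allI impI)
    show "(LINT x|lborel. complex_of_real (packets z x) * (\<phi> x + \<psi> x)) =
       (LINT x|lborel. complex_of_real (packets z x) * \<phi> x) + (LINT x|lborel. complex_of_real (packets z x) * \<psi> x)"
      if "\<phi> \<in> schwartz" "\<psi> \<in> schwartz" for \<phi> \<psi>
      using int[OF that(1)] int[OF that(2)] by (simp add: distrib_left)
    show "(LINT x|lborel. complex_of_real (packets z x) * (c * \<phi> x)) =
       c * (LINT x|lborel. complex_of_real (packets z x) * \<phi> x)" for c \<phi>
      by (subst integral_mult_right_zero[symmetric]) (simp add: mult_ac)
    fix u :: "nat \<Rightarrow> real^'a \<Rightarrow> complex"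
    assume u: "\<forall>k. u k \<in> schwartz" and lim: "\<forall>\<gamma> is. (\<lambda>k. schwartz_seminorm \<gamma> is (u k)) \<longlonglongrightarrow> 0"
    let ?S = "\<lambda>k. schwartz_seminorm (\<lambda>_. 0) [] (u k)"
    have lim0: "(\<lambda>k. 2 * sqrt (2 * pi) ^ CARD('a) * ?S k) \<longlonglongrightarrow> 0"
      using lim by (intro tendsto_mult_right_zero) auto
    have "\<forall>\<^sub>F k in sequentially. cmod (LINT x|lborel. complex_of_real (packets z x) * u k x) \<le> 2 * sqrt (2 * pi) ^ CARD('a) * ?S k"
      using u by (intro always_eventually allI norm_integral_packets_le schwartz_measurable schwartz_norm_le) auto
    from Lim_null_comparison[OF this lim0] show "(\<lambda>k. LINT x|lborel. complex_of_real (packets z x) * u k x) \<longlonglongrightarrow> 0"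
      .
  qed
qed simp

section \<open>Littlewood-Paley pieces of Gaussian packets\<close>

lemma lborel_integral_affine:
  fixes f :: "'a::euclidean_space \<Rightarrow> 'b::{banach, second_countable_topology}"
  assumes c: "c \<noteq> 0" and [measurable]: "f \<in> borel_measurable borel"
  shows "(LINT x|lborel. f x) = \<bar>c\<bar> ^ DIM('a) *\<^sub>R (LINT x|lborel. f (t + c *\<^sub>R x))"
  by (subst lborel_affine[OF c, of t]) (simp add: integral_density integral_distr)

lemma lborel_integral_shift:
  fixes f :: "'a::euclidean_space \<Rightarrow> 'b::{banach, second_countable_topology}"
  assumes [measurable]: "f \<in> borel_measurable borel"
  shows "(LINT x|lborel. f (t + x)) = (LINT x|lborel. f x)"
  using lborel_integral_affine[of 1 f t] by simp

lemma lborel_integrable_shift: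
  fixes f :: "'a::euclidean_space \<Rightarrow> 'b::{banach, second_countable_topology}"
  assumes "integrable lborel f"
  shows "integrable lborel (\<lambda>x. f (t + x))"
proof -
  have [measurable]: "f \<in> borel_measurable borel" using assms by simp
  show ?thesis
    using assms integrable_distr_eq[of "(+) t" lborel borel f] by (simp add: lborel_distr_plus)
qed

lemma has_vector_derivative_quotient:
  assumes "(f has_vector_derivative D) (at (0::real))"
  shows "((\<lambda>t. (f t - f 0) /\<^sub>R t) \<longlongrightarrow> D) (at 0)"
proof -
  have "((\<lambda>t. norm (f t - f 0 - t *\<^sub>R D) / norm t) \<longlongrightarrow> 0) (at 0)"
    using assms by (simp add: has_vector_derivative_def has_derivative_iff_norm)
  then have "((\<lambda>t. norm ((f t - f 0) /\<^sub>R t - D)) \<longlongrightarrow> 0) (at 0)"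
  proof (rule Lim_transform_eventually)
    have "norm (f t - f 0 - t *\<^sub>R D) / norm t = norm ((f t - f 0) /\<^sub>R t - D)" if "t \<noteq> 0" for t
    proof -
      have "(f t - f 0) /\<^sub>R t - D = (f t - f 0 - t *\<^sub>R D) /\<^sub>R t"
        using that by (simp add: scaleR_diff_right)
      then show ?thesis by (simp add: divide_inverse mult.commute)
    qed
    then show "\<forall>\<^sub>F t in at 0. norm (f t - f 0 - t *\<^sub>R D) / norm t = norm ((f t - f 0) /\<^sub>R t - D)"
      by (auto simp: eventually_at_filter)
  qed
  then show ?thesis
    by (simp add: tendsto_norm_zero_iff LIM_zero_iff)
qed

lemma smooth_differentiable: "smooth g \<Longrightarrow> g differentiable (at x)"
  by (auto simp: smooth_def partials_def dest!: spec[of _ "[]"])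

lemma smooth_continuous: "smooth g \<Longrightarrow> continuous_on S g"
  by (intro continuous_at_imp_continuous_on ballI differentiable_imp_continuous_within smooth_differentiable)

lemma smooth_measurable: "smooth g \<Longrightarrow> g \<in> borel_measurable borel"
  by (intro borel_measurable_continuous_onI smooth_continuous)

lemma smooth_partial: "smooth g \<Longrightarrow> smooth (partial i g)"
  unfolding smooth_def
proof (intro allI)
  fix "is" x assume "\<forall>is x. partials is g differentiable (at x)"
  then have "partials (is @ [i]) g differentiable (at x)" by blast
  then show "partials is (partial i g) differentiable (at x)" by (simp add: partials_def)
qed

lemma has_vector_derivative_partial:
  assumes "smooth g"
  shows "((\<lambda>t. g (x + t *\<^sub>R axis i 1)) has_vector_derivative partial i g (x + s *\<^sub>R axis i 1)) (at s within S)"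
proof -
  let ?y = "x + s *\<^sub>R axis i 1"
  have "(g has_derivative frechet_derivative g (at ?y)) (at ?y)"
    using smooth_differentiable[OF assms] frechet_derivative_works by blast
  then have "((\<lambda>t. g (x + t *\<^sub>R axis i 1)) has_derivative (\<lambda>h. frechet_derivative g (at ?y) (h *\<^sub>R axis i 1))) (at s)"
    by (rule has_derivative_compose[rotated]) (auto intro!: derivative_eq_intros)
  moreover have "linear (frechet_derivative g (at ?y))"
    by (rule linear_frechet_derivative[OF smooth_differentiable[OF assms]])
  ultimately show ?thesis
    unfolding has_vector_derivative_def partial_def by (auto simp: linear_scale intro: has_derivative_at_withinI)
qed

lemma partial_eq_0_outside:
  assumes "\<And>\<xi>. r < norm \<xi> \<Longrightarrow> g \<xi> = 0" and "r < norm \<xi>"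
  shows "partial i g \<xi> = 0"
proof -
  have "(g has_derivative (\<lambda>_. 0)) (at \<xi>)"
  proof (rule has_derivative_transform_within_open)
    show "((\<lambda>_. 0) has_derivative (\<lambda>_. 0)) (at \<xi>)" by simp
    show "open (- cball 0 r)" by auto
  qed (use assms in auto)
  then have "frechet_derivative g (at \<xi>) = (\<lambda>_. 0)"
    using frechet_derivative_at by metis
  then show ?thesis by (simp add: partial_def)
qed

lemma compact_support_bounded:
  fixes g :: "real^'n \<Rightarrow> complex"
  assumes "continuous_on UNIV g" and "\<And>\<xi>. r < norm \<xi> \<Longrightarrow> g \<xi> = 0"
  obtains B where "B > 0" "\<And>\<xi>. cmod (g \<xi>) \<le> B"
proof -
  have "compact (g ` cball 0 r)"
    using assms(1) by (intro compact_continuous_image) (auto intro: continuous_on_subset)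
  then obtain B where B: "B > 0" "\<And>\<xi>. norm \<xi> \<le> r \<Longrightarrow> cmod (g \<xi>) \<le> B"
    using compact_imp_bounded[of "g ` cball 0 r"] by (auto simp: bounded_pos)
  have "cmod (g \<xi>) \<le> B" for \<xi>
    using B assms(2)[of \<xi>] by (cases "norm \<xi> \<le> r") auto
  with B(1) show ?thesis by (rule that)
qed

lemma compact_support_integrable:
  fixes g :: "real^'n \<Rightarrow> complex"
  assumes "continuous_on UNIV g" and "\<And>\<xi>. r < norm \<xi> \<Longrightarrow> g \<xi> = 0"
  shows "integrable lborel g"
proof -
  have "integrable lborel (\<lambda>x. indicator (cball 0 r) x *\<^sub>R g x)"
    by (rule borel_integrable_compact) (auto intro: continuous_on_subset[OF assms(1)])
  moreover have "(\<lambda>x. indicator (cball 0 r) x *\<^sub>R g x) = g"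
    using assms(2) by (auto simp: fun_eq_iff indicator_def not_le)
  ultimately show ?thesis by simp
qed

lemma integrable_mult_cis:
  assumes "integrable lborel (g :: real^'n \<Rightarrow> complex)"
  shows "integrable lborel (\<lambda>\<xi>. g \<xi> * cis (x \<bullet> \<xi>))"
proof -
  have [measurable]: "g \<in> borel_measurable borel" using assms by simp
  show ?thesis
    by (rule Bochner_Integration.integrable_bound[OF assms]) (auto simp: norm_mult cis_conv_exp)
qed

text \<open>Difference quotients turn into the multiplier \<open>(cis (- h x\<^sub>i) - 1) / h\<close> by translation invariance.\<close>

lemma inv_fourier_partial:
  fixes g :: "real^'n \<Rightarrow> complex"
  assumes sm: "smooth g" and supp: "\<And>\<xi>. r < norm \<xi> \<Longrightarrow> g \<xi> = 0"
  shows "inv_fourier (partial i g) x = - \<i> * complex_of_real (x $ i) * inv_fourier g x"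
proof -
  define e :: "real^'n" where "e = axis i 1"
  \<comment> \<open>Discrete step sizes, so that dominated convergence applies to a sequence;
    \<open>h n \<le> 1\<close> keeps all difference quotients supported in the ball of radius
    \<open>r + 1\<close>.\<close>
  define h where "h n = inverse (real (Suc n))" for n
  have h: "0 < h n" "h n \<le> 1" for n by (auto simp: h_def field_simps)
  have h0: "filterlim h (at 0) sequentially"
    unfolding filterlim_at using h LIMSEQ_inverse_real_of_nat by (auto simp: h_def[abs_def] intro!: always_eventually)
  define Q where "Q n \<xi> = (g (h n *\<^sub>R e + \<xi>) - g \<xi>) /\<^sub>R h n * cis (x \<bullet> \<xi>)" for n \<xi>
  have [measurable]: "g \<in> borel_measurable borel" "partial i g \<in> borel_measurable borel"
    using sm by (auto intro: smooth_measurable smooth_partial)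
  have ig: "integrable lborel g"
    by (rule compact_support_integrable[OF smooth_continuous[OF sm] supp])
  obtain B where B: "B > 0" "\<And>\<xi>. cmod (partial i g \<xi>) \<le> B"
  proof (rule compact_support_bounded)
    show "continuous_on UNIV (partial i g)" by (rule smooth_continuous[OF smooth_partial[OF sm]])
    show "r < norm \<xi> \<Longrightarrow> partial i g \<xi> = 0" for \<xi> by (rule partial_eq_0_outside[OF supp])
  qed blast
  have deriv: "((\<lambda>t. g (\<xi> + t *\<^sub>R e)) has_vector_derivative partial i g (\<xi> + s *\<^sub>R e)) (at s within S)" for \<xi> s S
    unfolding e_def by (rule has_vector_derivative_partial[OF sm])
  have incr: "cmod (g (h n *\<^sub>R e + \<xi>) - g \<xi>) \<le> B * h n" for n \<xi>
  proof -
    have "cmod (g (\<xi> + h n *\<^sub>R e) - g (\<xi> + 0 *\<^sub>R e)) \<le> B * norm (h n - 0)"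
    proof (rule differentiable_bound[where S = "{0..h n}"])
      show "((\<lambda>t. g (\<xi> + t *\<^sub>R e)) has_derivative (\<lambda>t. t *\<^sub>R partial i g (\<xi> + s *\<^sub>R e))) (at s within {0..h n})" for s
        using deriv unfolding has_vector_derivative_def .
      show "onorm (\<lambda>t. t *\<^sub>R partial i g (\<xi> + s *\<^sub>R e)) \<le> B" for s
        using B by (intro onorm_le) (auto simp: mult.commute[of B] intro!: mult_left_mono)
    qed (use h[of n] in auto)
    then show ?thesis using h[of n] by (simp add: add.commute)
  qed
  have dom: "cmod (Q n \<xi>) \<le> B * indicator (cball 0 (r + 1)) \<xi>" for n \<xi>
  proof (cases "norm \<xi> \<le> r + 1")
    case True
    have "cmod (Q n \<xi>) = cmod (g (h n *\<^sub>R e + \<xi>) - g \<xi>) / h n"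
      using h[of n] by (simp add: Q_def norm_mult cis_conv_exp divide_inverse mult.commute)
    also have "\<dots> \<le> B" using incr[of n \<xi>] h[of n] by (simp add: divide_le_eq)
    finally show ?thesis using True by simp
  next
    case False
    have "norm \<xi> \<le> norm (h n *\<^sub>R e + \<xi>) + norm (h n *\<^sub>R e)"
      by (metis add_diff_cancel_left' norm_triangle_ineq4 add.commute)
    moreover have "norm (h n *\<^sub>R e) \<le> 1" using h[of n] by (simp add: e_def)
    ultimately have "norm (h n *\<^sub>R e + \<xi>) > r" using False by linarith
    then show ?thesis using False supp by (simp add: Q_def)
  qed
  have conv: "(\<lambda>n. Q n \<xi>) \<longlonglongrightarrow> partial i g \<xi> * cis (x \<bullet> \<xi>)" for \<xi>
  proof -
    have "((\<lambda>t. (g (\<xi> + t *\<^sub>R e) - g \<xi>) /\<^sub>R t) \<longlongrightarrow> partial i g \<xi>) (at 0)"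
      using has_vector_derivative_quotient[OF deriv[of \<xi> 0 UNIV]] by simp
    from filterlim_compose[OF this h0] show ?thesis
      unfolding Q_def by (intro tendsto_mult) (simp_all add: add.commute)
  qed
  have "(\<lambda>n. LINT \<xi>|lborel. Q n \<xi>) \<longlonglongrightarrow> (LINT \<xi>|lborel. partial i g \<xi> * cis (x \<bullet> \<xi>))"
  proof (rule integral_dominated_convergence[where w = "\<lambda>\<xi>. B * indicator (cball 0 (r + 1)) \<xi>"])
    show "integrable lborel (\<lambda>\<xi>. B * indicator (cball 0 (r + 1)) \<xi> :: real)"
      by (intro integrable_mult_right integrable_real_indicator) (use emeasure_lborel_cball_finite[of 0 "r + 1"] in auto)
    show "Q n \<in> borel_measurable lborel" for n
      unfolding Q_def cis_conv_exp by measurable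
    show "(\<lambda>\<xi>. partial i g \<xi> * cis (x \<bullet> \<xi>)) \<in> borel_measurable lborel"
      unfolding cis_conv_exp by measurable
  qed (use conv dom in auto)
  moreover have "(LINT \<xi>|lborel. Q n \<xi>) = (cis (- (h n * x $ i)) - 1) /\<^sub>R h n * (LINT \<xi>|lborel. g \<xi> * cis (x \<bullet> \<xi>))" for n
  proof -
    let ?u = "\<lambda>\<xi>. g \<xi> * cis (x \<bullet> (\<xi> - h n *\<^sub>R e))"
    have eq: "?u \<xi> = cis (- (h n * x $ i)) * (g \<xi> * cis (x \<bullet> \<xi>))" for \<xi>
      by (simp add: inner_diff_right e_def inner_axis cis_mult mult_ac)
    have [measurable]: "?u \<in> borel_measurable borel" unfolding cis_conv_exp by measurable
    have i1: "integrable lborel ?u" unfolding eq by (intro integrable_mult_right integrable_mult_cis ig)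
    have sh: "(LINT \<xi>|lborel. ?u (h n *\<^sub>R e + \<xi>)) = (LINT \<xi>|lborel. ?u \<xi>)"
      by (rule lborel_integral_shift) measurable
    have i2: "integrable lborel (\<lambda>\<xi>. ?u (h n *\<^sub>R e + \<xi>))"
      using lborel_integrable_shift[OF i1] .
    have "(LINT \<xi>|lborel. Q n \<xi>) = (LINT \<xi>|lborel. (?u (h n *\<^sub>R e + \<xi>) - g \<xi> * cis (x \<bullet> \<xi>)) /\<^sub>R h n)"
      by (simp add: Q_def left_diff_distrib)
    also have "\<dots> = ((LINT \<xi>|lborel. ?u \<xi>) - (LINT \<xi>|lborel. g \<xi> * cis (x \<bullet> \<xi>))) /\<^sub>R h n"
      by (subst integral_scaleR_right, subst Bochner_Integration.integral_diff[OF i2 integrable_mult_cis[OF ig]], subst sh) simp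
    finally show ?thesis
      unfolding eq by (simp add: left_diff_distrib)
  qed
  moreover have "(\<lambda>n. (cis (- (h n * x $ i)) - 1) /\<^sub>R h n * (LINT \<xi>|lborel. g \<xi> * cis (x \<bullet> \<xi>)))
     \<longlonglongrightarrow> (- \<i> * complex_of_real (x $ i)) * (LINT \<xi>|lborel. g \<xi> * cis (x \<bullet> \<xi>))"
  proof (intro tendsto_mult tendsto_const)
    have "((\<lambda>z. exp (- (\<i> * complex_of_real (x $ i) * z))) has_field_derivative (- \<i> * complex_of_real (x $ i))) (at (complex_of_real 0))"
      by (auto intro!: derivative_eq_intros)
    from has_vector_derivative_real_field[OF this]
    have "((\<lambda>t. cis (- (t * x $ i))) has_vector_derivative (- \<i> * complex_of_real (x $ i))) (at 0)"
      by (simp add: cis_conv_exp mult_ac)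
    from has_vector_derivative_quotient[OF this]
    have "((\<lambda>t. (cis (- (t * x $ i)) - 1) /\<^sub>R t) \<longlongrightarrow> - \<i> * complex_of_real (x $ i)) (at 0)"
      by simp
    from filterlim_compose[OF this h0]
    show "(\<lambda>n. (cis (- (h n * x $ i)) - 1) /\<^sub>R h n) \<longlonglongrightarrow> - \<i> * complex_of_real (x $ i)" .
  qed
  ultimately have "(LINT \<xi>|lborel. partial i g \<xi> * cis (x \<bullet> \<xi>))
      = (- \<i> * complex_of_real (x $ i)) * (LINT \<xi>|lborel. g \<xi> * cis (x \<bullet> \<xi>))"
    using LIMSEQ_unique by simp
  then show ?thesis unfolding inv_fourier_def by (simp add: mult_ac)
qed

lemma norm_inv_fourier_le:
  fixes g :: "real^'n \<Rightarrow> complex"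
  shows "cmod (inv_fourier g x) \<le> (LINT \<xi>|lborel. cmod (g \<xi>)) / (2 * pi) ^ CARD('n)"
proof -
  have "cmod (LINT \<xi>|lborel. g \<xi> * cis (x \<bullet> \<xi>)) \<le> (LINT \<xi>|lborel. cmod (g \<xi> * cis (x \<bullet> \<xi>)))"
    by (rule integral_norm_bound)
  then show ?thesis
    by (simp add: inv_fourier_def norm_mult norm_divide norm_power divide_right_mono)
qed

lemma inv_fourier_partial_power:
  fixes g :: "real^'n \<Rightarrow> complex"
  assumes "smooth g" and "\<And>\<xi>. r < norm \<xi> \<Longrightarrow> g \<xi> = 0"
  shows "smooth ((partial i ^^ M) g)" "r < norm \<xi> \<Longrightarrow> (partial i ^^ M) g \<xi> = 0"
    "inv_fourier ((partial i ^^ M) g) x = (- \<i> * complex_of_real (x $ i)) ^ M * inv_fourier g x"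
proof (induction M arbitrary: \<xi>)
  case (Suc M)
  { case 1 show ?case using Suc.IH(1) by (simp add: smooth_partial) }
  { case 2 then show ?case using partial_eq_0_outside[OF Suc.IH(2)] by simp }
  { case 3 show ?case using inv_fourier_partial[OF Suc.IH(1,2)] Suc.IH(3) by (simp add: mult_ac) }
qed (use assms in auto)

text \<open>Each derivative of the symbol in direction \<open>i\<close> is a factor of modulus
  \<open>\<bar>x $ i\<bar>\<close> in space, and an inverse transform is bounded by the L^1 norm of
  its symbol. Summing over \<open>i\<close> gives one constant for all coordinates.\<close>

lemma inv_fourier_decay:
  fixes g :: "real^'n \<Rightarrow> complex"
  assumes "smooth g" and "\<And>\<xi>. r < norm \<xi> \<Longrightarrow> g \<xi> = 0"
  obtains C where "C \<ge> 0" "\<And>x i. \<bar>x $ i\<bar> ^ M * cmod (inv_fourier g x) \<le> C"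
proof
  let ?c = "\<lambda>i. (LINT \<xi>|lborel. cmod ((partial i ^^ M) g \<xi>)) / (2 * pi) ^ CARD('n)"
  have nn: "?c i \<ge> 0" for i by (intro divide_nonneg_nonneg integral_nonneg_AE) auto
  then show "(\<Sum>i\<in>UNIV. ?c i) \<ge> 0" by (rule sum_nonneg)
  show "\<bar>x $ i\<bar> ^ M * cmod (inv_fourier g x) \<le> (\<Sum>i\<in>UNIV. ?c i)" for x i
  proof -
    have "\<bar>x $ i\<bar> ^ M * cmod (inv_fourier g x) = cmod (inv_fourier ((partial i ^^ M) g) x)"
      by (simp add: inv_fourier_partial_power(3)[OF assms] norm_mult norm_power)
    also have "\<dots> \<le> ?c i" by (rule norm_inv_fourier_le)
    also have "\<dots> \<le> (\<Sum>i\<in>UNIV. ?c i)" using nn by (intro member_le_sum) auto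
    finally show ?thesis .
  qed
qed

lemma inv_fourier_measurable [measurable]:
  assumes [measurable]: "g \<in> borel_measurable borel"
  shows "inv_fourier g \<in> borel_measurable borel"
  unfolding inv_fourier_def cis_conv_exp by measurable

lemma inv_fourier_dilate:
  fixes g :: "real^'n \<Rightarrow> complex"
  assumes c: "c > 0" and [measurable]: "g \<in> borel_measurable borel"
  shows "inv_fourier (\<lambda>\<xi>. g ((1 / c) *\<^sub>R \<xi>)) x = c ^ CARD('n) *\<^sub>R inv_fourier g (c *\<^sub>R x)"
proof -
  have "(LINT \<xi>|lborel. g ((1 / c) *\<^sub>R \<xi>) * cis (x \<bullet> \<xi>))
      = \<bar>c\<bar> ^ DIM(real^'n) *\<^sub>R (LINT \<xi>|lborel. g ((1 / c) *\<^sub>R (0 + c *\<^sub>R \<xi>)) * cis (x \<bullet> (0 + c *\<^sub>R \<xi>)))"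
    by (rule lborel_integral_affine) (use c in \<open>simp, unfold cis_conv_exp, measurable\<close>)
  moreover have "x \<bullet> (0 + c *\<^sub>R \<xi>) = (c *\<^sub>R x) \<bullet> \<xi>" "(1 / c) *\<^sub>R (0 + c *\<^sub>R \<xi>) = \<xi>" for \<xi>
    using c by simp_all
  ultimately show ?thesis using c by (simp only: inv_fourier_def) (simp add: scaleR_conv_of_real)
qed

section \<open>Littlewood-Paley kernels\<close>

locale resolution =
  fixes \<phi> :: "real^'n \<Rightarrow> complex"
  assumes resolution: "resolution_generator \<phi>"
begin

lemma smooth: "smooth \<phi>"
  and eq_1: "norm \<xi> \<le> 1 \<Longrightarrow> \<phi> \<xi> = 1"
  and eq_0: "2 < norm \<xi> \<Longrightarrow> \<phi> \<xi> = 0"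
proof -
  have "closure {\<xi>. \<phi> \<xi> \<noteq> 0} \<subseteq> cball 0 2" using resolution by (simp add: resolution_generator_def)
  then have "\<phi> \<xi> \<noteq> 0 \<Longrightarrow> norm \<xi> \<le> 2" for \<xi>
    using closure_subset[of "{\<xi>. \<phi> \<xi> \<noteq> 0}"] by auto
  then show "2 < norm \<xi> \<Longrightarrow> \<phi> \<xi> = 0" by force
qed (use resolution in \<open>auto simp: resolution_generator_def\<close>)

lemma measurable_gen [measurable]: "\<phi> \<in> borel_measurable borel"
  by (rule smooth_measurable[OF smooth])

lemma dyadic_piece_measurable [measurable]: "dyadic_piece \<phi> j \<in> borel_measurable borel"
  unfolding dyadic_piece_def by measurable

lemma integrable_dilate: "c \<noteq> 0 \<Longrightarrow> integrable lborel (\<lambda>\<xi>. \<phi> (c *\<^sub>R \<xi>))"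
proof (rule compact_support_integrable)
  show "continuous_on UNIV (\<lambda>\<xi>. \<phi> (c *\<^sub>R \<xi>))"
    by (rule continuous_on_compose2[OF smooth_continuous[OF smooth]]) (auto intro!: continuous_intros)
  show "2 / \<bar>c\<bar> < norm \<xi> \<Longrightarrow> \<phi> (c *\<^sub>R \<xi>) = 0" if "c \<noteq> 0" for \<xi>
    using that by (intro eq_0) (simp add: field_simps)
qed

lemma integrable_dyadic_piece: "integrable lborel (dyadic_piece \<phi> j)"
proof (cases "j = 0")
  case True
  then show ?thesis using integrable_dilate[of 1] by (simp add: dyadic_piece_def[abs_def])
next
  case False
  then show ?thesis
    unfolding dyadic_piece_def[abs_def] using integrable_dilate by (auto intro!: Bochner_Integration.integrable_diff)
qed

lemma inv_fourier_dyadic_piece: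
  "j \<noteq> 0 \<Longrightarrow> inv_fourier (dyadic_piece \<phi> j) x
     = (2 ^ j) ^ CARD('n) *\<^sub>R inv_fourier \<phi> ((2 ^ j) *\<^sub>R x)
       - (2 ^ (j - 1)) ^ CARD('n) *\<^sub>R inv_fourier \<phi> ((2 ^ (j - 1)) *\<^sub>R x)"
  using inv_fourier_dilate[of "2 ^ j" \<phi> x] inv_fourier_dilate[of "2 ^ (j - 1)" \<phi> x]
  by (simp add: inv_fourier_def dyadic_piece_def left_diff_distrib integrable_mult_cis integrable_dilate
      right_diff_distrib flip: of_real_power of_real_mult)

text \<open>For \<open>j > 0\<close> the kernel is a difference of two dilates of
  \<open>inv_fourier \<phi>\<close>. The dilation factors are at least 1, so the decay in
  \<open>x\<close> persists and only the normalising power of the dilation is lost. The crude growth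
  in \<open>j\<close> is later outweighed by \<open>bump_piece_small\<close>.\<close>

lemma dyadic_kernel_decay:
  obtains C where "C \<ge> 0"
    "\<And>j x i. \<bar>x $ i\<bar> ^ M * cmod (inv_fourier (dyadic_piece \<phi> j) x) \<le> C * 2 ^ (j * CARD('n))"
proof -
  obtain C where C: "C \<ge> 0" "\<And>x i. \<bar>x $ i\<bar> ^ M * cmod (inv_fourier \<phi> x) \<le> C"
    using inv_fourier_decay[OF smooth eq_0] by blast
  show ?thesis
  proof
    fix j x i
    have dil: "\<bar>x $ i\<bar> ^ M * cmod ((2 ^ m) ^ CARD('n) *\<^sub>R inv_fourier \<phi> ((2 ^ m) *\<^sub>R x)) \<le> 2 ^ (j * CARD('n)) * C"
      if "m \<le> j" for m
    proof -
      have "1 * \<bar>x $ i\<bar> \<le> 2 ^ m * \<bar>x $ i\<bar>" by (intro mult_right_mono) auto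
      then have "\<bar>x $ i\<bar> ^ M \<le> \<bar>(2 ^ m *\<^sub>R x) $ i\<bar> ^ M" by (intro power_mono) (auto simp: abs_mult)
      then have "\<bar>x $ i\<bar> ^ M * cmod (inv_fourier \<phi> ((2 ^ m) *\<^sub>R x)) \<le> C"
        by (rule order_trans[OF mult_right_mono C(2)]) simp
      then have "(2 ^ m) ^ CARD('n) * (\<bar>x $ i\<bar> ^ M * cmod (inv_fourier \<phi> ((2 ^ m) *\<^sub>R x))) \<le> 2 ^ (j * CARD('n)) * C"
        using that C(1) by (intro mult_mono) (auto simp: power_mult power_mono)
      then show ?thesis by (simp add: mult_ac)
    qed
    show "\<bar>x $ i\<bar> ^ M * cmod (inv_fourier (dyadic_piece \<phi> j) x) \<le> (2 * C) * 2 ^ (j * CARD('n))"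
    proof (cases "j = 0")
      case True
      then have "dyadic_piece \<phi> j = \<phi>" by (simp add: dyadic_piece_def fun_eq_iff)
      then show ?thesis using True order_trans[OF C(2)[of x i], of "2 * C"] C(1) by simp
    next
      case False
      show ?thesis
        unfolding inv_fourier_dyadic_piece[OF False]
        using mult_left_mono[OF norm_triangle_ineq4, of "\<bar>x $ i\<bar> ^ M"] dil[of j] dil[of "j - 1"]
        by (smt (verit) distrib_left mult.commute diff_le_self order_refl zero_le_power abs_ge_zero)
    qed
  qed (use C in simp)
qed

lemma kernel_bounded: obtains B where "\<And>x. cmod (inv_fourier (dyadic_piece \<phi> j) x) \<le> B"
  using dyadic_kernel_decay[of 0] by (metis mult_1 power_0)

definition bump_piece :: "nat \<Rightarrow> real^'n \<Rightarrow> complex" where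
  "bump_piece j x = (LINT y|lborel. complex_of_real (bump 0 y) * inv_fourier (dyadic_piece \<phi> j) (x - y))"

end

section \<open>Pieces of a single Gaussian: decay in space and in \<open>j\<close>\<close>

lemma integrable_moment_gauss: "integrable lborel (\<lambda>t. \<bar>t\<bar> ^ M * gauss 0 t)"
proof -
  have "(\<lambda>t. \<bar>t\<bar> ^ M * gauss 0 t) = (\<lambda>t. sqrt (2 * pi) * (std_normal_density t * \<bar>t\<bar> ^ M))"
    by (simp add: gauss_eq_normal_density fun_eq_iff)
  then show ?thesis using integrable_std_normal_moment_abs[of M] by simp
qed

lemma integrable_moment_bump: "integrable lborel (\<lambda>x::real^'n. \<bar>x $ i\<bar> ^ M * bump 0 x)"
proof -
  have eq: "\<bar>x $ i\<bar> ^ M * bump 0 x = (\<Prod>k\<in>UNIV. (if k = i then \<bar>x $ k\<bar> ^ M else 1) * gauss 0 (x $ k))" for x :: "real^'n"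
    by (simp add: bump_def prod.distrib)
  show ?thesis
    unfolding eq
  proof (rule integrable_vec_prod[where f = "\<lambda>k t. (if k = i then \<bar>t\<bar> ^ M else 1) * gauss 0 t"])
    show "integrable lborel (\<lambda>t. (if k = i then \<bar>t\<bar> ^ M else 1) * gauss 0 t)" for k
      using integrable_moment_gauss[of M] by (cases "k = i") auto
  qed
qed

lemma gauss_fourier: "(LINT t|lborel. complex_of_real (gauss 0 t) * cis (- (t * s))) = complex_of_real (sqrt (2 * pi) * gauss 0 s)"
proof -
  have "char std_normal_distribution (- s) = (LINT t|lborel. std_normal_density t *\<^sub>R iexp ((- s) * t))"
    unfolding char_def by (subst integral_density) auto
  then have "complex_of_real (exp (- (s^2) / 2)) = (LINT t|lborel. std_normal_density t *\<^sub>R iexp ((- s) * t))"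
    by (simp add: char_std_normal_distribution)
  then have "complex_of_real (sqrt (2 * pi)) * complex_of_real (exp (- (s^2) / 2))
     = (LINT t|lborel. complex_of_real (sqrt (2 * pi)) * (std_normal_density t *\<^sub>R iexp ((- s) * t)))"
    by (simp only: integral_mult_right_zero)
  also have "\<dots> = (LINT t|lborel. complex_of_real (gauss 0 t) * cis (- (t * s)))"
    by (intro Bochner_Integration.integral_cong) (auto simp: gauss_eq_normal_density cis_conv_exp scaleR_conv_of_real mult_ac)
  finally show ?thesis by (simp add: gauss_def)
qed

lemma bump_fourier:
  fixes \<xi> :: "real^'n"
  shows "(LINT y|lborel. complex_of_real (bump 0 y) * cis (- (y \<bullet> \<xi>)))
     = complex_of_real (sqrt (2 * pi) ^ CARD('n) * bump 0 \<xi>)"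
proof -
  have cis_sum: "cis (\<Sum>i\<in>A. f i) = (\<Prod>i\<in>A. cis (f i))" if "finite A" for f and A :: "'n set"
    using that by induction (auto simp: cis_mult[symmetric])
  have "complex_of_real (bump 0 y) * cis (- (y \<bullet> \<xi>)) = (\<Prod>i\<in>UNIV. complex_of_real (gauss 0 (y $ i)) * cis (- (y $ i * \<xi> $ i)))" for y :: "real^'n"
    by (simp add: bump_def inner_vec_def prod.distrib cis_sum flip: sum_negf)
  then have "(LINT y|lborel. complex_of_real (bump 0 (y::real^'n)) * cis (- (y \<bullet> \<xi>)))
    = (\<Prod>i\<in>UNIV. LINT t|lborel. complex_of_real (gauss 0 t) * cis (- (t * \<xi> $ i)))"
  proof (simp only:, intro integral_vec_prod)
    show "integrable lborel (\<lambda>t. complex_of_real (gauss 0 t) * cis (- (t * \<xi> $ i)))" for i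
      by (rule Bochner_Integration.integrable_bound[OF integrable_gauss[of 0]]) (auto simp: norm_mult cis_conv_exp)
  qed
  also have "\<dots> = complex_of_real (sqrt (2 * pi) ^ CARD('n) * bump 0 \<xi>)"
    by (simp add: gauss_fourier bump_def prod.distrib)
  finally show ?thesis .
qed

lemma add_power_le: "0 \<le> a \<Longrightarrow> 0 \<le> b \<Longrightarrow> (a + b) ^ M \<le> 2 ^ M * (a ^ M + (b::real) ^ M)"
proof -
  assume ab: "0 \<le> a" "0 \<le> b"
  have "(a + b) ^ M \<le> (2 * max a b) ^ M" using ab by (intro power_mono) auto
  also have "\<dots> = 2 ^ M * max a b ^ M" by (simp add: power_mult_distrib)
  also have "\<dots> \<le> 2 ^ M * (a ^ M + b ^ M)" using ab by (auto simp: max_def)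
  finally show ?thesis .
qed

context resolution
begin

text \<open>The power of \<open>x $ i\<close> is split between \<open>x - y\<close>, where the
  kernel decays, and \<open>y\<close>, where the Gaussian has finite moments.\<close>

lemma bump_piece_growth:
  obtains C where "C \<ge> 0" "\<And>j x i. \<bar>x $ i\<bar> ^ M * cmod (bump_piece j x) \<le> C * 2 ^ (j * CARD('n))"
proof -
  obtain C1 where C1: "C1 \<ge> 0" "\<And>j x i. \<bar>x $ i\<bar> ^ M * cmod (inv_fourier (dyadic_piece \<phi> j) x) \<le> C1 * 2 ^ (j * CARD('n))"
    using dyadic_kernel_decay by blast
  obtain C0 where C0: "C0 \<ge> 0" "\<And>j x i. \<bar>x $ i\<bar> ^ 0 * cmod (inv_fourier (dyadic_piece \<phi> j) x) \<le> C0 * 2 ^ (j * CARD('n))"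
    using dyadic_kernel_decay by blast
  define h where "h i y = 2 ^ M * (C1 * bump 0 y + C0 * (\<bar>y $ i\<bar> ^ M * bump 0 y))" for i and y :: "real^'n"
  have ih: "integrable lborel (h i)" for i
    unfolding h_def by (intro integrable_mult_right Bochner_Integration.integrable_add integrable_moment_bump integrable_bump)
  have hn: "h i y \<ge> 0" for i y using C1 C0 by (auto simp: h_def)
  define C where "C = (\<Sum>i\<in>UNIV. LINT y|lborel. h i y)"
  have In: "(LINT y|lborel. h i y) \<ge> 0" for i using hn by (intro integral_nonneg_AE) auto
  show ?thesis
  proof
    show "C \<ge> 0" unfolding C_def by (intro sum_nonneg In)
    fix j x i
    let ?K = "inv_fourier (dyadic_piece \<phi> j)"
    let ?D = "2 ^ (j * CARD('n)) :: real"
    have pt: "cmod (complex_of_real (\<bar>x $ i\<bar> ^ M) * (complex_of_real (bump 0 y) * ?K (x - y))) \<le> ?D * h i y" for y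
    proof -
      have "\<bar>x $ i\<bar> ^ M \<le> (\<bar>(x - y) $ i\<bar> + \<bar>y $ i\<bar>) ^ M" by (intro power_mono) auto
      also have "\<dots> \<le> 2 ^ M * (\<bar>(x - y) $ i\<bar> ^ M + \<bar>y $ i\<bar> ^ M)" by (intro add_power_le) auto
      finally have "\<bar>x $ i\<bar> ^ M * cmod (?K (x - y)) \<le> 2 ^ M * (\<bar>(x - y) $ i\<bar> ^ M + \<bar>y $ i\<bar> ^ M) * cmod (?K (x - y))"
        by (rule mult_right_mono) simp
      also have "\<dots> = 2 ^ M * (\<bar>(x - y) $ i\<bar> ^ M * cmod (?K (x - y)) + \<bar>y $ i\<bar> ^ M * cmod (?K (x - y)))"
        by (simp add: algebra_simps)
      also have "\<dots> \<le> 2 ^ M * (C1 * ?D + \<bar>y $ i\<bar> ^ M * (C0 * ?D))"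
        using C1(2)[of "x - y" i j] C0(2)[of "x - y" i j] by (intro mult_left_mono add_mono) auto
      finally have "bump 0 y * (\<bar>x $ i\<bar> ^ M * cmod (?K (x - y))) \<le> bump 0 y * (2 ^ M * (C1 * ?D + \<bar>y $ i\<bar> ^ M * (C0 * ?D)))"
        by (rule mult_left_mono) simp
      then show ?thesis by (simp add: norm_mult norm_power h_def algebra_simps)
    qed
    have "\<bar>x $ i\<bar> ^ M * cmod (bump_piece j x)
       = cmod (LINT y|lborel. complex_of_real (\<bar>x $ i\<bar> ^ M) * (complex_of_real (bump 0 y) * ?K (x - y)))"
      by (simp add: bump_piece_def norm_mult norm_power)
    also have "\<dots> \<le> (LINT y|lborel. ?D * h i y)"
    proof (rule order_trans[OF integral_norm_bound integral_mono])
      show i2: "integrable lborel (\<lambda>y. ?D * h i y)" by (intro integrable_mult_right ih)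
      show "integrable lborel (\<lambda>y. cmod (complex_of_real (\<bar>x $ i\<bar> ^ M) * (complex_of_real (bump 0 y) * ?K (x - y))))"
        by (rule Bochner_Integration.integrable_bound[OF i2]) (use pt hn in \<open>auto simp: abs_mult\<close>)
    qed (rule pt)
    also have "\<dots> = (LINT y|lborel. h i y) * ?D" by simp
    also have "\<dots> \<le> C * ?D" unfolding C_def using In by (intro mult_right_mono member_le_sum) auto
    finally show "\<bar>x $ i\<bar> ^ M * cmod (bump_piece j x) \<le> C * ?D" .
  qed
qed

text \<open>The gain in \<open>j\<close> is visible on the frequency side, where the dyadic cutoff
  meets the Gaussian tail. Fubini moves the convolution there, and the transform of the Gaussian is
  again a Gaussian.\<close>

lemma bump_piece_eq:
  "bump_piece j x = inv_fourier (\<lambda>\<xi>. dyadic_piece \<phi> j \<xi> * complex_of_real (sqrt (2 * pi) ^ CARD('n) * bump 0 \<xi>)) x"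
proof -
  let ?P = "dyadic_piece \<phi> j"
  let ?F = "\<lambda>y \<xi>. complex_of_real (bump 0 y) * (?P \<xi> * cis ((x - y) \<bullet> \<xi>))"
  have int: "integrable (lborel \<Otimes>\<^sub>M lborel) (\<lambda>(y, \<xi>). ?F y \<xi>)"
  proof (rule lborel_pair.Fubini_integrable)
    show "(\<lambda>(y, \<xi>). ?F y \<xi>) \<in> borel_measurable (lborel \<Otimes>\<^sub>M lborel)"
      unfolding cis_conv_exp by measurable
    have "(\<lambda>y. LINT \<xi>|lborel. cmod (case (y, \<xi>) of (y, \<xi>) \<Rightarrow> ?F y \<xi>)) = (\<lambda>y. bump 0 y * (LINT \<xi>|lborel. cmod (?P \<xi>)))"
      by (simp add: norm_mult)
    then show "integrable lborel (\<lambda>y. LINT \<xi>|lborel. cmod (case (y, \<xi>) of (y, \<xi>) \<Rightarrow> ?F y \<xi>))"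
      by simp
    show "AE y in lborel. integrable lborel (\<lambda>\<xi>. case (y, \<xi>) of (y, \<xi>) \<Rightarrow> ?F y \<xi>)"
      by (auto intro!: AE_I2 integrable_mult_cis integrable_dyadic_piece)
  qed
  have eq: "(LINT y|lborel. ?F y \<xi>) = ?P \<xi> * complex_of_real (sqrt (2 * pi) ^ CARD('n) * bump 0 \<xi>) * cis (x \<bullet> \<xi>)" for \<xi>
  proof -
    have "(LINT y|lborel. ?F y \<xi>) = (LINT y|lborel. (?P \<xi> * cis (x \<bullet> \<xi>)) * (complex_of_real (bump 0 y) * cis (- (y \<bullet> \<xi>))))"
      by (intro Bochner_Integration.integral_cong) (auto simp: inner_diff_left mult_ac cis_mult)
    then show ?thesis by (simp add: bump_fourier mult_ac)
  qed
  have "bump_piece j x = (LINT y|lborel. complex_of_real (1 / (2 * pi) ^ CARD('n)) * (LINT \<xi>|lborel. ?F y \<xi>))"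
    unfolding bump_piece_def inv_fourier_def
    by (subst integral_mult_right_zero) (simp add: mult.left_commute)
  also have "\<dots> = complex_of_real (1 / (2 * pi) ^ CARD('n)) * (LINT \<xi>|lborel. LINT y|lborel. ?F y \<xi>)"
    using lborel_pair.Fubini_integral[OF int] by simp
  finally show ?thesis unfolding eq inv_fourier_def .
qed

text \<open>The frequencies in the support of the \<open>j\<close>-th piece are at least \<open>2\<^sup>j\<^sup>-\<^sup>1\<close>, so a moment of the
  Gaussian of order \<open>N\<close> gains the factor \<open>2\<^sup>-\<^sup>j\<^sup>N\<close>.\<close>

lemma bump_piece_small:
  obtains C where "C \<ge> 0" "\<And>j x. cmod (bump_piece j x) \<le> C / 2 ^ (j * N)"
proof -
  obtain B where B: "B > 0" "\<And>\<xi>. cmod (\<phi> \<xi>) \<le> B"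
    using compact_support_bounded[OF smooth_continuous[OF smooth] eq_0] by blast
  define h where "h \<xi> = 2 * B * sqrt (2 * pi) ^ CARD('n) * (bump 0 \<xi> + (2 * CARD('n)) ^ N * (\<Sum>i\<in>UNIV. \<bar>\<xi> $ i\<bar> ^ N * bump 0 \<xi>))" for \<xi> :: "real^'n"
  have ih: "integrable lborel h"
    unfolding h_def by (intro integrable_mult_right Bochner_Integration.integrable_add Bochner_Integration.integrable_sum integrable_moment_bump integrable_bump)
  have hn: "h \<xi> \<ge> 0" for \<xi> using B by (auto simp: h_def intro!: mult_nonneg_nonneg add_nonneg_nonneg sum_nonneg)
  define C where "C = (LINT \<xi>|lborel. h \<xi>) / (2 * pi) ^ CARD('n)"
  show ?thesis
  proof
    show "C \<ge> 0" using hn by (auto simp: C_def intro!: divide_nonneg_nonneg integral_nonneg_AE)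
    fix j x
    let ?g = "\<lambda>\<xi>. dyadic_piece \<phi> j \<xi> * complex_of_real (sqrt (2 * pi) ^ CARD('n) * bump 0 \<xi>)"
    have pt: "cmod (?g \<xi>) \<le> h \<xi> / 2 ^ (j * N)" for \<xi>
    proof (cases "dyadic_piece \<phi> j \<xi> = 0")
      case True then show ?thesis using hn[of \<xi>] by simp
    next
      case False
      have d: "cmod (dyadic_piece \<phi> j \<xi>) \<le> 2 * B"
        using B(2)[of \<xi>] B(2)[of "(1 / 2 ^ j) *\<^sub>R \<xi>"] B(2)[of "(1 / 2 ^ (j - 1)) *\<^sub>R \<xi>"] B(1)
          norm_triangle_ineq4[of "\<phi> ((1 / 2 ^ j) *\<^sub>R \<xi>)" "\<phi> ((1 / 2 ^ (j - 1)) *\<^sub>R \<xi>)"]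
        by (auto simp: dyadic_piece_def)
      \<comment> \<open>For \<open>j > 0\<close> some coordinate of \<xi> is at least
        \<open>2 ^ (j - 1) / CARD('n)\<close> in modulus, whence the factor
        \<open>2 * CARD('n)\<close> in \<open>h\<close>. The summand 1 covers
        \<open>j = 0\<close>.\<close>
      have key: "2 ^ (j * N) \<le> 1 + (2 * CARD('n)) ^ N * (\<Sum>i\<in>UNIV. \<bar>\<xi> $ i\<bar> ^ N)"
      proof (cases "j = 0")
        case True then show ?thesis by (simp add: sum_nonneg)
      next
        case j: False
        \<comment> \<open>Inside this ball both dilates of \<phi> equal 1 and cancel.\<close>
        have "\<not> norm \<xi> \<le> 2 ^ (j - 1)"
        proof
          assume "norm \<xi> \<le> 2 ^ (j - 1)"
          moreover have "(2::real) ^ (j - 1) \<le> 2 ^ j" by (intro power_increasing) auto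
          ultimately have "norm \<xi> \<le> 2 ^ (j - 1)" "norm \<xi> \<le> 2 ^ j" by linarith+
          then have "norm ((1 / 2 ^ (j - 1)) *\<^sub>R \<xi>) \<le> 1" "norm ((1 / 2 ^ j) *\<^sub>R \<xi>) \<le> 1"
            by (simp_all add: divide_le_eq)
          then show False using False j by (simp add: dyadic_piece_def eq_1)
        qed
        then have "2 ^ (j - 1) \<le> (\<Sum>i\<in>UNIV. \<bar>\<xi> $ i\<bar>)"
          using norm_le_l1_cart[of \<xi>] by linarith
        also have "\<dots> \<le> CARD('n) * Max (range (\<lambda>i. \<bar>\<xi> $ i\<bar>))"
          by (rule sum_bounded_above) auto
        finally have "2 ^ (j - 1) \<le> CARD('n) * Max (range (\<lambda>i. \<bar>\<xi> $ i\<bar>))" .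
        moreover have "Max (range (\<lambda>i. \<bar>\<xi> $ i\<bar>)) \<in> range (\<lambda>i. \<bar>\<xi> $ i\<bar>)" by (intro Max_in) auto
        then obtain i where "Max (range (\<lambda>i. \<bar>\<xi> $ i\<bar>)) = \<bar>\<xi> $ i\<bar>" by (rule rangeE)
        ultimately have i: "2 ^ (j - 1) \<le> CARD('n) * \<bar>\<xi> $ i\<bar>" by simp
        have "(2::real) ^ j = 2 * 2 ^ (j - 1)" using j by (simp flip: power_Suc)
        then have "2 ^ j \<le> 2 * CARD('n) * \<bar>\<xi> $ i\<bar>" using i by simp
        then have "(2 ^ j) ^ N \<le> (2 * CARD('n) * \<bar>\<xi> $ i\<bar>) ^ N" by (intro power_mono) auto
        also have "\<dots> = (2 * CARD('n)) ^ N * \<bar>\<xi> $ i\<bar> ^ N" by (simp add: power_mult_distrib)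
        also have "\<dots> \<le> (2 * CARD('n)) ^ N * (\<Sum>i\<in>UNIV. \<bar>\<xi> $ i\<bar> ^ N)"
          by (intro mult_left_mono member_le_sum) auto
        finally show ?thesis by (simp add: power_mult)
      qed
      have "2 ^ (j * N) * cmod (?g \<xi>) = (2 ^ (j * N) * cmod (dyadic_piece \<phi> j \<xi>)) * (sqrt (2 * pi) ^ CARD('n) * bump 0 \<xi>)"
        by (simp add: norm_mult norm_power)
      also have "\<dots> \<le> ((1 + (2 * CARD('n)) ^ N * (\<Sum>i\<in>UNIV. \<bar>\<xi> $ i\<bar> ^ N)) * (2 * B)) * (sqrt (2 * pi) ^ CARD('n) * bump 0 \<xi>)"
        using key d by (intro mult_right_mono mult_mono) (auto simp: sum_nonneg add_nonneg_nonneg)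
      also have "\<dots> = h \<xi>" by (simp add: h_def algebra_simps sum_distrib_left sum_distrib_right)
      finally show ?thesis by (simp add: field_simps)
    qed
    have "(LINT \<xi>|lborel. cmod (?g \<xi>)) \<le> (LINT \<xi>|lborel. h \<xi> / 2 ^ (j * N))"
    proof (rule integral_mono)
      show i2: "integrable lborel (\<lambda>\<xi>. h \<xi> / 2 ^ (j * N))" using ih by simp
      show "integrable lborel (\<lambda>\<xi>. cmod (?g \<xi>))"
        by (rule Bochner_Integration.integrable_bound[OF i2]) (use pt hn in auto)
    qed (rule pt)
    then have "(LINT \<xi>|lborel. cmod (?g \<xi>)) / (2 * pi) ^ CARD('n) \<le> C / 2 ^ (j * N)"
      by (simp add: C_def field_simps)
    then show "cmod (bump_piece j x) \<le> C / 2 ^ (j * N)"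
      unfolding bump_piece_eq using norm_inv_fourier_le[of ?g x] by linarith
  qed
qed

end

section \<open>A pointwise criterion for finite Besov quasi-norms\<close>

lemma epow_ennreal: "t \<ge> 0 \<Longrightarrow> epow (ennreal t) s = ennreal (t powr s)"
  by (simp add: epow_def)

lemma epow_mono:
  assumes "s > 0" "t \<le> u" shows "epow t s \<le> epow u s"
proof (cases "u = \<infinity>")
  case False
  then have "enn2real t \<le> enn2real u" "t \<noteq> \<infinity>"
    using assms by (auto intro!: enn2real_mono simp: top.not_eq_extremum neq_top_trans)
  then show ?thesis using assms False by (auto simp: epow_def intro!: ennreal_leI powr_mono2)
qed (simp add: epow_def)

lemma epow_top [simp]: "epow \<infinity> s = \<infinity>" "epow top s = \<infinity>"
  by (simp_all add: epow_def)

lemma epow_less_top_iff: "epow t s < top \<longleftrightarrow> t < top"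
  by (auto simp: epow_def top.not_eq_extremum)

lemma powr_lt_1: "0 \<le> x \<Longrightarrow> x < 1 \<Longrightarrow> 0 < p \<Longrightarrow> x powr p < (1::real)"
  using powr_less_mono2[of p x 1] by simp

text \<open>One spatial profile \<open>W\<close> dominates all pieces pointwise, so the L^p
  quasi-norms are mere multiples of one number, for \<open>p < 1\<close> as well. What remains is a
  geometric series of ratio \<open>2 powr ((\<alpha> - L) * q)\<close>.\<close>

lemma besov_seq_qnorm_finite:
  fixes g :: "nat \<Rightarrow> real^'n \<Rightarrow> complex"
  assumes p: "p > 0" and q: "q > 0" and L: "\<alpha> < real L" and C: "C \<ge> 0"
    and g: "\<And>j x. cmod (g j x) \<le> C / 2 ^ (j * L) * W x"
    and W: "\<And>x. W x \<ge> 0" "W \<in> borel_measurable borel" "(\<integral>\<^sup>+x. ennreal (W x powr p) \<partial>lborel) < \<infinity>"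
  shows "besov_seq_qnorm \<alpha> p q g < \<infinity>"
proof -
  note [measurable] = W(2)
  obtain I where I: "I \<ge> 0" "(\<integral>\<^sup>+x. ennreal (W x powr p) \<partial>lborel) = ennreal I"
    using W(3) by (auto simp: less_top_ennreal)
  define A where "A = C * I powr (1 / p)"
  have Lp: "Lp_qnorm p (g j) \<le> ennreal (A / 2 ^ (j * L))" for j
  proof -
    let ?c = "C / 2 ^ (j * L)"
    have c: "?c \<ge> 0" using C by simp
    have "(\<integral>\<^sup>+x. ennreal (cmod (g j x) powr p) \<partial>lborel) \<le> (\<integral>\<^sup>+x. ennreal (?c powr p) * ennreal (W x powr p) \<partial>lborel)"
      using p g c W(1)
      by (intro nn_integral_mono) (auto simp: powr_mult[symmetric] simp flip: ennreal_mult intro!: ennreal_leI powr_mono2)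
    also have "\<dots> = ennreal (?c powr p * I)"
      using I by (simp add: nn_integral_cmult ennreal_mult)
    finally have "Lp_qnorm p (g j) \<le> epow (ennreal (?c powr p * I)) (1 / p)"
      unfolding Lp_qnorm_def using p by (intro epow_mono) auto
    also have "\<dots> = ennreal ((?c powr p * I) powr (1 / p))"
      using I by (intro epow_ennreal) auto
    also have "(?c powr p * I) powr (1 / p) = A / 2 ^ (j * L)"
      using C I p by (subst powr_mult) (auto simp: powr_powr A_def)
    finally show ?thesis .
  qed
  have A: "A \<ge> 0" using C by (simp add: A_def)
  define \<rho> where "\<rho> = 2 powr ((\<alpha> - L) * q)"
  have \<rho>: "0 < \<rho>" "\<rho> < 1" using L q powr_less_cancel_iff[of 2 "(\<alpha> - L) * q" 0] by (auto simp: \<rho>_def mult_neg_pos)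
  have "(\<Sum>j. epow (ennreal (2 powr (\<alpha> * real j)) * Lp_qnorm p (g j)) q) \<le> (\<Sum>j. ennreal (A powr q * \<rho> ^ j))"
  proof (intro suminf_le summableI)
    fix j
    have "epow (ennreal (2 powr (\<alpha> * real j)) * Lp_qnorm p (g j)) q
       \<le> epow (ennreal (2 powr (\<alpha> * real j)) * ennreal (A / 2 ^ (j * L))) q"
      using q Lp by (intro epow_mono mult_left_mono) auto
    also have "\<dots> = ennreal ((2 powr (\<alpha> * real j) * (A / 2 ^ (j * L))) powr q)"
      using A by (subst ennreal_mult[symmetric]) (auto intro!: epow_ennreal)
    also have "2 powr (\<alpha> * real j) * (A / 2 ^ (j * L)) = A * 2 powr ((\<alpha> - L) * j)"
    proof -
      have "(2::real) ^ (j * L) = 2 powr (real L * real j)"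
        by (simp add: powr_realpow[symmetric] mult.commute)
      then show ?thesis by (simp add: powr_diff left_diff_distrib)
    qed
    also have "\<dots> powr q = A powr q * \<rho> ^ j"
      using A by (simp add: powr_mult powr_powr \<rho>_def powr_realpow[symmetric] mult_ac)
    finally show "epow (ennreal (2 powr (\<alpha> * real j)) * Lp_qnorm p (g j)) q \<le> ennreal (A powr q * \<rho> ^ j)" .
  qed
  also have "\<dots> < \<infinity>"
    using \<rho> by (subst suminf_ennreal2) (auto intro!: summable_mult)
  finally show ?thesis
    using q by (simp add: besov_seq_qnorm_def epow_less_top_iff)
qed

section \<open>Weighted decay of the pieces and summation over the packets\<close>

text \<open>A product over coordinates rather than a power of the norm, so that the integral of its
  negative powers factors.\<close>

definition weight :: "nat \<Rightarrow> real^'n \<Rightarrow> real" where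
  "weight s x = (\<Prod>i\<in>UNIV. (1 + (x $ i)\<^sup>2) ^ s)"

lemma weight_ge_1: "weight s x \<ge> 1"
  unfolding weight_def by (intro prod_ge_1 one_le_power) auto

lemma weight_measurable [measurable]: "weight s \<in> borel_measurable borel"
  unfolding weight_def by measurable

lemma max_1_power: "0 \<le> a \<Longrightarrow> max 1 a ^ n = max 1 ((a::real) ^ n)"
  by (cases "a \<le> 1") (auto simp: max_absorb1 max_absorb2 power_le_one one_le_power)

text \<open>The coordinate of largest modulus dominates every factor. This turns the weight into a
  power of one coordinate, the form in which \<open>bump_piece_growth\<close> is available.\<close>

lemma weight_le:
  fixes x :: "real^'n"
  obtains i where "weight s x \<le> 2 ^ (s * CARD('n)) * max 1 (\<bar>x $ i\<bar> ^ (2 * s * CARD('n)))"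
proof -
  have "Max (range (\<lambda>i. \<bar>x $ i\<bar>)) \<in> range (\<lambda>i. \<bar>x $ i\<bar>)" by (intro Max_in) auto
  then obtain i where "Max (range (\<lambda>i. \<bar>x $ i\<bar>)) = \<bar>x $ i\<bar>" by (rule rangeE)
  then have i: "\<bar>x $ k\<bar> \<le> \<bar>x $ i\<bar>" for k
    by (metis Max_ge finite finite_imageI rangeI)
  have le2: "1 + (x $ i)\<^sup>2 \<le> 2 * max 1 (\<bar>x $ i\<bar>\<^sup>2)" by simp
  have mx: "max 1 (\<bar>x $ i\<bar>\<^sup>2) ^ n = max 1 (\<bar>x $ i\<bar> ^ (2 * n))" for n
    by (simp add: max_1_power power_mult)
  have "weight s x \<le> (\<Prod>k\<in>(UNIV::'n set). (1 + (x $ i)\<^sup>2) ^ s)"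
    unfolding weight_def using i by (intro prod_mono) (auto intro!: power_mono simp: abs_le_square_iff[symmetric])
  also have "\<dots> = (1 + (x $ i)\<^sup>2) ^ (s * CARD('n))" by (simp add: power_mult)
  also have "\<dots> \<le> (2 * max 1 (\<bar>x $ i\<bar>\<^sup>2)) ^ (s * CARD('n))"
    by (intro power_mono le2) auto
  also have "\<dots> = 2 ^ (s * CARD('n)) * max 1 (\<bar>x $ i\<bar> ^ (2 * s * CARD('n)))"
    by (simp only: power_mult_distrib mx mult.assoc)
  finally show ?thesis by (rule that)
qed

context resolution
begin

text \<open>The geometric mean of the growth bound and of the smallness bound.\<close>

lemma bump_piece_weighted:
  obtains C where "C \<ge> 0" "\<And>j x. cmod (bump_piece j x) \<le> C / 2 ^ (j * L) * (1 / weight s x)"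
proof -
  \<comment> \<open>In the product of the two bounds, \<open>CARD('n)\<close> cancels the growth
    \<open>2 ^ (j * CARD('n))\<close> and \<open>2 * L\<close> leaves the square of
    \<open>1 / 2 ^ (j * L)\<close>.\<close>
  define N where "N = 2 * L + CARD('n)"
  obtain A where A: "A \<ge> 0" "\<And>j x. cmod (bump_piece j x) \<le> A / 2 ^ (j * N)"
    using bump_piece_small by blast
  \<comment> \<open>Twice the exponent of \<open>weight_le\<close>, because the square of the
    weighted piece is estimated.\<close>
  obtain B where B: "B \<ge> 0" "\<And>j x i. \<bar>x $ i\<bar> ^ (4 * s * CARD('n)) * cmod (bump_piece j x) \<le> B * 2 ^ (j * CARD('n))"
    using bump_piece_growth by blast
  define C where "C = 2 ^ (s * CARD('n)) * sqrt (A\<^sup>2 + A * B)"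
  show ?thesis
  proof
    show "C \<ge> 0" using A B by (simp add: C_def)
    fix j x
    let ?F = "cmod (bump_piece j x)" and ?S = "s * CARD('n)"
    obtain i where i: "weight s x \<le> 2 ^ ?S * max 1 (\<bar>x $ i\<bar> ^ (2 * ?S))"
      using weight_le[of s x] by (metis mult.assoc)
    have "?F\<^sup>2 \<le> (A / 2 ^ (j * L))\<^sup>2"
    proof (rule power_mono)
      show "?F \<le> A / 2 ^ (j * L)"
        using A by (intro order_trans[OF A(2)] divide_left_mono power_increasing) (auto simp: N_def)
    qed simp
    also have "\<dots> = A\<^sup>2 / (2 ^ (j * L))\<^sup>2" by (simp add: power_divide)
    finally have F1: "?F\<^sup>2 \<le> A\<^sup>2 / (2 ^ (j * L))\<^sup>2" .
    have "?F * (\<bar>x $ i\<bar> ^ (4 * ?S) * ?F) \<le> (A / 2 ^ (j * N)) * (B * 2 ^ (j * CARD('n)))"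
      using A(1) A(2)[of j x] B(2)[of x i j] by (intro mult_mono[of "cmod (bump_piece j x)"]) (simp_all add: mult.assoc)
    also have "\<dots> = A * B / (2 ^ (j * L))\<^sup>2"
      by (simp add: N_def distrib_left power_add power_mult[symmetric] mult_ac)
    finally have F2: "?F\<^sup>2 * \<bar>x $ i\<bar> ^ (4 * ?S) \<le> A * B / (2 ^ (j * L))\<^sup>2"
      by (simp add: power2_eq_square mult_ac)
    have "(?F * weight s x)\<^sup>2 \<le> (?F * (2 ^ ?S * max 1 (\<bar>x $ i\<bar> ^ (2 * ?S))))\<^sup>2"
      using i weight_ge_1[of s x] by (intro power_mono mult_left_mono) auto
    also have "\<dots> = (2 ^ ?S)\<^sup>2 * (?F\<^sup>2 * max 1 (\<bar>x $ i\<bar> ^ (4 * ?S)))"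
    proof -
      have "(max 1 (\<bar>x $ i\<bar> ^ (2 * ?S)))\<^sup>2 = max 1 (\<bar>x $ i\<bar> ^ (4 * ?S))"
        by (simp add: max_1_power power_mult[symmetric] mult.commute)
      then show ?thesis by (simp add: power_mult_distrib mult_ac)
    qed
    also have "\<dots> \<le> (2 ^ ?S)\<^sup>2 * (?F\<^sup>2 + ?F\<^sup>2 * \<bar>x $ i\<bar> ^ (4 * ?S))"
      by (intro mult_left_mono) (auto simp: max_def)
    also have "\<dots> \<le> (2 ^ ?S)\<^sup>2 * (A\<^sup>2 / (2 ^ (j * L))\<^sup>2 + A * B / (2 ^ (j * L))\<^sup>2)"
      by (intro mult_left_mono add_mono F1 F2) auto
    also have "\<dots> = (C / 2 ^ (j * L))\<^sup>2"
      using A B by (simp add: C_def power_mult_distrib power_divide flip: add_divide_distrib)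
    finally have "?F * weight s x \<le> C / 2 ^ (j * L)"
      by (rule power2_le_imp_le) (use A B in \<open>simp add: C_def\<close>)
    then show "?F \<le> C / 2 ^ (j * L) * (1 / weight s x)"
      using weight_ge_1[of s x] by (simp add: pos_le_divide_eq mult_ac)
  qed
qed

text \<open>Convolution commutes with translation, so every packet contributes a translate of the
  same function \<open>bump_piece j\<close>.\<close>

lemma lp_piece_packets_sums:
  "(\<lambda>k. complex_of_real ((1/2) ^ k) * bump_piece j (x - z k))
     sums lp_piece \<phi> j (dist_of_fun (\<lambda>y. complex_of_real (packets z y))) x"
proof -
  let ?K = "\<lambda>y. inv_fourier (dyadic_piece \<phi> j) (x - y)"
  obtain B where B: "\<And>y. cmod (inv_fourier (dyadic_piece \<phi> j) y) \<le> B"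
    using kernel_bounded by blast
  have K[measurable]: "?K \<in> borel_measurable borel" by measurable
  have "(LINT y|lborel. complex_of_real (bump (z k) y) * ?K y) = bump_piece j (x - z k)" for k
  proof -
    have "(LINT y|lborel. complex_of_real (bump (z k) (z k + y)) * ?K (z k + y)) = (LINT y|lborel. complex_of_real (bump (z k) y) * ?K y)"
      by (rule lborel_integral_shift) measurable
    moreover have "bump (z k) (z k + y) = bump 0 y" for y by (subst bump_shift) simp
    moreover have "x - (z k + y) = x - z k - y" for y by simp
    ultimately show ?thesis unfolding bump_piece_def by simp
  qed
  then show ?thesis
    using packets_sums[OF K, of B z] B by (simp add: lp_piece_def kernel_conv_def pairing_def dist_of_fun_def)
qed

end

text \<open>The profile that dominates all pieces of the packet sum at once; it plays the part of
  \<open>W\<close> in \<open>besov_seq_qnorm_finite\<close>.\<close>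

definition tails :: "nat \<Rightarrow> (nat \<Rightarrow> real^'n) \<Rightarrow> real^'n \<Rightarrow> real" where
  "tails s z x = (\<Sum>k. (1/2) ^ k * (1 / weight s (x - z k)))"

lemma inverse_weight_le_1: "0 \<le> 1 / weight s x" "1 / weight s x \<le> 1"
  using weight_ge_1[of s x] by auto

lemma summable_tails: "summable (\<lambda>k. (1/2) ^ k * (1 / weight s (x - z k)))"
proof (rule summable_comparison_test'[where g = "\<lambda>k. (1/2::real) ^ k" and N = 0])
  show "norm ((1/2) ^ k * (1 / weight s (x - z k))) \<le> (1/2) ^ k" for k
    using inverse_weight_le_1[of s "x - z k"] mult_left_le[of "1 / weight s (x - z k)" "(1/2) ^ k"] by (simp add: abs_mult)
qed simp

lemma tails_measurable [measurable]: "tails s z \<in> borel_measurable borel"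
  unfolding tails_def by measurable

lemma tails_nonneg: "tails s z x \<ge> 0"
  unfolding tails_def using inverse_weight_le_1 by (intro suminf_nonneg summable_tails mult_nonneg_nonneg) auto

text \<open>Splitting \<open>2\<^sup>-\<^sup>k = 2\<^sup>-\<^sup>k\<^sup>/\<^sup>2 2\<^sup>-\<^sup>k\<^sup>/\<^sup>2\<close> bounds the sum by a supremum, whose \<open>p\<close>-th power is at most the sum of
  the \<open>p\<close>-th powers; this treats \<open>p < 1\<close> and \<open>p \<ge> 1\<close> alike.\<close>

lemma tails_powr_le:
  fixes p :: real
  assumes p: "p > 0"
  obtains C where "C \<ge> 0" "\<And>x. ennreal (tails s z x powr p)
     \<le> (\<Sum>k. ennreal (C * (1/2) powr (k * p / 2)) * ennreal ((1 / weight s (x - z k)) powr p))"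
proof -
  define r where "r = (1/2 :: real) powr (1/2)"
  have r: "0 < r" "r < 1" and rr: "r * r = 1/2"
    by (auto simp: r_def powr_add[symmetric] intro!: powr_lt_1)
  define R where "R = (\<Sum>k. r ^ k)"
  have R: "R \<ge> 0" unfolding R_def using r by (intro suminf_nonneg) auto
  show ?thesis
  proof
    show "R powr p \<ge> 0" by simp
    fix x
    let ?y = "\<lambda>k. 1 / weight s (x - z k)"
    note y = inverse_weight_le_1
    let ?t = "\<lambda>k. (r ^ k * ?y k) powr p"
    have rp: "(r ^ k) powr p = (r powr p) ^ k" for k
      using r by (simp add: powr_realpow[symmetric] powr_powr mult.commute)
    have t_le: "?t k \<le> (r powr p) ^ k" for k
      using r y[of s "x - z k"] p by (subst rp[symmetric]) (intro powr_mono2 mult_left_le, auto)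
    have st: "summable ?t"
      by (rule summable_comparison_test'[where g = "\<lambda>k. (r powr p) ^ k" and N = 0])
         (use t_le r p in \<open>auto intro!: summable_geometric powr_lt_1\<close>)
    define S where "S = (\<Sum>k. ?t k)"
    have S: "S \<ge> 0" unfolding S_def by (intro suminf_nonneg st) auto
    have le: "r ^ k * ?y k \<le> S powr (1 / p)" for k
    proof -
      have "?t k \<le> S" unfolding S_def using sum_le_suminf[OF st, of "{k}"] by simp
      then have "?t k powr (1 / p) \<le> S powr (1 / p)" using p by (intro powr_mono2) auto
      then show ?thesis using p r y[of s "x - z k"] by (simp add: powr_powr)
    qed
    have "tails s z x \<le> (\<Sum>k. r ^ k * S powr (1 / p))"
      unfolding tails_def
    proof (intro suminf_le summable_tails summable_mult2)
      show "(1/2) ^ k * ?y k \<le> r ^ k * S powr (1 / p)" for k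
        using mult_left_mono[OF le[of k], of "r ^ k"] r by (simp add: rr[symmetric] power_mult_distrib mult.assoc)
    qed (use r in auto)
    also have "\<dots> = R * S powr (1 / p)"
      unfolding R_def using r by (intro suminf_mult2[symmetric]) auto
    finally have "tails s z x powr p \<le> (R * S powr (1 / p)) powr p"
      using p tails_nonneg by (intro powr_mono2) auto
    also have "\<dots> = R powr p * S" using R S p by (simp add: powr_mult powr_powr)
    finally have "ennreal (tails s z x powr p) \<le> ennreal (R powr p * S)" by (rule ennreal_leI)
    also have "\<dots> = ennreal (R powr p) * (\<Sum>k. ennreal (?t k))"
      unfolding S_def using st by (subst ennreal_mult') (auto simp: suminf_ennreal2 suminf_nonneg)
    also have "\<dots> = (\<Sum>k. ennreal (R powr p * (1/2) powr (k * p / 2)) * ennreal (?y k powr p))"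
    proof (subst ennreal_suminf_cmult[symmetric], intro suminf_cong)
      fix k
      have "?t k = (1/2) powr (k * p / 2) * ?y k powr p"
        using r y[of s "x - z k"] by (subst powr_mult) (auto simp: r_def powr_realpow[symmetric] powr_powr mult_ac)
      then show "ennreal (R powr p) * ennreal (?t k) = ennreal (R powr p * (1/2) powr (k * p / 2)) * ennreal (?y k powr p)"
        by (simp add: ennreal_mult mult.assoc)
    qed
    finally show "ennreal (tails s z x powr p) \<le> (\<Sum>k. ennreal (R powr p * (1/2) powr (k * p / 2)) * ennreal (?y k powr p))" .
  qed
qed

text \<open>Under the condition on \<open>s\<close> the integrand is at most the product of the
  functions \<open>inverse (1 + (x $ i)\<^sup>2)\<close>, each integrable on the line.\<close>

lemma nn_integral_weight:
  assumes "real s * p \<ge> 1"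
  shows "(\<integral>\<^sup>+x. ennreal ((1 / weight s (x :: real^'n)) powr p) \<partial>lborel) < \<infinity>"
proof -
  have set: "einterval (-\<infinity>) \<infinity> = UNIV" by auto
  have "integrable lborel (\<lambda>t::real. inverse (1 + t\<^sup>2))"
    using integrable_inverse_1_plus_square unfolding set by (simp add: set_integrable_def)
  then have fin: "(\<integral>\<^sup>+t. ennreal (inverse (1 + t\<^sup>2)) \<partial>lborel) < \<infinity>"
    by (simp add: integrable_iff_bounded)
  have pt: "(1 / weight s x) powr p \<le> (\<Prod>i\<in>UNIV. inverse (1 + (x $ i)\<^sup>2))" for x :: "real^'n"
  proof -
    have "(1 / weight s x) powr p = (\<Prod>i\<in>UNIV. (1 + (x $ i)\<^sup>2) powr - (real s * p))"
    proof -
      have nz: "1 + t\<^sup>2 > (0::real)" for t by (simp add: add_pos_nonneg)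
      have "(1 / weight s x) powr p = (\<Prod>i\<in>UNIV. (1 + (x $ i)\<^sup>2) powr - real s) powr p"
        using nz by (simp add: weight_def prod_dividef powr_minus powr_realpow divide_inverse prod_inversef[symmetric])
      also have "\<dots> = (\<Prod>i\<in>UNIV. ((1 + (x $ i)\<^sup>2) powr - real s) powr p)"
        by (rule prod_powr_distrib)
      finally show ?thesis by (simp add: powr_powr)
    qed
    also have "\<dots> \<le> (\<Prod>i\<in>UNIV. (1 + (x $ i)\<^sup>2) powr - 1)"
      using assms by (intro prod_mono conjI powr_mono) auto
    also have "\<dots> = (\<Prod>i\<in>UNIV. inverse (1 + (x $ i)\<^sup>2))"
      by (simp add: powr_minus add_nonneg_nonneg)
    finally show ?thesis .
  qed
  have "(\<integral>\<^sup>+x. ennreal ((1 / weight s (x :: real^'n)) powr p) \<partial>lborel)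
     \<le> (\<integral>\<^sup>+x. (\<Prod>i\<in>UNIV. ennreal (inverse (1 + ((x :: real^'n) $ i)\<^sup>2))) \<partial>lborel)"
    by (intro nn_integral_mono) (auto simp: prod_ennreal intro!: ennreal_leI pt)
  also have "\<dots> = (\<Prod>i\<in>(UNIV::'n set). \<integral>\<^sup>+t. ennreal (inverse (1 + t\<^sup>2)) \<partial>lborel)"
    by (rule nn_integral_vec_prod) measurable
  also have "\<dots> < \<infinity>" using fin by (simp add: power_less_top_ennreal)
  finally show ?thesis .
qed

text \<open>All translates of the weight have the same integral \<open>I\<close>, so the centres
  drop out and a geometric series of ratio \<open>(1/2) powr (p / 2)\<close> remains.\<close>

lemma nn_integral_tails:
  assumes p: "p > 0" and s: "real s * p \<ge> 1"
  shows "(\<integral>\<^sup>+x. ennreal (tails s z (x :: real^'n) powr p) \<partial>lborel) < \<infinity>"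
proof -
  obtain C where C: "C \<ge> 0" "\<And>x. ennreal (tails s z x powr p)
     \<le> (\<Sum>k. ennreal (C * (1/2) powr (k * p / 2)) * ennreal ((1 / weight s (x - z k)) powr p))"
    using tails_powr_le[OF p] by blast
  define I where "I = (\<integral>\<^sup>+x. ennreal ((1 / weight s (x :: real^'n)) powr p) \<partial>lborel)"
  have I: "I < \<infinity>" unfolding I_def by (rule nn_integral_weight[OF s])
  have sh: "(\<integral>\<^sup>+x. ennreal ((1 / weight s (x - z k)) powr p) \<partial>lborel) = I" for k
  proof -
    have "I = (\<integral>\<^sup>+x. ennreal ((1 / weight s x) powr p) \<partial>(distr lborel borel ((+) (- z k))))"
      unfolding I_def lborel_distr_plus ..
    also have "\<dots> = (\<integral>\<^sup>+x. ennreal ((1 / weight s (- z k + x)) powr p) \<partial>lborel)"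
      by (rule nn_integral_distr) measurable
    finally show ?thesis by simp
  qed
  have "(\<integral>\<^sup>+x. ennreal (tails s z x powr p) \<partial>lborel)
    \<le> (\<integral>\<^sup>+x. (\<Sum>k. ennreal (C * (1/2) powr (k * p / 2)) * ennreal ((1 / weight s (x - z k)) powr p)) \<partial>lborel)"
    by (intro nn_integral_mono C)
  also have "\<dots> = (\<Sum>k. ennreal (C * (1/2) powr (k * p / 2)) * I)"
    by (subst nn_integral_suminf) (auto simp: nn_integral_cmult sh)
  also have "\<dots> = (\<Sum>k. ennreal (C * (1/2) powr (k * p / 2))) * I"
    by (rule ennreal_suminf_multc)
  also have "\<dots> < \<infinity>"
  proof -
    have "(1/2) powr (real k * p / 2) = ((1/2) powr (p / 2)) ^ k" for k
      by (simp add: powr_realpow[symmetric] powr_powr mult_ac)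
    moreover have "summable (\<lambda>k. C * ((1/2::real) powr (p / 2)) ^ k)"
      using p by (intro summable_mult summable_geometric) (auto intro!: powr_lt_1)
    ultimately have "(\<Sum>k. ennreal (C * (1/2) powr (real k * p / 2))) < \<infinity>"
      using C by (subst suminf_ennreal2) auto
    then show ?thesis using I by (simp add: ennreal_mult_less_top)
  qed
  finally show ?thesis .
qed

theorem packets_in_besov:
  fixes \<phi> :: "real^'n \<Rightarrow> complex"
  assumes "resolution_generator \<phi>" and p: "p > 0" and q: "q > 0"
  shows "dist_of_fun (\<lambda>x. complex_of_real (packets z x)) \<in> besov \<phi> \<alpha> p q"
proof -
  interpret resolution \<phi> by standard fact
  \<comment> \<open>\<open>L\<close> beats the smoothness weight
    \<open>2 powr (\<alpha> * j)\<close> and \<open>s\<close> makes the tails p-integrable;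
    \<open>bump_piece_weighted\<close> supplies any such pair.\<close>
  obtain L :: nat where L: "\<alpha> < real L" using reals_Archimedean2 by blast
  obtain s :: nat where "1 / p \<le> real s" using real_arch_simple by blast
  then have s: "real s * p \<ge> 1" using p by (simp add: field_simps)
  obtain C where C: "C \<ge> 0" "\<And>j x. cmod (bump_piece j x) \<le> C / 2 ^ (j * L) * (1 / weight s x)"
    using bump_piece_weighted by blast
  have "cmod (lp_piece \<phi> j (dist_of_fun (\<lambda>y. complex_of_real (packets z y))) x) \<le> C / 2 ^ (j * L) * tails s z x" for j x
  proof -
    have "cmod (lp_piece \<phi> j (dist_of_fun (\<lambda>y. complex_of_real (packets z y))) x)
      \<le> (\<Sum>k. C / 2 ^ (j * L) * ((1/2) ^ k * (1 / weight s (x - z k))))"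
      unfolding sums_unique[OF lp_piece_packets_sums]
    proof (rule norm_suminf_le)
      show "cmod (complex_of_real ((1/2) ^ k) * bump_piece j (x - z k)) \<le> C / 2 ^ (j * L) * ((1/2) ^ k * (1 / weight s (x - z k)))" for k
        using mult_left_mono[OF C(2)[of j "x - z k"], of "(1/2) ^ k"] by (simp add: norm_mult norm_power mult_ac)
    qed (intro summable_mult summable_tails)
    also have "\<dots> = C / 2 ^ (j * L) * tails s z x"
      unfolding tails_def by (intro suminf_mult summable_tails)
    finally show ?thesis .
  qed
  from besov_seq_qnorm_finite[OF p q L C(1) this tails_nonneg tails_measurable nn_integral_tails[OF p s]]
  have "besov_qnorm \<phi> \<alpha> p q (dist_of_fun (\<lambda>x. complex_of_real (packets z x))) < \<infinity>"
    by (simp add: besov_qnorm_def)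
  then show ?thesis
    using tempered_function_packets[of z] by (simp add: besov_def tempered_function_def)
qed

section \<open>Hermite expansion of a Gaussian\<close>

text \<open>The recursion that arises from differentiating a polynomial times
  \<open>exp (- (t\<^sup>2))\<close>. As formal polynomials these have a degree, a leading
  coefficient and \<open>pderiv\<close>, on which orthogonality rests.\<close>

fun hpoly :: "nat \<Rightarrow> real poly" where
  "hpoly 0 = 1"
| "hpoly (Suc n) = [:0, 2:] * hpoly n - pderiv (hpoly n)"

lemma hermite_poly_eq: "hermite_poly n t = poly (hpoly n) t"
proof -
  have "(deriv ^^ n) (\<lambda>s. exp (- (s\<^sup>2))) = (\<lambda>t. (- 1) ^ n * poly (hpoly n) t * exp (- (t\<^sup>2)))"
  proof (induction n)
    case (Suc n)
    have "((\<lambda>t. (- 1) ^ n * poly (hpoly n) t * exp (- (t\<^sup>2))) has_real_derivative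
       (- 1) ^ Suc n * poly (hpoly (Suc n)) t * exp (- (t\<^sup>2))) (at t)" for t :: real
      by (auto intro!: derivative_eq_intros poly_DERIV simp: algebra_simps)
    then show ?case using Suc by (auto intro!: DERIV_imp_deriv)
  qed simp
  then have "hermite_poly n t = ((- 1) ^ n * (- 1) ^ n) * (exp (t\<^sup>2) * exp (- (t\<^sup>2))) * poly (hpoly n) t"
    by (simp add: hermite_poly_def mult_ac)
  also have "\<dots> = poly (hpoly n) t" by (simp flip: power_mult_distrib exp_add)
  finally show ?thesis .
qed

lemma degree_hpoly: "degree (hpoly n) \<le> n"
proof (induction n)
  case (Suc n)
  have "degree ([:0, 2:] * hpoly n) \<le> Suc n"
    by (rule order_trans[OF degree_mult_le]) (use Suc in simp)
  moreover have "degree (pderiv (hpoly n)) \<le> Suc n" using Suc by (simp add: degree_pderiv)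
  ultimately show ?case by (simp add: degree_diff_le)
qed simp

lemma coeff_hpoly: "coeff (hpoly n) n = 2 ^ n"
proof (induction n)
  case (Suc n)
  have "coeff (pderiv (hpoly n)) (Suc n) = 0"
    using degree_hpoly[of n] by (intro coeff_eq_0) (simp add: degree_pderiv)
  then show ?case using Suc by (simp add: coeff_pCons)
qed simp

lemma pderiv_funpow_eq: "degree q \<le> n \<Longrightarrow> (pderiv ^^ n) q = [:fact n * coeff q n:]" for q :: "real poly"
proof (induction n arbitrary: q)
  case 0
  then show ?case by (metis degree_0_id fact_0 funpow_0 le_zero_eq mult_1)
next
  case (Suc n)
  then have "degree (pderiv q) \<le> n" by (simp add: degree_pderiv)
  from Suc.IH[OF this] show ?case by (simp add: funpow_Suc_right coeff_pderiv algebra_simps del: funpow.simps)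
qed

text \<open>One term of the exponential series gives
  \<open>\<bar>t\<bar> ^ k \<le> fact k * exp \<bar>t\<bar>\<close>; then the square is completed in
  \<open>(1 + \<bar>R\<bar>) * \<bar>t\<bar> - t\<^sup>2 / 2\<close>.\<close>

lemma power_exp_bounded:
  fixes t R :: real
  shows "\<bar>t\<bar> ^ k * exp (R * t - t\<^sup>2 / 2) \<le> fact k * exp ((1 + \<bar>R\<bar>)\<^sup>2 / 2)"
proof -
  have "\<bar>t\<bar> ^ k / fact k \<le> exp \<bar>t\<bar>"
  proof -
    have "\<bar>t\<bar> ^ k /\<^sub>R fact k \<le> (\<Sum>n. \<bar>t\<bar> ^ n /\<^sub>R fact n)"
      using sum_le_suminf[OF summable_exp_generic[of "\<bar>t\<bar>"], of "{k}"] by simp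
    then show ?thesis by (simp add: exp_def divide_inverse mult.commute)
  qed
  then have "\<bar>t\<bar> ^ k \<le> fact k * exp \<bar>t\<bar>" by (simp add: field_simps)
  then have "\<bar>t\<bar> ^ k * exp (R * t - t\<^sup>2 / 2) \<le> fact k * exp \<bar>t\<bar> * exp (R * t - t\<^sup>2 / 2)"
    by (rule mult_right_mono) simp
  also have "\<dots> = fact k * exp (\<bar>t\<bar> + (R * t - t\<^sup>2 / 2))" by (simp add: exp_add)
  also have "\<dots> \<le> fact k * exp ((1 + \<bar>R\<bar>)\<^sup>2 / 2)"
  proof -
    have "R * t \<le> \<bar>R\<bar> * \<bar>t\<bar>" by (simp flip: abs_mult)
    moreover have "0 \<le> (\<bar>t\<bar> - (1 + \<bar>R\<bar>))\<^sup>2" by simp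
    then have "\<bar>t\<bar> * (1 + \<bar>R\<bar>) - t\<^sup>2 / 2 \<le> (1 + \<bar>R\<bar>)\<^sup>2 / 2"
      by (simp add: power2_diff)
    ultimately have "\<bar>t\<bar> + (R * t - t\<^sup>2 / 2) \<le> (1 + \<bar>R\<bar>)\<^sup>2 / 2" by (simp add: algebra_simps)
    then show ?thesis by simp
  qed
  finally show ?thesis .
qed

lemma poly_exp_bounded:
  obtains C :: real where "C \<ge> 0" "\<And>t. \<bar>poly q t * exp (R * t - t\<^sup>2 / 2)\<bar> \<le> C"
proof -
  let ?E = "\<lambda>t. exp (R * t - t\<^sup>2 / 2)" and ?D = "exp ((1 + \<bar>R\<bar>)\<^sup>2 / 2)"
  have tm: "\<bar>coeff q k * (t ^ k * ?E t)\<bar> \<le> \<bar>coeff q k\<bar> * (fact k * ?D)" for k t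
  proof -
    have "\<bar>coeff q k * (t ^ k * ?E t)\<bar> = \<bar>coeff q k\<bar> * (\<bar>t\<bar> ^ k * ?E t)"
      by (simp add: abs_mult power_abs)
    also have "\<dots> \<le> \<bar>coeff q k\<bar> * (fact k * ?D)"
      by (rule mult_left_mono[OF power_exp_bounded abs_ge_zero])
    finally show ?thesis .
  qed
  have le: "\<bar>poly q t * ?E t\<bar> \<le> (\<Sum>k\<le>degree q. \<bar>coeff q k\<bar> * (fact k * ?D))" for t
  proof -
    have "poly q t * ?E t = (\<Sum>k\<le>degree q. coeff q k * (t ^ k * ?E t))"
      by (simp only: poly_altdef sum_distrib_right mult.assoc)
    also have "\<bar>\<dots>\<bar> \<le> (\<Sum>k\<le>degree q. \<bar>coeff q k * (t ^ k * ?E t)\<bar>)" by (rule sum_abs)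
    also have "\<dots> \<le> (\<Sum>k\<le>degree q. \<bar>coeff q k\<bar> * (fact k * ?D))"
      by (rule sum_mono[OF tm])
    finally show ?thesis .
  qed
  have "0 \<le> (\<Sum>k\<le>degree q. \<bar>coeff q k\<bar> * (fact k * ?D))"
    by (rule sum_nonneg) simp
  then show ?thesis using le by (rule that)
qed

text \<open>The common form of all integrands here, up to constants: parameter 0 for two Hermite
  functions, \<open>R\<close> for a Hermite function against \<open>gauss R\<close>, and
  \<open>2 * R\<close> for the square of \<open>gauss R\<close>.\<close>

definition pgauss :: "real poly \<Rightarrow> real \<Rightarrow> real \<Rightarrow> real" where
  "pgauss q R t = poly q t * exp (R * t - t\<^sup>2)"

lemma pgauss_measurable [measurable]: "pgauss q R \<in> borel_measurable borel"
proof -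
  have [measurable]: "poly q \<in> borel_measurable borel"
    by (intro borel_measurable_continuous_onI continuous_intros)
  show ?thesis unfolding pgauss_def by measurable
qed

text \<open>Half of the quadratic exponent absorbs the polynomial and \<open>exp (R * t)\<close>;
  the other half remains as an integrable majorant that vanishes at infinity.\<close>

lemma pgauss_le:
  obtains C where "C \<ge> 0" "\<And>t. \<bar>pgauss q R t\<bar> \<le> C * gauss 0 t"
proof -
  obtain C where C: "C \<ge> 0" "\<And>t. \<bar>poly q t * exp (R * t - t\<^sup>2 / 2)\<bar> \<le> C"
    using poly_exp_bounded by blast
  have eq: "pgauss q R t = (poly q t * exp (R * t - t\<^sup>2 / 2)) * gauss 0 t" for t
  proof -
    have "exp (R * t - t\<^sup>2) = exp (R * t - t\<^sup>2 / 2) * gauss 0 t"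
      unfolding gauss_def exp_add[symmetric] by (rule arg_cong[where f = exp]) simp
    then show ?thesis by (simp only: pgauss_def mult.assoc)
  qed
  have "\<bar>pgauss q R t\<bar> \<le> C * gauss 0 t" for t
    using mult_right_mono[OF C(2)[of t], of "gauss 0 t"] unfolding eq by (simp add: abs_mult)
  with C(1) show ?thesis by (rule that)
qed

lemma integrable_pgauss: "integrable lborel (pgauss q R)"
proof -
  obtain C where C: "C \<ge> 0" "\<And>t. \<bar>pgauss q R t\<bar> \<le> C * gauss 0 t" using pgauss_le by blast
  have i: "integrable lborel (\<lambda>t. C * gauss 0 t)" by simp
  show ?thesis by (rule Bochner_Integration.integrable_bound[OF i]) (use C in auto)
qed

text \<open>Integration by parts: the integrand is the derivative of \<open>pgauss q R\<close>,
  which tends to 0 at both ends.\<close>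

lemma integral_pgauss_deriv: "(LINT t|lborel. pgauss (pderiv q + [:R, - 2:] * q) R t) = 0"
proof -
  let ?f = "pgauss (pderiv q + [:R, - 2:] * q) R"
  obtain C where C: "C \<ge> 0" "\<And>t. \<bar>pgauss q R t\<bar> \<le> C * gauss 0 t" using pgauss_le by blast
  have lim: "(pgauss q R \<longlongrightarrow> 0) F" if "(gauss 0 \<longlongrightarrow> 0) F" for F
    by (rule Lim_null_comparison[where g = "\<lambda>t. C * gauss 0 t"])
       (use C tendsto_mult_right_zero[OF that, of C] in auto)
  have g1: "(gauss 0 \<longlongrightarrow> 0) at_top" and g2: "(gauss 0 \<longlongrightarrow> 0) at_bot"
    unfolding gauss_def by real_asymp+
  have deriv: "(pgauss q R has_vector_derivative ?f t) (at t)" for t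
    unfolding pgauss_def has_real_derivative_iff_has_vector_derivative[symmetric]
    by (auto intro!: derivative_eq_intros poly_DERIV simp: algebra_simps)
  have "(LBINT t=-\<infinity>..\<infinity>. ?f t) = 0 - 0"
  proof (rule interval_integral_FTC_integrable[where F = "pgauss q R"])
    show "isCont ?f t" for t unfolding pgauss_def by (intro continuous_intros)
    show "set_integrable lborel (einterval (-\<infinity>) \<infinity>) ?f"
      using integrable_pgauss by (simp add: set_integrable_def)
    show "((pgauss q R \<circ> real_of_ereal) \<longlongrightarrow> 0) (at_right (- \<infinity>))"
      using lim[OF g2] by (simp add: ereal_tendsto_simps)
    show "((pgauss q R \<circ> real_of_ereal) \<longlongrightarrow> 0) (at_left \<infinity>)"
      using lim[OF g1] by (simp add: ereal_tendsto_simps)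
  qed (use deriv in auto)
  then show ?thesis by (simp add: interval_lebesgue_integral_def set_lebesgue_integral_def)
qed

text \<open>Lowers the Hermite index by moving one derivative to the remaining factor. With
  \<open>q = 1\<close> it gives the coefficients of a Gaussian, with \<open>R = 0\<close> the
  orthogonality relations.\<close>

lemma integral_pgauss_hpoly_Suc:
  "(LINT t|lborel. pgauss (q * hpoly (Suc n)) R t) = (LINT t|lborel. pgauss ((pderiv q + smult R q) * hpoly n) R t)"
proof -
  have "pderiv (q * hpoly n) + [:R, - 2:] * (q * hpoly n) = (pderiv q + smult R q) * hpoly n - q * hpoly (Suc n)"
  proof -
    have alg: "(q * P' + P * q') + (B - A) * (q * P) = (q' + B * q) * P - q * (A * P - P')"
      for P P' q' A B :: "real poly" by (simp add: algebra_simps)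
    have "[:R, - 2:] = [:R:] - [:0, 2:]" "smult R q = [:R:] * q" by simp_all
    then show ?thesis by (simp only: hpoly.simps pderiv_mult alg)
  qed
  then have "(LINT t|lborel. pgauss ((pderiv q + smult R q) * hpoly n - q * hpoly (Suc n)) R t) = 0"
    using integral_pgauss_deriv[of "q * hpoly n" R] by simp
  moreover have "pgauss (r - s) R t = pgauss r R t - pgauss s R t" for r s t
    by (simp add: pgauss_def left_diff_distrib)
  ultimately show ?thesis
    by (simp add: integrable_pgauss del: hpoly.simps)
qed

lemma integral_pgauss_1: "(LINT t|lborel. pgauss 1 R t) = sqrt pi * exp (R\<^sup>2 / 4)"
proof -
  have "pgauss 1 R t = sqrt pi * exp (R\<^sup>2 / 4) * normal_density (R / 2) (1 / sqrt 2) t" for t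
  proof -
    have half: "(1 / sqrt 2)\<^sup>2 = (1 / 2 :: real)" by (simp add: power_divide)
    have "exp (R * t - t\<^sup>2) = exp (R\<^sup>2 / 4) * exp (- (t - R / 2)\<^sup>2)"
      by (simp add: power2_eq_square algebra_simps flip: exp_add)
    then show ?thesis unfolding pgauss_def normal_density_def half by simp
  qed
  then show ?thesis by simp
qed

lemma integral_pgauss_hpoly: "(LINT t|lborel. pgauss (hpoly n) R t) = R ^ n * (sqrt pi * exp (R\<^sup>2 / 4))"
proof (induction n)
  case 0 then show ?case by (simp add: integral_pgauss_1)
next
  case (Suc n)
  have "pgauss (smult R (hpoly n)) R t = R * pgauss (hpoly n) R t" for t by (simp add: pgauss_def)
  then show ?case using integral_pgauss_hpoly_Suc[of 1 n R] Suc by (simp del: hpoly.simps)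
qed

lemma integral_pgauss_mult_hpoly:
  "(LINT t|lborel. pgauss (q * hpoly n) 0 t) = (LINT t|lborel. pgauss ((pderiv ^^ n) q) 0 t)"
proof (induction n arbitrary: q)
  case (Suc n)
  have "(LINT t|lborel. pgauss (q * hpoly (Suc n)) 0 t) = (LINT t|lborel. pgauss (pderiv q * hpoly n) 0 t)"
    by (simp only: integral_pgauss_hpoly_Suc smult_0_left add_0_right)
  also have "\<dots> = (LINT t|lborel. pgauss ((pderiv ^^ n) (pderiv q)) 0 t)" by (rule Suc)
  also have "(pderiv ^^ n) (pderiv q) = (pderiv ^^ Suc n) q" by (simp only: funpow_Suc_right o_apply)
  finally show ?case .
qed simp

text \<open>For \<open>m \<le> n\<close>, all \<open>n\<close> derivatives are moved to
  \<open>hpoly m\<close>: they annihilate it if \<open>m < n\<close> and leave \<open>fact n\<close>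
  times its leading coefficient if \<open>m = n\<close>.\<close>

lemma hpoly_orthogonal:
  "(LINT t|lborel. pgauss (hpoly m * hpoly n) 0 t) = (if m = n then 2 ^ n * fact n * sqrt pi else 0)"
proof -
  have *: "(LINT t|lborel. pgauss (hpoly m * hpoly n) 0 t) = (if m = n then 2 ^ n * fact n * sqrt pi else 0)"
    if "m \<le> n" for m n
  proof -
    have "(pderiv ^^ n) (hpoly m) = [:fact n * coeff (hpoly m) n:]"
      using degree_hpoly[of m] that by (intro pderiv_funpow_eq) simp
    moreover have "coeff (hpoly m) n = (if m = n then 2 ^ n else 0)"
      using degree_hpoly[of m] that coeff_hpoly by (auto intro!: coeff_eq_0)
    moreover have "pgauss [:c:] 0 t = c * pgauss 1 0 t" for c t by (simp add: pgauss_def)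
    ultimately show ?thesis
      by (simp add: integral_pgauss_mult_hpoly integral_pgauss_1)
  qed
  show ?thesis
    using *[of m n] *[of n m] by (cases "m \<le> n") (auto simp: mult.commute)
qed

lemma hermite_fun_norm: "((2 ^ n * fact n * sqrt pi) powr (- 1 / 2))\<^sup>2 * (2 ^ n * fact n * sqrt pi) = 1"
proof -
  have "(x powr (- 1 / 2))\<^sup>2 * x = 1" if "x > 0" for x :: real
    using that by (simp only: power2_eq_square powr_add[symmetric]) (simp add: powr_minus)
  then show ?thesis by simp
qed

lemma hermite_fun_measurable [measurable]: "hermite_fun n \<in> borel_measurable borel"
proof -
  have [measurable]: "poly q \<in> borel_measurable borel" for q :: "real poly"
    by (intro borel_measurable_continuous_onI continuous_intros)
  show ?thesis unfolding hermite_fun_def hermite_poly_eq by measurable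
qed

lemma hermite_fun_bounded: obtains B where "\<And>t. \<bar>hermite_fun n t\<bar> \<le> B"
proof -
  obtain C where C: "C \<ge> 0" "\<And>t. \<bar>poly (smult ((2 ^ n * fact n * sqrt pi) powr (- 1 / 2)) (hpoly n)) t * exp (0 * t - t\<^sup>2 / 2)\<bar> \<le> C"
    using poly_exp_bounded by blast
  show ?thesis by (rule that[of C]) (use C(2) in \<open>simp add: hermite_fun_def hermite_poly_eq\<close>)
qed

lemma hermite_fun_mult:
  "hermite_fun m t * hermite_fun n t =
     (2 ^ m * fact m * sqrt pi) powr (- 1 / 2) * (2 ^ n * fact n * sqrt pi) powr (- 1 / 2) * pgauss (hpoly m * hpoly n) 0 t"
proof -
  have "exp (0 * t - t\<^sup>2) = exp (- (t\<^sup>2) / 2) * exp (- (t\<^sup>2) / 2)" by (simp flip: exp_add)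
  then show ?thesis
    unfolding hermite_fun_def hermite_poly_eq pgauss_def by (simp only: poly_mult mult_ac)
qed

lemma integrable_hermite_fun_mult: "integrable lborel (\<lambda>t. hermite_fun m t * hermite_fun n t)"
  unfolding hermite_fun_mult by (intro integrable_mult_right integrable_pgauss)

lemma hermite_fun_orthonormal: "(LINT t|lborel. hermite_fun m t * hermite_fun n t) = (if m = n then 1 else 0)"
  unfolding hermite_fun_mult integral_mult_right_zero hpoly_orthogonal
  using hermite_fun_norm[of n] by (auto simp: power2_eq_square)

section \<open>Hermite coefficients of a translated Gaussian: Poisson weights\<close>

definition hcoeff :: "nat \<Rightarrow> real \<Rightarrow> real" where
  "hcoeff n R = (LINT t|lborel. gauss R t * hermite_fun n t)"

lemma gauss_hermite_fun:
  "gauss R t * hermite_fun n t = (2 ^ n * fact n * sqrt pi) powr (- 1 / 2) * exp (- (R\<^sup>2) / 2) * pgauss (hpoly n) R t"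
proof -
  have "gauss R t * exp (- (t\<^sup>2) / 2) = exp (- (R\<^sup>2) / 2) * exp (R * t - t\<^sup>2)"
    unfolding gauss_def exp_add[symmetric]
    by (rule arg_cong[where f = exp]) (simp add: power2_eq_square field_simps)
  moreover have "g * (N * P * e) = N * e1 * (P * e2)" if "g * e = e1 * e2" for g e e1 e2 N P :: real
  proof -
    have "g * (N * P * e) = N * P * (g * e)" by (simp only: mult_ac)
    then show ?thesis unfolding that by (simp only: mult_ac)
  qed
  ultimately show ?thesis
    unfolding hermite_fun_def hermite_poly_eq pgauss_def by blast
qed

lemma integrable_gauss_hermite_fun: "integrable lborel (\<lambda>t. gauss R t * hermite_fun n t)"
  unfolding gauss_hermite_fun by (intro integrable_mult_right integrable_pgauss)

lemma hcoeff_eq: "hcoeff n R = (2 ^ n * fact n * sqrt pi) powr (- 1 / 2) * sqrt pi * R ^ n * exp (- (R\<^sup>2) / 4)"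
proof -
  have e: "exp (- (R\<^sup>2) / 4) = exp (- (R\<^sup>2) / 2) * exp (R\<^sup>2 / 4)" by (simp flip: exp_add)
  show ?thesis
    unfolding hcoeff_def gauss_hermite_fun integral_mult_right_zero integral_pgauss_hpoly e
    by (simp only: mult_ac)
qed

text \<open>Up to the factor \<open>sqrt pi\<close>, these are the Poisson weights of mean \<open>R\<^sup>2 / 2\<close>.\<close>

lemma hcoeff_square: "(hcoeff n R)\<^sup>2 = sqrt pi * exp (- (R\<^sup>2 / 2)) * ((R\<^sup>2 / 2) ^ n / fact n)"
proof -
  let ?N = "(2 ^ n * fact n * sqrt pi) powr (- 1 / 2) :: real"
  have N: "?N\<^sup>2 = 1 / (2 ^ n * fact n * sqrt pi)"
    by (rule eq_divide_imp[OF _ hermite_fun_norm]) simp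
  have alg: "1 / (p * f * s) * s\<^sup>2 * X = s * (X / p / f)" if "s > 0" for p f s X :: real
    using that by (simp add: power2_eq_square)
  have "(hcoeff n R)\<^sup>2 = ?N\<^sup>2 * (sqrt pi)\<^sup>2 * (R ^ n)\<^sup>2 * (exp (- (R\<^sup>2) / 4))\<^sup>2"
    by (simp only: hcoeff_eq power_mult_distrib)
  also have "(exp (- (R\<^sup>2) / 4))\<^sup>2 = exp (- (R\<^sup>2 / 2))" by (simp flip: exp_double)
  also have "(R ^ n)\<^sup>2 = (R\<^sup>2) ^ n" by (simp only: power_mult[symmetric] mult.commute)
  also have "?N\<^sup>2 * (sqrt pi)\<^sup>2 * (R\<^sup>2) ^ n = sqrt pi * ((R\<^sup>2 / 2) ^ n / fact n)"
    unfolding N by (simp only: alg[OF real_sqrt_gt_zero[OF pi_gt_zero]] power_divide)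
  finally show ?thesis by (simp only: mult_ac)
qed

lemma exp_sums: "(\<lambda>n. x ^ n / fact n) sums exp (x :: real)"
  using exp_converges[of x] by (simp add: divide_inverse mult.commute)

text \<open>Poisson weights have total mass 1, and \<open>sqrt pi\<close> is also the squared L^2
  norm of \<open>gauss R\<close>. So this is Parseval's identity for \<open>gauss R\<close>,
  obtained from the explicit coefficients.\<close>

lemma hcoeff_square_sums: "(\<lambda>n. (hcoeff n R)\<^sup>2) sums sqrt pi"
proof -
  note sums_mult[OF exp_sums[of "R\<^sup>2 / 2"], of "sqrt pi * exp (- (R\<^sup>2 / 2))"]
  moreover have "sqrt pi * exp (- (R\<^sup>2 / 2)) * exp (R\<^sup>2 / 2) = sqrt pi" by (simp add: exp_minus)
  ultimately show ?thesis unfolding hcoeff_square by (simp only:)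
qed

text \<open>The square is rewritten through the factorial moments \<open>n\<close> and
  \<open>n * (n - 1)\<close>, each of which merely shifts the index of the exponential
  series.\<close>

lemma poisson_variance_sums: "(\<lambda>n. (real n - m)\<^sup>2 * (m ^ n / fact n)) sums (m * exp m)" for m :: real
proof -
  let ?e = "\<lambda>n. m ^ n / fact n"
  have e: "?e sums exp m" by (rule exp_sums)
  have st: "real (Suc n) * ?e (Suc n) = m * ?e n" for n
    by (simp del: of_nat_Suc)
  have e1: "(\<lambda>n. real n * ?e n) sums (m * exp m)"
  proof (rule sums_Suc_imp)
    show "(\<lambda>n. real (Suc n) * ?e (Suc n)) sums (m * exp m)" unfolding st by (rule sums_mult[OF e])
  qed simp
  have e2: "(\<lambda>n. real n * (real n - 1) * ?e n) sums (m * (m * exp m))"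
  proof (rule sums_Suc_imp)
    have "real (Suc n) * (real (Suc n) - 1) * ?e (Suc n) = real n * (real (Suc n) * ?e (Suc n))" for n by simp
    then have "real (Suc n) * (real (Suc n) - 1) * ?e (Suc n) = m * (real n * ?e n)" for n
      by (simp only: st mult.left_commute)
    then show "(\<lambda>n. real (Suc n) * (real (Suc n) - 1) * ?e (Suc n)) sums (m * (m * exp m))"
      by (simp only: sums_mult[OF e1])
  qed simp
  have "(\<lambda>n. real n * (real n - 1) * ?e n + (1 - 2 * m) * (real n * ?e n) + m\<^sup>2 * ?e n)
      sums (m * (m * exp m) + (1 - 2 * m) * (m * exp m) + m\<^sup>2 * exp m)"
    by (intro sums_add sums_mult e e1 e2)
  moreover have "r * (r - 1) * E + (1 - 2 * m) * (r * E) + m\<^sup>2 * E = (r - m)\<^sup>2 * E" for r E :: real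
    by (simp add: power2_eq_square algebra_simps)
  moreover have "m * (m * exp m) + (1 - 2 * m) * (m * exp m) + m\<^sup>2 * exp m = m * exp m"
    by (simp add: power2_eq_square algebra_simps)
  ultimately show ?thesis by (simp only:)
qed

lemma hcoeff_variance_sums: "(\<lambda>n. (real n - R\<^sup>2 / 2)\<^sup>2 * (hcoeff n R)\<^sup>2) sums (sqrt pi * (R\<^sup>2 / 2))"
proof -
  define m where "m = R\<^sup>2 / 2"
  have "sqrt pi * exp (- m) * (m * exp m) = sqrt pi * m" by (simp add: exp_minus)
  with sums_mult[OF poisson_variance_sums[of m], of "sqrt pi * exp (- m)"]
  have "(\<lambda>n. sqrt pi * exp (- m) * ((real n - m)\<^sup>2 * (m ^ n / fact n))) sums (sqrt pi * m)"
    by (simp only:)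
  moreover have "(real n - m)\<^sup>2 * (sqrt pi * exp (- m) * (m ^ n / fact n)) = sqrt pi * exp (- m) * ((real n - m)\<^sup>2 * (m ^ n / fact n))" for n
    by (rule mult.left_commute)
  ultimately show ?thesis
    unfolding hcoeff_square m_def[symmetric] by (simp only:)
qed

text \<open>Parseval for a finite Hermite sum minus a multiple of a Gaussian. Expanding the square
  leaves three terms; \<open>hcoeff_square_sums\<close> spreads the squared norm of the Gaussian
  over the indices, so that the terms recombine into squares.\<close>

lemma
  fixes b :: "nat \<Rightarrow> real"
  shows integrable_hermite_deviation:
      "integrable lborel (\<lambda>t. ((\<Sum>n<M. b n * hermite_fun n t) - c * gauss R t)\<^sup>2)" (is ?A)
    and hermite_deviation_sums:
      "(\<lambda>n. ((if n < M then b n else 0) - c * hcoeff n R)\<^sup>2) sums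
         (LINT t|lborel. ((\<Sum>n<M. b n * hermite_fun n t) - c * gauss R t)\<^sup>2)" (is ?B)
proof -
  have ig: "integrable lborel (\<lambda>t. gauss R t * gauss R t)"
    by (rule Bochner_Integration.integrable_bound[OF integrable_gauss[of R]]) (auto intro!: mult_left_le)
  have gval: "(LINT t|lborel. gauss R t * gauss R t) = sqrt pi"
  proof -
    have "gauss R t * gauss R t = exp (- (R\<^sup>2)) * pgauss 1 (2 * R) t" for t
      by (simp add: gauss_def pgauss_def power2_diff field_simps flip: exp_add)
    then have "(LINT t|lborel. gauss R t * gauss R t) = exp (- (R\<^sup>2)) * (sqrt pi * exp ((2 * R)\<^sup>2 / 4))"
      by (simp add: integral_pgauss_1)
    also have "\<dots> = sqrt pi * (exp (- (R\<^sup>2)) * exp (R\<^sup>2))" by (simp add: power_mult_distrib)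
    also have "\<dots> = sqrt pi" by (simp flip: exp_add)
    finally show ?thesis .
  qed
  let ?h = "\<lambda>t. \<Sum>n<M. b n * hermite_fun n t"
  have expand: "(?h t - c * gauss R t)\<^sup>2 =
     (\<Sum>n<M. \<Sum>m<M. (b n * b m) * (hermite_fun n t * hermite_fun m t))
       - (\<Sum>n<M. (2 * c * b n) * (gauss R t * hermite_fun n t)) + c\<^sup>2 * (gauss R t * gauss R t)" for t
  proof -
    have "(?h t - c * gauss R t)\<^sup>2 = ?h t * ?h t - (2 * c * gauss R t) * ?h t + c\<^sup>2 * (gauss R t * gauss R t)"
      by (simp add: power2_eq_square algebra_simps)
    also have "?h t * ?h t = (\<Sum>n<M. \<Sum>m<M. (b n * b m) * (hermite_fun n t * hermite_fun m t))"
      by (simp only: sum_product mult_ac)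
    also have "(2 * c * gauss R t) * ?h t = (\<Sum>n<M. (2 * c * b n) * (gauss R t * hermite_fun n t))"
      by (simp only: sum_distrib_left mult_ac)
    finally show ?thesis .
  qed
  have i1: "integrable lborel (\<lambda>t. \<Sum>n<M. \<Sum>m<M. (b n * b m) * (hermite_fun n t * hermite_fun m t))"
    by (intro Bochner_Integration.integrable_sum integrable_mult_right integrable_hermite_fun_mult)
  have i2: "integrable lborel (\<lambda>t. \<Sum>n<M. (2 * c * b n) * (gauss R t * hermite_fun n t))"
    by (intro Bochner_Integration.integrable_sum integrable_mult_right integrable_gauss_hermite_fun)
  have i3: "integrable lborel (\<lambda>t. c\<^sup>2 * (gauss R t * gauss R t))"
    by (intro integrable_mult_right ig)
  show ?A unfolding expand by (intro Bochner_Integration.integrable_add Bochner_Integration.integrable_diff i1 i2 i3)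
  have v1: "(LINT t|lborel. (\<Sum>n<M. \<Sum>m<M. (b n * b m) * (hermite_fun n t * hermite_fun m t))) = (\<Sum>n<M. (b n)\<^sup>2)"
  proof -
    have "(LINT t|lborel. (\<Sum>n<M. \<Sum>m<M. (b n * b m) * (hermite_fun n t * hermite_fun m t)))
      = (\<Sum>n<M. \<Sum>m<M. (b n * b m) * (if n = m then 1 else 0))"
      by (subst Bochner_Integration.integral_sum, intro Bochner_Integration.integrable_sum integrable_mult_right integrable_hermite_fun_mult,
          subst Bochner_Integration.integral_sum, intro integrable_mult_right integrable_hermite_fun_mult)
         (simp only: integral_mult_right_zero hermite_fun_orthonormal)
    also have "\<dots> = (\<Sum>n<M. (b n)\<^sup>2)"
      by (intro sum.cong refl) (simp add: power2_eq_square if_distrib cong: if_cong)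
    finally show ?thesis .
  qed
  have v2: "(LINT t|lborel. (\<Sum>n<M. (2 * c * b n) * (gauss R t * hermite_fun n t))) = (\<Sum>n<M. 2 * c * b n * hcoeff n R)"
    by (subst Bochner_Integration.integral_sum, intro integrable_mult_right integrable_gauss_hermite_fun)
       (simp only: integral_mult_right_zero hcoeff_def)
  have I: "(LINT t|lborel. (?h t - c * gauss R t)\<^sup>2) = (\<Sum>n<M. (b n)\<^sup>2) - (\<Sum>n<M. 2 * c * b n * hcoeff n R) + c\<^sup>2 * sqrt pi"
    unfolding expand
    by (subst Bochner_Integration.integral_add[OF Bochner_Integration.integrable_diff[OF i1 i2] i3],
        subst Bochner_Integration.integral_diff[OF i1 i2]) (simp only: v1 v2 integral_mult_right_zero gval)
  have s1: "(\<lambda>n. if n \<in> {..<M} then (b n)\<^sup>2 else 0) sums (\<Sum>n<M. (b n)\<^sup>2)" by (rule sums_If_finite_set) simp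
  have s2: "(\<lambda>n. if n \<in> {..<M} then 2 * c * b n * hcoeff n R else 0) sums (\<Sum>n<M. 2 * c * b n * hcoeff n R)" by (rule sums_If_finite_set) simp
  have "(\<lambda>n. (if n \<in> {..<M} then (b n)\<^sup>2 else 0) - (if n \<in> {..<M} then 2 * c * b n * hcoeff n R else 0) + c\<^sup>2 * (hcoeff n R)\<^sup>2)
      sums ((\<Sum>n<M. (b n)\<^sup>2) - (\<Sum>n<M. 2 * c * b n * hcoeff n R) + c\<^sup>2 * sqrt pi)"
    by (intro sums_add sums_diff s1 s2 sums_mult hcoeff_square_sums)
  moreover have "(if n \<in> {..<M} then (b n)\<^sup>2 else 0) - (if n \<in> {..<M} then 2 * c * b n * hcoeff n R else 0) + c\<^sup>2 * (hcoeff n R)\<^sup>2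
      = ((if n < M then b n else 0) - c * hcoeff n R)\<^sup>2" for n
    by (simp add: power2_eq_square algebra_simps)
  ultimately show ?B unfolding I by (simp only:)
qed

text \<open>The complex form, from real and imaginary parts. Since \<open>b\<close> vanishes from
  \<open>M\<close> on, the truncated sum can be compared with the whole coefficient sequence of the
  Gaussian.\<close>

lemma nn_integral_hermite_deviation:
  fixes b :: "nat \<Rightarrow> complex"
  assumes "\<And>n. M \<le> n \<Longrightarrow> b n = 0"
  shows "(\<integral>\<^sup>+t. ennreal ((cmod ((\<Sum>n<M. b n * complex_of_real (hermite_fun n t)) - c * complex_of_real (gauss R t)))\<^sup>2) \<partial>lborel)
     = (\<Sum>n. ennreal ((cmod (b n - c * complex_of_real (hcoeff n R)))\<^sup>2))"
proof -
  let ?D = "\<lambda>b c t. ((\<Sum>n<M. b n * hermite_fun n t) - c * gauss R t)\<^sup>2"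
  let ?r = "\<lambda>n. Re (b n)" and ?i = "\<lambda>n. Im (b n)"
  have split: "(cmod ((\<Sum>n<M. b n * complex_of_real (hermite_fun n t)) - c * complex_of_real (gauss R t)))\<^sup>2
     = ?D ?r (Re c) t + ?D ?i (Im c) t" for t
    by (simp add: cmod_power2 Re_sum Im_sum)
  have "(\<integral>\<^sup>+t. ennreal (?D ?r (Re c) t + ?D ?i (Im c) t) \<partial>lborel)
      = ennreal (LINT t|lborel. ?D ?r (Re c) t + ?D ?i (Im c) t)"
    by (intro nn_integral_eq_integral Bochner_Integration.integrable_add integrable_hermite_deviation) auto
  also have "(LINT t|lborel. ?D ?r (Re c) t + ?D ?i (Im c) t) = (LINT t|lborel. ?D ?r (Re c) t) + (LINT t|lborel. ?D ?i (Im c) t)"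
    by (intro Bochner_Integration.integral_add integrable_hermite_deviation)
  finally have 1: "(\<integral>\<^sup>+t. ennreal (?D ?r (Re c) t + ?D ?i (Im c) t) \<partial>lborel)
      = ennreal ((LINT t|lborel. ?D ?r (Re c) t) + (LINT t|lborel. ?D ?i (Im c) t))" .
  have "(\<lambda>n. (cmod (b n - c * complex_of_real (hcoeff n R)))\<^sup>2) sums ((LINT t|lborel. ?D ?r (Re c) t) + (LINT t|lborel. ?D ?i (Im c) t))"
  proof -
    have "(cmod (b n - c * complex_of_real (hcoeff n R)))\<^sup>2 =
      ((if n < M then ?r n else 0) - Re c * hcoeff n R)\<^sup>2 + ((if n < M then ?i n else 0) - Im c * hcoeff n R)\<^sup>2" for n
      using assms[of n] by (simp add: cmod_power2)
    then show ?thesis by (simp only: sums_add[OF hermite_deviation_sums hermite_deviation_sums])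
  qed
  then have "(\<Sum>n. ennreal ((cmod (b n - c * complex_of_real (hcoeff n R)))\<^sup>2)) = ennreal ((LINT t|lborel. ?D ?r (Re c) t) + (LINT t|lborel. ?D ?i (Im c) t))"
    by (subst suminf_ennreal2) (auto simp: sums_iff)
  with 1 show ?thesis unfolding split by simp
qed

text \<open>Cauchy-Schwarz for the weights \<open>2\<^sup>-\<^sup>l\<close>, whose sum is \<open>2\<close>, as nonnegativity of a variance.\<close>

lemma geometric_jensen:
  fixes y :: "nat \<Rightarrow> real"
  assumes y: "\<And>l. 0 \<le> y l" "\<And>l. y l \<le> B"
  shows "summable (\<lambda>l. (1/2) ^ l * y l)" "summable (\<lambda>l. (1/2) ^ l * (y l)\<^sup>2)"
    "(\<Sum>l. (1/2) ^ l * y l)\<^sup>2 \<le> 2 * (\<Sum>l. (1/2) ^ l * (y l)\<^sup>2)"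
proof -
  have g: "(\<lambda>l. (1/2 :: real) ^ l) sums 2" using geometric_sums[of "1/2 :: real"] by simp
  show s1: "summable (\<lambda>l. (1/2) ^ l * y l)"
    by (rule summable_comparison_test'[where g = "\<lambda>l. (1/2) ^ l * B" and N = 0])
       (use y in \<open>auto simp: abs_mult intro!: mult_left_mono summable_mult2\<close>)
  show s2: "summable (\<lambda>l. (1/2) ^ l * (y l)\<^sup>2)"
    by (rule summable_comparison_test'[where g = "\<lambda>l. (1/2) ^ l * B\<^sup>2" and N = 0])
       (use y in \<open>auto simp: abs_mult intro!: mult_left_mono summable_mult2 power_mono\<close>)
  define W V where "W = (\<Sum>l. (1/2) ^ l * y l)" and "V = (\<Sum>l. (1/2) ^ l * (y l)\<^sup>2)"
  \<comment> \<open>\<open>W / 2\<close> is the mean of \<open>y\<close>, as the weights have total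
    mass 2.\<close>
  have "(\<lambda>l. (1/2) ^ l * (y l)\<^sup>2 - W * ((1/2) ^ l * y l) + W\<^sup>2 / 4 * (1/2) ^ l) sums (V - W * W + W\<^sup>2 / 4 * 2)"
    unfolding V_def by (subst (3) W_def) (intro sums_add sums_diff sums_mult g summable_sums s1 s2)
  moreover have "(1/2) ^ l * (y l)\<^sup>2 - W * ((1/2) ^ l * y l) + W\<^sup>2 / 4 * (1/2) ^ l = (1/2) ^ l * (y l - W / 2)\<^sup>2" for l
    by (simp add: power2_eq_square algebra_simps)
  ultimately have "(\<lambda>l. (1/2) ^ l * (y l - W / 2)\<^sup>2) sums (V - W\<^sup>2 / 2)"
    by (simp add: power2_eq_square)
  then have "0 \<le> V - W\<^sup>2 / 2"
    using suminf_nonneg[of "\<lambda>l. (1/2) ^ l * (y l - W / 2)\<^sup>2"] by (auto simp: sums_iff)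
  then show "(\<Sum>l. (1/2) ^ l * y l)\<^sup>2 \<le> 2 * (\<Sum>l. (1/2) ^ l * (y l)\<^sup>2)"
    by (simp add: W_def V_def)
qed

section \<open>Hermite pieces of Gaussian packets\<close>

lemma hermite_admissible_props:
  assumes "hermite_admissible a"
  shows admissible_support: "0 \<le> t \<Longrightarrow> a t \<noteq> 0 \<Longrightarrow> t \<in> {1/4..4}"
    and admissible_nonzero: "a 1 \<noteq> 0"
    and admissible_bounded: "\<exists>A\<ge>0. \<forall>t\<ge>0. cmod (a t) \<le> A"
    and admissible_lipschitz: "\<exists>L\<ge>0. \<forall>t\<ge>0. cmod (a t - a 1) \<le> L * \<bar>t - 1\<bar>"
proof -
  have "closure {t. 0 \<le> t \<and> a t \<noteq> 0} \<subseteq> {1/4..4}"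
    using assms by (simp add: hermite_admissible_def)
  then have supp: "t \<in> {1/4..4}" if "0 \<le> t" "a t \<noteq> 0" for t
    using closure_subset[of "{t. 0 \<le> t \<and> a t \<noteq> 0}"] that by blast
  then show "0 \<le> t \<Longrightarrow> a t \<noteq> 0 \<Longrightarrow> t \<in> {1/4..4}" .
  obtain c where c: "c > 0" "\<forall>t\<in>{1/3..3}. cmod (a t) > c"
    using assms by (auto simp: hermite_admissible_def)
  have "cmod (a 1) > 0" by (rule less_trans[OF c(1) bspec[OF c(2)]]) simp
  then show "a 1 \<noteq> 0" by simp
  obtain D :: "nat \<Rightarrow> real \<Rightarrow> complex" where D: "\<And>t. t \<ge> 0 \<Longrightarrow> D 0 t = a t"
    "\<And>k t. t \<ge> 0 \<Longrightarrow> (D k has_vector_derivative D (Suc k) t) (at t within {0..})"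
    using assms unfolding hermite_admissible_def smooth_halfline_def by blast
  \<comment> \<open>The number 5 lies beyond the support bound 4: up to 5 compactness bounds
    \<open>a\<close> and its derivative, and past 5 \<open>a\<close> vanishes while
    \<open>\<bar>t - 1\<bar>\<close> exceeds 1.\<close>
  have bdd: "\<exists>B\<ge>0. \<forall>t\<in>{0..5}. cmod (D k t) \<le> B" for k
  proof -
    have "continuous_on {0..} (D k)"
      using D(2) by (auto simp: continuous_on_eq_continuous_within intro: has_vector_derivative_continuous)
    then have "compact (D k ` {0..5})"
      by (intro compact_continuous_image) (auto intro: continuous_on_subset)
    then show ?thesis
      using compact_imp_bounded[of "D k ` {0..5}"] by (auto simp: bounded_pos intro: less_imp_le)
  qed
  obtain A where A: "A \<ge> 0" "\<And>t. t \<in> {0..5} \<Longrightarrow> cmod (D 0 t) \<le> A" using bdd by blast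
  have A': "cmod (a t) \<le> A" if "t \<ge> 0" for t
    using A(2)[of t] D(1)[OF that] A(1) supp[OF that] that by (cases "t \<le> 5") fastforce+
  then show "\<exists>A\<ge>0. \<forall>t\<ge>0. cmod (a t) \<le> A" using A(1) by blast
  obtain B where B: "B \<ge> 0" "\<And>t. t \<in> {0..5} \<Longrightarrow> cmod (D 1 t) \<le> B" using bdd by blast
  have "cmod (a t - a 1) \<le> (A + B) * \<bar>t - 1\<bar>" if t: "t \<ge> 0" for t
  proof (cases "t \<le> 5")
    case True
    have "cmod (D 0 t - D 0 1) \<le> B * norm (t - 1)"
    proof (rule differentiable_bound[where S = "{0..5}" and f' = "\<lambda>s h. h *\<^sub>R D 1 s"])
      show "(D 0 has_derivative (\<lambda>h. h *\<^sub>R D 1 s)) (at s within {0..5})" if "s \<in> {0..5}" for s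
        using has_vector_derivative_within_subset[OF D(2)[of s 0], of "{0..5}"] that
        by (auto simp: has_vector_derivative_def)
      show "onorm (\<lambda>h. h *\<^sub>R D 1 s) \<le> B" if "s \<in> {0..5}" for s
        using B(2)[OF that] by (intro onorm_le) (auto simp: mult.commute[of B] intro!: mult_left_mono)
    qed (use True t in auto)
    also have "\<dots> \<le> (A + B) * \<bar>t - 1\<bar>" using A by (simp add: mult_right_mono)
    finally show ?thesis using D(1) t by simp
  next
    case False
    then have "a t = 0" using supp[OF t] by fastforce
    then have "cmod (a t - a 1) \<le> A" using A'[of 1] by simp
    also have "A \<le> (A + B) * 1" using B by simp
    also have "\<dots> \<le> (A + B) * \<bar>t - 1\<bar>" using False A B by (intro mult_left_mono) auto
    finally show ?thesis .
  qed
  then show "\<exists>L\<ge>0. \<forall>t\<ge>0. cmod (a t - a 1) \<le> L * \<bar>t - 1\<bar>" using A B by (intro exI[of _ "A + B"]) auto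
qed

text \<open>Distinct scales differ by a factor of at least \<open>4\<close>, so a frequency \<open>\<nu>\<close> seen by the piece at
  scale \<open>\<rho> k\<close> is at distance comparable to the larger scale from any other \<open>(\<rho> l)\<^sup>2\<close>.\<close>

lemma admissible_gap:
  fixes \<rho> :: "nat \<Rightarrow> real"
  assumes a: "hermite_admissible a" and pos: "\<And>k. \<rho> k > 0"
    and sep: "\<And>k l. k < l \<Longrightarrow> 4 * \<rho> k \<le> \<rho> l"
  shows "\<exists>C\<ge>0. \<forall>k l (\<nu>::nat).
    cmod (a (real \<nu> / (\<rho> k)\<^sup>2) - (if l = k then a 1 else 0)) \<le> C / \<rho> k * (\<bar>real \<nu> - (\<rho> l)\<^sup>2\<bar> / \<rho> l)"
proof -
  obtain L where L: "L \<ge> 0" "\<And>t. t \<ge> 0 \<Longrightarrow> cmod (a t - a 1) \<le> L * \<bar>t - 1\<bar>" using admissible_lipschitz[OF a] by blast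
  obtain A where A: "A \<ge> 0" "\<And>t. t \<ge> 0 \<Longrightarrow> cmod (a t) \<le> A" using admissible_bounded[OF a] by blast
  \<comment> \<open>\<open>L\<close> serves the case \<open>l = k\<close>; \<open>16 / 3\<close>
    inverts the constant of the gap estimate for \<open>l \<noteq> k\<close>.\<close>
  define C where "C = L + 16 / 3 * A"
  have C: "L \<le> C" "16 / 3 * A \<le> C" "C \<ge> 0" using L A by (auto simp: C_def)
  show ?thesis
  proof (intro exI[of _ C] conjI allI)
    show "C \<ge> 0" by fact
    fix k l \<nu> :: nat
    let ?d = "\<bar>real \<nu> - (\<rho> l)\<^sup>2\<bar>"
    have rhs: "C / \<rho> k * (?d / \<rho> l) = C * (?d / (\<rho> k * \<rho> l))" by simp
    have t0: "real \<nu> / (\<rho> k)\<^sup>2 \<ge> 0" by simp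
    show "cmod (a (real \<nu> / (\<rho> k)\<^sup>2) - (if l = k then a 1 else 0)) \<le> C / \<rho> k * (?d / \<rho> l)"
    proof (cases "l = k")
      case True
      have "real \<nu> / (\<rho> k)\<^sup>2 - 1 = (real \<nu> - (\<rho> k)\<^sup>2) / (\<rho> k)\<^sup>2" using pos[of k] by (simp add: field_simps)
      then have "\<bar>real \<nu> / (\<rho> k)\<^sup>2 - 1\<bar> = \<bar>real \<nu> - (\<rho> k)\<^sup>2\<bar> / (\<rho> k)\<^sup>2" by (simp add: abs_divide)
      then have "cmod (a (real \<nu> / (\<rho> k)\<^sup>2) - a 1) \<le> L * (\<bar>real \<nu> - (\<rho> k)\<^sup>2\<bar> / (\<rho> k)\<^sup>2)"
        using L(2)[OF t0] by simp
      also have "\<dots> \<le> C * (\<bar>real \<nu> - (\<rho> k)\<^sup>2\<bar> / (\<rho> k)\<^sup>2)" using C by (intro mult_right_mono) auto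
      finally show ?thesis using True by (simp add: power2_eq_square)
    next
      case False
      show ?thesis
      proof (cases "a (real \<nu> / (\<rho> k)\<^sup>2) = 0")
        case True then show ?thesis using False C pos[of k] pos[of l] by simp
      next
        case nz: False
        from admissible_support[OF a t0 nz]
        have nu: "(\<rho> k)\<^sup>2 \<le> 4 * real \<nu>" "real \<nu> \<le> 4 * (\<rho> k)\<^sup>2" using pos[of k] by (auto simp: field_simps)
        \<comment> \<open>The support of \<open>a\<close> confines \<nu> to between
          \<open>(\<rho> k)\<^sup>2 / 4\<close> and \<open>4 * (\<rho> k)\<^sup>2\<close>, while the
          squared scales differ by a factor of at least 16. The constant is 1 - 4/16 = 3/4 if
          \<open>k < l\<close> and 1/4 - 1/16 = 3/16 if \<open>l < k\<close>.\<close>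
        have "3 / 16 * (\<rho> k * \<rho> l) \<le> ?d"
        proof (cases "k < l")
          case True
          have "(4 * \<rho> k)\<^sup>2 \<le> (\<rho> l)\<^sup>2" using sep[OF True] pos[of k] by (intro power_mono) auto
          then have "16 * (\<rho> k)\<^sup>2 \<le> (\<rho> l)\<^sup>2" by (simp add: power_mult_distrib)
          then have "3 / 4 * (\<rho> l)\<^sup>2 \<le> ?d" using nu(2) by linarith
          moreover have "\<rho> k * \<rho> l \<le> \<rho> l * \<rho> l" using sep[OF True] pos[of k] pos[of l] by (intro mult_right_mono) auto
          moreover have "0 \<le> \<rho> l * \<rho> l" by simp
          ultimately show ?thesis unfolding power2_eq_square by linarith
        next
          case nl: False
          then have kl: "l < k" using False by simp
          have "(4 * \<rho> l)\<^sup>2 \<le> (\<rho> k)\<^sup>2" using sep[OF kl] pos[of l] by (intro power_mono) auto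
          then have "16 * (\<rho> l)\<^sup>2 \<le> (\<rho> k)\<^sup>2" by (simp add: power_mult_distrib)
          then have "3 / 16 * (\<rho> k)\<^sup>2 \<le> ?d" using nu(1) by linarith
          moreover have "\<rho> k * \<rho> l \<le> \<rho> k * \<rho> k" using sep[OF kl] pos[of k] pos[of l] by (intro mult_left_mono) auto
          ultimately show ?thesis by (simp add: power2_eq_square)
        qed
        then have "1 \<le> 16 / 3 * (?d / (\<rho> k * \<rho> l))" using pos[of k] pos[of l] by (simp add: field_simps)
        then have "A * 1 \<le> A * (16 / 3 * (?d / (\<rho> k * \<rho> l)))" using A(1) by (rule mult_left_mono)
        also have "\<dots> = (16 / 3 * A) * (?d / (\<rho> k * \<rho> l))" by simp
        also have "\<dots> \<le> C * (?d / (\<rho> k * \<rho> l))" using C pos[of k] pos[of l] by (intro mult_right_mono) auto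
        finally show ?thesis using A(2)[OF t0] False unfolding rhs by simp
      qed
    qed
  qed
qed

lemma suminf_swap_ennreal: "(\<Sum>i. \<Sum>j. f i j) = (\<Sum>j. \<Sum>i. (f i j :: ennreal))"
proof -
  have "(\<Sum>i. \<Sum>j. f i j) = (\<integral>\<^sup>+i. (\<Sum>j. f i j) \<partial>count_space UNIV)" by (simp add: nn_integral_count_space_nat)
  also have "\<dots> = (\<Sum>j. \<integral>\<^sup>+i. f i j \<partial>count_space UNIV)" by (rule nn_integral_suminf) simp
  finally show ?thesis by (simp add: nn_integral_count_space_nat)
qed

section \<open>The one-dimensional Hermite pieces: approximation and lower bound\<close>

text \<open>With \<open>R\<^sup>2 / 2 = (\<rho> l)\<^sup>2\<close> for the centre \<open>R = sqrt 2 * \<rho> l\<close>, the Hermite expansion of the \<open>l\<close>-th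
  Gaussian concentrates at \<open>\<nu> \<approx> (\<rho> l)\<^sup>2\<close>.\<close>

definition packet_coeff :: "(nat \<Rightarrow> real) \<Rightarrow> nat \<Rightarrow> real" where
  "packet_coeff \<rho> \<nu> = (\<Sum>l. (1/2) ^ l * hcoeff \<nu> (sqrt 2 * \<rho> l))"

text \<open>The factor along the axis of a Hermite piece of scale \<open>m\<close>, which will be
  \<open>4 ^ (j - 1)\<close>. Every \<open>M\<close> above \<open>4 * m\<close> gives the full sum,
  because \<open>a\<close> vanishes beyond 4.\<close>

definition hermite_piece :: "(real \<Rightarrow> complex) \<Rightarrow> (nat \<Rightarrow> real) \<Rightarrow> real \<Rightarrow> nat \<Rightarrow> real \<Rightarrow> complex" where
  "hermite_piece a \<rho> m M t = (\<Sum>\<nu><M. a (real \<nu> / m) * complex_of_real (packet_coeff \<rho> \<nu>) * complex_of_real (hermite_fun \<nu> t))"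

lemma hermite_piece_measurable [measurable]: "hermite_piece a \<rho> m M \<in> borel_measurable borel"
  unfolding hermite_piece_def by measurable

lemma sqrt_pi_le: "sqrt pi \<le> 4"
proof -
  have "sqrt pi \<le> sqrt 4" by (rule real_sqrt_le_mono[OF less_imp_le[OF pi_less_4]])
  then show ?thesis by simp
qed

lemma hcoeff_le: "\<bar>hcoeff n R\<bar> \<le> 2"
proof -
  have "(hcoeff n R)\<^sup>2 \<le> (\<Sum>n. (hcoeff n R)\<^sup>2)"
    using sum_le_suminf[OF sums_summable[OF hcoeff_square_sums[of R]], of "{n}"] by simp
  also have "\<dots> = sqrt pi" by (rule sums_unique[OF hcoeff_square_sums, symmetric])
  also have "\<dots> \<le> 4" by (rule sqrt_pi_le)
  finally show ?thesis using abs_le_square_iff[of "hcoeff n R" 2] by simp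
qed

lemma packet_coeff_sums: "(\<lambda>l. (1/2) ^ l * hcoeff \<nu> (sqrt 2 * \<rho> l)) sums packet_coeff \<rho> \<nu>"
  unfolding packet_coeff_def
proof (rule summable_sums, rule summable_comparison_test'[where g = "\<lambda>l. (1/2) ^ l * 2" and N = 0])
  show "norm ((1/2) ^ l * hcoeff \<nu> (sqrt 2 * \<rho> l)) \<le> (1/2) ^ l * 2" for l
    using mult_left_mono[OF hcoeff_le, of "(1/2) ^ l"] by (simp add: abs_mult)
qed (rule summable_mult2, simp)

text \<open>The \<nu>-th coefficient of the difference is a sum over packets \<open>l\<close> in
  which the multiplier is compared with \<open>a 1\<close> for \<open>l = k\<close> and with 0
  otherwise. By \<open>admissible_gap\<close> each comparison costs \<open>C / \<rho> k\<close>
  times the deviation of \<nu> from the l-th mean in units of its standard deviation. In square mean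
  over \<nu> this deviation is the same for all \<open>l\<close>, and the weights
  \<open>(1/2) ^ l\<close> make the total finite.\<close>

lemma hermite_piece_approx:
  fixes \<rho> :: "nat \<Rightarrow> real"
  assumes a: "hermite_admissible a" and pos: "\<And>k. \<rho> k > 0"
    and sep: "\<And>k l. k < l \<Longrightarrow> 4 * \<rho> k \<le> \<rho> l"
  shows "\<exists>C\<ge>0. \<forall>k M. 4 * (\<rho> k)\<^sup>2 < real M \<longrightarrow> (\<integral>\<^sup>+t. ennreal ((cmod (hermite_piece a \<rho> ((\<rho> k)\<^sup>2) M t
        - (1/2) ^ k * a 1 * complex_of_real (gauss (sqrt 2 * \<rho> k) t)))\<^sup>2) \<partial>lborel) \<le> ennreal (C / (\<rho> k)\<^sup>2)"
proof -
  obtain C where C: "C \<ge> 0"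
    "\<And>k l (\<nu>::nat). cmod (a (real \<nu> / (\<rho> k)\<^sup>2) - (if l = k then a 1 else 0)) \<le> C / \<rho> k * (\<bar>real \<nu> - (\<rho> l)\<^sup>2\<bar> / \<rho> l)"
    using admissible_gap[where \<rho> = \<rho>, OF a pos sep] by blast
  \<comment> \<open>The normalised deviation times the coefficient: the l-th Poisson law has mean
    \<open>(\<rho> l)\<^sup>2\<close> and standard deviation \<open>\<rho> l\<close>.\<close>
  define y where "y \<nu> l = \<bar>real \<nu> - (\<rho> l)\<^sup>2\<bar> / \<rho> l * \<bar>hcoeff \<nu> (sqrt 2 * \<rho> l)\<bar>" for \<nu> l
  have ysums: "(\<lambda>\<nu>. (y \<nu> l)\<^sup>2) sums sqrt pi" for l
  proof -
    have "(\<lambda>\<nu>. (real \<nu> - (\<rho> l)\<^sup>2)\<^sup>2 * (hcoeff \<nu> (sqrt 2 * \<rho> l))\<^sup>2) sums (sqrt pi * (\<rho> l)\<^sup>2)"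
      using hcoeff_variance_sums[of "sqrt 2 * \<rho> l"] by (simp add: power_mult_distrib)
    from sums_divide[OF this, of "(\<rho> l)\<^sup>2"] show ?thesis
      using pos[of l] by (simp add: y_def power_mult_distrib power_divide)
  qed
  have y0: "0 \<le> y \<nu> l" for \<nu> l using pos[of l] by (simp add: y_def)
  have y2: "y \<nu> l \<le> 2" for \<nu> l
  proof -
    have "(y \<nu> l)\<^sup>2 \<le> (\<Sum>\<nu>. (y \<nu> l)\<^sup>2)"
      using sum_le_suminf[OF sums_summable[OF ysums[of l]], of "{\<nu>}"] by simp
    also have "\<dots> = sqrt pi" by (rule sums_unique[OF ysums, symmetric])
    also have "\<dots> \<le> 2\<^sup>2" using sqrt_pi_le by simp
    finally show ?thesis by (rule power2_le_imp_le) simp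
  qed
  note J = geometric_jensen[of "y \<nu>" 2 for \<nu>, OF y0 y2]
  \<comment> \<open>In the witness, one factor 2 comes from \<open>geometric_jensen\<close> and the
    other from summing \<open>(1/2) ^ l\<close>.\<close>
  show ?thesis
  proof (intro exI[of _ "4 * C\<^sup>2 * sqrt pi"] conjI allI impI)
    show "4 * C\<^sup>2 * sqrt pi \<ge> 0" by simp
    fix k M assume M: "4 * (\<rho> k)\<^sup>2 < real M"
    define b where "b \<nu> = a (real \<nu> / (\<rho> k)\<^sup>2) * complex_of_real (packet_coeff \<rho> \<nu>)" for \<nu>
    let ?lam = "(1/2) ^ k * a 1"
    have b0: "b n = 0" if "M \<le> n" for n
    proof -
      have "4 * (\<rho> k)\<^sup>2 < real n" using M that by linarith
      then have "4 < real n / (\<rho> k)\<^sup>2" using pos[of k] by (simp add: field_simps)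
      then have "a (real n / (\<rho> k)\<^sup>2) = 0" using admissible_support[OF a, of "real n / (\<rho> k)\<^sup>2"] by force
      then show ?thesis by (simp add: b_def)
    qed
    have pt: "(cmod (b \<nu> - ?lam * complex_of_real (hcoeff \<nu> (sqrt 2 * \<rho> k))))\<^sup>2
       \<le> 2 * (C / \<rho> k)\<^sup>2 * (\<Sum>l. (1/2) ^ l * (y \<nu> l)\<^sup>2)" for \<nu>
    proof -
      let ?u = "\<lambda>l. (a (real \<nu> / (\<rho> k)\<^sup>2) - (if l = k then a 1 else 0)) * complex_of_real ((1/2) ^ l * hcoeff \<nu> (sqrt 2 * \<rho> l))"
      have "(\<lambda>l. a (real \<nu> / (\<rho> k)\<^sup>2) * complex_of_real ((1/2) ^ l * hcoeff \<nu> (sqrt 2 * \<rho> l))) sums b \<nu>"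
        unfolding b_def by (intro sums_mult sums_of_real packet_coeff_sums)
      moreover have "(\<lambda>l. if l = k then a 1 * complex_of_real ((1/2) ^ k * hcoeff \<nu> (sqrt 2 * \<rho> k)) else 0)
          sums (a 1 * complex_of_real ((1/2) ^ k * hcoeff \<nu> (sqrt 2 * \<rho> k)))"
        by (rule sums_single[of k "\<lambda>l. a 1 * complex_of_real ((1/2) ^ l * hcoeff \<nu> (sqrt 2 * \<rho> l))", THEN sums_cong[THEN iffD1, rotated]]) auto
      ultimately have "(\<lambda>l. a (real \<nu> / (\<rho> k)\<^sup>2) * complex_of_real ((1/2) ^ l * hcoeff \<nu> (sqrt 2 * \<rho> l)) -
          (if l = k then a 1 * complex_of_real ((1/2) ^ k * hcoeff \<nu> (sqrt 2 * \<rho> k)) else 0))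
          sums (b \<nu> - a 1 * complex_of_real ((1/2) ^ k * hcoeff \<nu> (sqrt 2 * \<rho> k)))" by (rule sums_diff)
      moreover have "a (real \<nu> / (\<rho> k)\<^sup>2) * complex_of_real ((1/2) ^ l * hcoeff \<nu> (sqrt 2 * \<rho> l)) -
          (if l = k then a 1 * complex_of_real ((1/2) ^ k * hcoeff \<nu> (sqrt 2 * \<rho> k)) else 0) = ?u l" for l
        by (cases "l = k") (simp_all only: simp_thms if_True if_False left_diff_distrib diff_zero mult_zero_left)
      moreover have "a 1 * complex_of_real ((1/2) ^ k * hcoeff \<nu> (sqrt 2 * \<rho> k)) = ?lam * complex_of_real (hcoeff \<nu> (sqrt 2 * \<rho> k))"
        by simp
      ultimately have us: "?u sums (b \<nu> - ?lam * complex_of_real (hcoeff \<nu> (sqrt 2 * \<rho> k)))" by (simp only:)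
      have "cmod (b \<nu> - ?lam * complex_of_real (hcoeff \<nu> (sqrt 2 * \<rho> k))) \<le> (\<Sum>l. C / \<rho> k * ((1/2) ^ l * y \<nu> l))"
        unfolding sums_unique[OF us]
      proof (rule norm_suminf_le)
        fix l
        have "cmod (?u l) = cmod (a (real \<nu> / (\<rho> k)\<^sup>2) - (if l = k then a 1 else 0)) * ((1/2) ^ l * \<bar>hcoeff \<nu> (sqrt 2 * \<rho> l)\<bar>)"
          by (simp only: norm_mult norm_of_real abs_mult power_abs abs_divide abs_one abs_numeral)
        also have "\<dots> \<le> C / \<rho> k * (\<bar>real \<nu> - (\<rho> l)\<^sup>2\<bar> / \<rho> l) * ((1/2) ^ l * \<bar>hcoeff \<nu> (sqrt 2 * \<rho> l)\<bar>)"
          by (intro mult_right_mono C) auto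
        also have "\<dots> = C / \<rho> k * ((1/2) ^ l * y \<nu> l)" by (simp only: y_def mult_ac)
        finally show "cmod (?u l) \<le> C / \<rho> k * ((1/2) ^ l * y \<nu> l)" .
      qed (intro summable_mult J)
      also have "\<dots> = C / \<rho> k * (\<Sum>l. (1/2) ^ l * y \<nu> l)" by (intro suminf_mult J)
      finally have "(cmod (b \<nu> - ?lam * complex_of_real (hcoeff \<nu> (sqrt 2 * \<rho> k))))\<^sup>2 \<le> (C / \<rho> k * (\<Sum>l. (1/2) ^ l * y \<nu> l))\<^sup>2"
        by (rule power_mono) simp
      also have "\<dots> = (C / \<rho> k)\<^sup>2 * (\<Sum>l. (1/2) ^ l * y \<nu> l)\<^sup>2" by (rule power_mult_distrib)
      also have "\<dots> \<le> (C / \<rho> k)\<^sup>2 * (2 * (\<Sum>l. (1/2) ^ l * (y \<nu> l)\<^sup>2))" by (intro mult_left_mono J) simp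
      finally show ?thesis by (simp only: mult_ac)
    qed
    have "(\<integral>\<^sup>+t. ennreal ((cmod (hermite_piece a \<rho> ((\<rho> k)\<^sup>2) M t
        - ?lam * complex_of_real (gauss (sqrt 2 * \<rho> k) t)))\<^sup>2) \<partial>lborel)
      = (\<Sum>\<nu>. ennreal ((cmod (b \<nu> - ?lam * complex_of_real (hcoeff \<nu> (sqrt 2 * \<rho> k))))\<^sup>2))"
      using nn_integral_hermite_deviation[of M b ?lam "sqrt 2 * \<rho> k", OF b0]
      unfolding hermite_piece_def b_def .
    also have "\<dots> \<le> (\<Sum>\<nu>. \<Sum>l. ennreal (2 * (C / \<rho> k)\<^sup>2 * ((1/2) ^ l * (y \<nu> l)\<^sup>2)))"
    proof (intro suminf_le summableI)
      fix \<nu>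
      have "ennreal ((cmod (b \<nu> - ?lam * complex_of_real (hcoeff \<nu> (sqrt 2 * \<rho> k))))\<^sup>2)
          \<le> ennreal (2 * (C / \<rho> k)\<^sup>2 * (\<Sum>l. (1/2) ^ l * (y \<nu> l)\<^sup>2))" by (rule ennreal_leI[OF pt])
      also have "2 * (C / \<rho> k)\<^sup>2 * (\<Sum>l. (1/2) ^ l * (y \<nu> l)\<^sup>2) = (\<Sum>l. 2 * (C / \<rho> k)\<^sup>2 * ((1/2) ^ l * (y \<nu> l)\<^sup>2))"
        by (intro suminf_mult[symmetric] J)
      also have "ennreal \<dots> = (\<Sum>l. ennreal (2 * (C / \<rho> k)\<^sup>2 * ((1/2) ^ l * (y \<nu> l)\<^sup>2)))"
        by (intro suminf_ennreal2[symmetric] summable_mult J) simp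
      finally show "ennreal ((cmod (b \<nu> - ?lam * complex_of_real (hcoeff \<nu> (sqrt 2 * \<rho> k))))\<^sup>2)
          \<le> (\<Sum>l. ennreal (2 * (C / \<rho> k)\<^sup>2 * ((1/2) ^ l * (y \<nu> l)\<^sup>2)))" .
    qed
    \<comment> \<open>With \<nu> innermost, the sum over \<nu> is the variance
      \<open>ysums\<close>.\<close>
    also have "\<dots> = (\<Sum>l. \<Sum>\<nu>. ennreal (2 * (C / \<rho> k)\<^sup>2 * ((1/2) ^ l * (y \<nu> l)\<^sup>2)))"
      by (rule suminf_swap_ennreal)
    also have "\<dots> = (\<Sum>l. ennreal (2 * (C / \<rho> k)\<^sup>2 * sqrt pi * (1/2) ^ l))"
    proof (intro suminf_cong)
      fix l
      have "(\<lambda>\<nu>. (2 * (C / \<rho> k)\<^sup>2 * (1/2) ^ l) * (y \<nu> l)\<^sup>2) sums ((2 * (C / \<rho> k)\<^sup>2 * (1/2) ^ l) * sqrt pi)"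
        by (rule sums_mult[OF ysums])
      then have s: "(\<lambda>\<nu>. 2 * (C / \<rho> k)\<^sup>2 * ((1/2) ^ l * (y \<nu> l)\<^sup>2)) sums (2 * (C / \<rho> k)\<^sup>2 * sqrt pi * (1/2) ^ l)"
        by (simp only: mult_ac)
      show "(\<Sum>\<nu>. ennreal (2 * (C / \<rho> k)\<^sup>2 * ((1/2) ^ l * (y \<nu> l)\<^sup>2))) = ennreal (2 * (C / \<rho> k)\<^sup>2 * sqrt pi * (1/2) ^ l)"
        unfolding sums_unique[OF s] by (rule suminf_ennreal2[OF _ sums_summable[OF s]]) simp
    qed
    also have "\<dots> = ennreal (4 * C\<^sup>2 * sqrt pi / (\<rho> k)\<^sup>2)"
    proof -
      have "(\<lambda>l. 2 * (C / \<rho> k)\<^sup>2 * sqrt pi * (1/2) ^ l) sums (2 * (C / \<rho> k)\<^sup>2 * sqrt pi * 2)"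
        using geometric_sums[of "1/2 :: real"] by (intro sums_mult) simp
      moreover have "2 * (C / \<rho> k)\<^sup>2 * sqrt pi * 2 = 4 * C\<^sup>2 * sqrt pi / (\<rho> k)\<^sup>2" by (simp add: power_divide)
      ultimately have s: "(\<lambda>l. 2 * (C / \<rho> k)\<^sup>2 * sqrt pi * (1/2) ^ l) sums (4 * C\<^sup>2 * sqrt pi / (\<rho> k)\<^sup>2)" by (simp only:)
      show ?thesis unfolding sums_unique[OF s] by (rule suminf_ennreal2[OF _ sums_summable[OF s]]) simp
    qed
    finally show "(\<integral>\<^sup>+t. ennreal ((cmod (hermite_piece a \<rho> ((\<rho> k)\<^sup>2) M t
        - (1/2) ^ k * a 1 * complex_of_real (gauss (sqrt 2 * \<rho> k) t)))\<^sup>2) \<partial>lborel) \<le> ennreal (4 * C\<^sup>2 * sqrt pi / (\<rho> k)\<^sup>2)" .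
  qed
qed

text \<open>On the unit neighbourhood of the \<open>k\<close>-th centre, either the piece is at least \<open>\<delta> / 2\<^sup>k\<close> or its
  distance to the \<open>k\<close>-th Gaussian is; the second alternative fails on half of the interval by the
  \<open>L\<^sup>2\<close> estimate. This gives a lower bound for every \<open>p > 0\<close>.\<close>

lemma hermite_piece_lower:
  fixes \<rho> :: "nat \<Rightarrow> real"
  assumes a: "hermite_admissible a" and pos: "\<And>k. \<rho> k > 0"
    and sep: "\<And>k l. k < l \<Longrightarrow> 4 * \<rho> k \<le> \<rho> l" and grow: "\<And>k. 4 ^ k \<le> \<rho> k" and p: "p > 0"
  obtains \<delta> K where "\<delta> > 0"
    "\<And>k M. K \<le> k \<Longrightarrow> 4 * (\<rho> k)\<^sup>2 < real M \<Longrightarrow>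
       ennreal ((\<delta> / 2 ^ k) powr p) \<le> (\<integral>\<^sup>+t. ennreal (cmod (hermite_piece a \<rho> ((\<rho> k)\<^sup>2) M t) powr p) \<partial>lborel)"
proof -
  obtain C where C: "C \<ge> 0"
    "\<And>k M. 4 * (\<rho> k)\<^sup>2 < real M \<Longrightarrow> (\<integral>\<^sup>+t. ennreal ((cmod (hermite_piece a \<rho> ((\<rho> k)\<^sup>2) M t
        - (1/2) ^ k * a 1 * complex_of_real (gauss (sqrt 2 * \<rho> k) t)))\<^sup>2) \<partial>lborel) \<le> ennreal (C / (\<rho> k)\<^sup>2)"
    using hermite_piece_approx[where \<rho> = \<rho>, OF a pos sep] by blast
  \<comment> \<open>\<open>exp (- 1 / 2)\<close> is the minimum of the Gaussian at distance at most
    1 from its centre; halving shares its size between the two alternatives.\<close>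
  define \<delta> where "\<delta> = cmod (a 1) * exp (- 1 / 2) / 2"
  have \<delta>: "\<delta> > 0" using admissible_nonzero[OF a] by (simp add: \<delta>_def)
  \<comment> \<open>By \<open>grow\<close> the squared error is at most C / 16^k, to be compared
    with \<delta>^2 / 4^k. So C \<le> 4^k \<delta>^2 suffices, and \<open>real k \<le> 4 ^ k\<close>
    provides it from \<open>K\<close> on.\<close>
  obtain K where K: "C / \<delta>\<^sup>2 \<le> real K" using real_arch_simple by blast
  show ?thesis
  proof
    show "\<delta> > 0" by fact
    fix k M assume k: "K \<le> k" and M: "4 * (\<rho> k)\<^sup>2 < real M"
    define d where "d = \<delta> / 2 ^ k"
    have d: "d > 0" using \<delta> by (simp add: d_def)
    let ?U = "hermite_piece a \<rho> ((\<rho> k)\<^sup>2) M" and ?g = "\<lambda>t. (1/2) ^ k * a 1 * complex_of_real (gauss (sqrt 2 * \<rho> k) t)"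
    let ?I = "{sqrt 2 * \<rho> k - 1..sqrt 2 * \<rho> k + 1}"
    let ?X = "\<integral>\<^sup>+t. ennreal (cmod (?U t) powr p) \<partial>lborel"
    have small: "C / (\<rho> k)\<^sup>2 \<le> d\<^sup>2"
    proof -
      have "C / \<delta>\<^sup>2 \<le> real k" using K k by linarith
      then have "C \<le> real k * \<delta>\<^sup>2" using \<delta> by (simp add: pos_divide_le_eq)
      also have "real k \<le> 4 ^ k"
        using of_nat_less_two_power[of k, where 'a = real] power_mono[of "2::real" 4 k] by simp
      then have "real k * \<delta>\<^sup>2 \<le> 4 ^ k * \<delta>\<^sup>2" by (intro mult_right_mono) auto
      finally have C4: "C \<le> 4 ^ k * \<delta>\<^sup>2" .
      have "(4 ^ k)\<^sup>2 \<le> (\<rho> k)\<^sup>2" using grow by (intro power_mono) auto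
      then have "4 ^ k * \<delta>\<^sup>2 * 4 ^ k \<le> \<delta>\<^sup>2 * (\<rho> k)\<^sup>2" using mult_left_mono[of "(4 ^ k)\<^sup>2" "(\<rho> k)\<^sup>2" "\<delta>\<^sup>2"] by (simp add: power2_eq_square mult_ac)
      moreover have "C * 4 ^ k \<le> 4 ^ k * \<delta>\<^sup>2 * 4 ^ k" by (rule mult_right_mono[OF C4]) simp
      ultimately have "C * 4 ^ k \<le> \<delta>\<^sup>2 * (\<rho> k)\<^sup>2" by linarith
      moreover have "(2 ^ k)\<^sup>2 = (4 ^ k :: real)" by (simp add: power2_eq_square flip: power_mult_distrib)
      ultimately show ?thesis using pos[of k] by (simp add: d_def power_divide field_simps)
    qed
    \<comment> \<open>Chebyshev's argument as one pointwise inequality. Integration gives 2 on the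
      left, the length of the interval; the last term contributes at most 1, which leaves at least 1
      for the \<open>p\<close>-th power.\<close>
    have pt: "indicator ?I t \<le> ennreal (1 / d powr p) * ennreal (cmod (?U t) powr p) + ennreal (1 / d\<^sup>2) * ennreal ((cmod (?U t - ?g t))\<^sup>2)" for t
    proof (cases "t \<in> ?I")
      case True
      then have "(t - sqrt 2 * \<rho> k)\<^sup>2 \<le> 1" using abs_le_square_iff[of "t - sqrt 2 * \<rho> k" 1] by auto
      then have "exp (- 1 / 2) \<le> gauss (sqrt 2 * \<rho> k) t" by (simp add: gauss_def)
      then have "(1/2) ^ k * cmod (a 1) * exp (- 1 / 2) \<le> cmod (?g t)"
        by (simp add: norm_mult norm_power norm_divide mult_left_mono)
      then have g: "2 * d \<le> cmod (?g t)" by (simp add: d_def \<delta>_def power_divide)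
      have "1 \<le> 1 / d powr p * cmod (?U t) powr p + 1 / d\<^sup>2 * (cmod (?U t - ?g t))\<^sup>2"
      proof (cases "d \<le> cmod (?U t)")
        case True
        then have "d powr p \<le> cmod (?U t) powr p" using d p by (intro powr_mono2) auto
        then have "1 \<le> 1 / d powr p * cmod (?U t) powr p" using d by (simp add: field_simps)
        moreover have "0 \<le> 1 / d\<^sup>2 * (cmod (?U t - ?g t))\<^sup>2" by simp
        ultimately show ?thesis by linarith
      next
        case False
        then have "d \<le> cmod (?U t - ?g t)" using g norm_triangle_ineq2[of "?g t" "?U t"] norm_minus_commute[of "?U t" "?g t"] by linarith
        then have "d\<^sup>2 \<le> (cmod (?U t - ?g t))\<^sup>2" using d by (intro power_mono) auto
        then have "1 \<le> 1 / d\<^sup>2 * (cmod (?U t - ?g t))\<^sup>2" using d by (simp add: field_simps)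
        moreover have "0 \<le> 1 / d powr p * cmod (?U t) powr p" by simp
        ultimately show ?thesis by linarith
      qed
      then have "ennreal 1 \<le> ennreal (1 / d powr p * cmod (?U t) powr p + 1 / d\<^sup>2 * (cmod (?U t - ?g t))\<^sup>2)"
        by (rule ennreal_leI)
      also have "\<dots> = ennreal (1 / d powr p) * ennreal (cmod (?U t) powr p) + ennreal (1 / d\<^sup>2) * ennreal ((cmod (?U t - ?g t))\<^sup>2)"
        by (subst ennreal_plus) (simp_all only: ennreal_mult[symmetric] zero_le_power2 powr_ge_zero divide_nonneg_nonneg mult_nonneg_nonneg zero_le_one)
      finally show ?thesis using True by simp
    qed simp
    have "2 = (\<integral>\<^sup>+t. indicator ?I t \<partial>lborel)" by simp
    also have "\<dots> \<le> (\<integral>\<^sup>+t. ennreal (1 / d powr p) * ennreal (cmod (?U t) powr p) + ennreal (1 / d\<^sup>2) * ennreal ((cmod (?U t - ?g t))\<^sup>2) \<partial>lborel)"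
      by (intro nn_integral_mono pt)
    also have "\<dots> = ennreal (1 / d powr p) * ?X + ennreal (1 / d\<^sup>2) * (\<integral>\<^sup>+t. ennreal ((cmod (?U t - ?g t))\<^sup>2) \<partial>lborel)"
      by (subst nn_integral_add) (simp_all add: nn_integral_cmult)
    also have "\<dots> \<le> ennreal (1 / d powr p) * ?X + ennreal 1"
    proof (rule add_left_mono)
      have "ennreal (1 / d\<^sup>2) * (\<integral>\<^sup>+t. ennreal ((cmod (?U t - ?g t))\<^sup>2) \<partial>lborel) \<le> ennreal (1 / d\<^sup>2) * ennreal (C / (\<rho> k)\<^sup>2)"
        using C(2) M by (intro mult_left_mono) auto
      also have "\<dots> = ennreal (1 / d\<^sup>2 * (C / (\<rho> k)\<^sup>2))"
        using C(1) by (intro ennreal_mult[symmetric]) auto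
      also have "\<dots> \<le> ennreal (1 / d\<^sup>2 * d\<^sup>2)"
        by (intro ennreal_leI mult_left_mono small) simp
      also have "1 / d\<^sup>2 * d\<^sup>2 = 1" using d by simp
      finally show "ennreal (1 / d\<^sup>2) * (\<integral>\<^sup>+t. ennreal ((cmod (?U t - ?g t))\<^sup>2) \<partial>lborel) \<le> ennreal 1" .
    qed
    finally have two: "2 \<le> ennreal (1 / d powr p) * ?X + ennreal 1" .
    show "ennreal ((\<delta> / 2 ^ k) powr p) \<le> ?X"
    proof (rule ccontr)
      assume "\<not> ?thesis"
      then have lt: "?X < ennreal (d powr p)" by (simp add: d_def)
      then obtain x where x: "?X = ennreal x" "x \<ge> 0" by (cases ?X) auto
      then have "x < d powr p" using lt by (simp add: ennreal_less_iff)
      then have "1 / d powr p * x < 1" using d by (simp add: field_simps)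
      moreover have "ennreal (1 / d powr p * x + 1) = ennreal (1 / d powr p) * ennreal x + ennreal 1"
      proof -
        have "ennreal (1 / d powr p * x + 1) = ennreal (1 / d powr p * x) + ennreal 1"
          by (rule ennreal_plus) (use x(2) in auto)
        also have "ennreal (1 / d powr p * x) = ennreal (1 / d powr p) * ennreal x"
          by (rule ennreal_mult) (use x(2) in auto)
        finally show ?thesis .
      qed
      then have "ennreal 2 \<le> ennreal (1 / d powr p * x + 1)"
        using two by (simp only: x(1) ennreal_numeral)
      then have "2 \<le> 1 / d powr p * x + 1" using x(2) by (subst (asm) ennreal_le_iff) auto
      ultimately show False by linarith
    qed
  qed
qed

section \<open>Reduction of the Hermite pieces to one dimension\<close>

lemma hermite_tensor_measurable [measurable]: "hermite_tensor \<beta> \<in> borel_measurable borel"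
  unfolding hermite_tensor_def by measurable

lemma hermite_kernel_measurable [measurable]: "hermite_kernel \<nu> x \<in> borel_measurable borel"
  unfolding hermite_kernel_def by measurable

lemma hermite_kernel_bounded: obtains B where "\<And>y. \<bar>hermite_kernel \<nu> x (y :: real^'n)\<bar> \<le> B"
proof -
  have "\<exists>B. \<forall>t. \<bar>hermite_fun n t\<bar> \<le> B" for n
    by (rule hermite_fun_bounded[of n]) blast
  then obtain B where B: "\<And>n t. \<bar>hermite_fun n t\<bar> \<le> B n" by metis
  have "\<bar>hermite_tensor \<beta> y\<bar> \<le> (\<Prod>i\<in>UNIV. B (\<beta> i))" for \<beta> and y :: "real^'n"
    unfolding hermite_tensor_def abs_prod using B by (intro prod_mono) auto
  then have "\<bar>hermite_kernel \<nu> x y\<bar> \<le> (\<Sum>\<beta> | (\<Sum>i\<in>UNIV. \<beta> i) = \<nu>. \<bar>hermite_tensor \<beta> x\<bar> * (\<Prod>i\<in>UNIV. B (\<beta> i)))" for y :: "real^'n"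
    unfolding hermite_kernel_def
    by (intro order_trans[OF sum_abs] sum_mono) (auto simp: abs_mult intro!: mult_left_mono)
  then show ?thesis by (rule that)
qed

lemma hermite_kernel_bounded_complex: obtains B where "\<And>y. cmod (complex_of_real (hermite_kernel \<nu> x (y :: real^'n))) \<le> B"
  using hermite_kernel_bounded[of \<nu> x] by (metis norm_of_real)

lemma finite_multiindices: "finite {\<beta> :: 'n::finite \<Rightarrow> nat. (\<Sum>i\<in>UNIV. \<beta> i) = \<nu>}"
proof (rule finite_subset)
  have "\<beta> i \<le> (\<Sum>i\<in>UNIV. \<beta> i)" for \<beta> :: "'n \<Rightarrow> nat" and i by (rule member_le_sum) auto
  then show "{\<beta> :: 'n \<Rightarrow> nat. (\<Sum>i\<in>UNIV. \<beta> i) = \<nu>} \<subseteq> (\<Pi>\<^sub>E i\<in>UNIV. {..\<nu>})" by auto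
qed (intro finite_PiE, auto)

text \<open>The transverse factor: packets on the \<open>i\<close>-th axis are centred at 0 in all
  other directions.\<close>

definition cross_gauss :: "'n \<Rightarrow> real^'n \<Rightarrow> real" where
  "cross_gauss i x = (\<Prod>k\<in>UNIV - {i}. gauss 0 (x $ k))"

text \<open>Expresses that \<open>gauss 0\<close> is its own projection onto the ground state;
  together with \<open>hcoeff_zero\<close> it settles the transverse directions.\<close>

lemma hermite_fun_0: "hermite_fun 0 t * hcoeff 0 0 = gauss 0 t"
  using hermite_fun_norm[of 0] by (simp add: hermite_fun_def hermite_poly_eq hcoeff_eq gauss_def power2_eq_square mult_ac)

lemma hcoeff_zero: "n \<noteq> 0 \<Longrightarrow> hcoeff n 0 = 0"
  by (simp add: hcoeff_eq)

lemma
  fixes z :: "real^'n"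
  shows integrable_bump_hermite_tensor: "integrable lborel (\<lambda>y. bump z y * hermite_tensor \<beta> y)"
    and integral_bump_hermite_tensor: "(LINT y|lborel. bump z y * hermite_tensor \<beta> y) = (\<Prod>k\<in>UNIV. hcoeff (\<beta> k) (z $ k))"
proof -
  have eq: "bump z y * hermite_tensor \<beta> y = (\<Prod>k\<in>UNIV. gauss (z $ k) (y $ k) * hermite_fun (\<beta> k) (y $ k))" for y :: "real^'n"
    by (simp add: bump_def hermite_tensor_def prod.distrib)
  show "integrable lborel (\<lambda>y. bump z y * hermite_tensor \<beta> y)"
    unfolding eq by (intro integrable_vec_prod integrable_gauss_hermite_fun)
  show "(LINT y|lborel. bump z y * hermite_tensor \<beta> y) = (\<Prod>k\<in>UNIV. hcoeff (\<beta> k) (z $ k))"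
    unfolding eq hcoeff_def by (intro integral_vec_prod integrable_gauss_hermite_fun)
qed

text \<open>Translating a Gaussian along the \<open>i\<close>-th axis excites only the multi-indices supported in \<open>i\<close>.\<close>

lemma integral_bump_hermite_kernel:
  fixes x :: "real^'n"
  shows "(LINT y|lborel. bump (R *\<^sub>R axis i 1) y * hermite_kernel \<nu> x y)
     = hcoeff \<nu> R * (hermite_fun \<nu> (x $ i) * cross_gauss i x)"
proof -
  let ?z = "R *\<^sub>R axis i 1 :: real^'n" and ?S = "{\<beta> :: 'n \<Rightarrow> nat. (\<Sum>i\<in>UNIV. \<beta> i) = \<nu>}"
  let ?T = "\<lambda>\<beta>. hermite_tensor \<beta> x * (\<Prod>k\<in>UNIV. hcoeff (\<beta> k) (?z $ k))"
  define \<beta>0 where "\<beta>0 k = (if k = i then \<nu> else 0)" for k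
  have zk: "?z $ k = (if k = i then R else 0)" for k by (simp add: axis_def)
  have "(LINT y|lborel. bump ?z y * hermite_kernel \<nu> x y) = (LINT y|lborel. (\<Sum>\<beta>\<in>?S. hermite_tensor \<beta> x * (bump ?z y * hermite_tensor \<beta> y)))"
    by (simp add: hermite_kernel_def sum_distrib_left mult_ac)
  also have "\<dots> = (\<Sum>\<beta>\<in>?S. LINT y|lborel. hermite_tensor \<beta> x * (bump ?z y * hermite_tensor \<beta> y))"
    by (intro Bochner_Integration.integral_sum integrable_mult_right integrable_bump_hermite_tensor)
  also have "\<dots> = (\<Sum>\<beta>\<in>?S. ?T \<beta>)"
    by (simp only: integral_mult_right_zero integral_bump_hermite_tensor)
  also have "\<dots> = (\<Sum>\<beta>\<in>{\<beta>0}. ?T \<beta>)"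
  proof (rule sum.mono_neutral_right[OF finite_multiindices])
    show "{\<beta>0} \<subseteq> ?S" by (simp add: \<beta>0_def)
    show "\<forall>\<beta>\<in>?S - {\<beta>0}. ?T \<beta> = 0"
    proof
      fix \<beta> assume \<beta>: "\<beta> \<in> ?S - {\<beta>0}"
      have "\<exists>k. k \<noteq> i \<and> \<beta> k \<noteq> 0"
      proof (rule ccontr)
        assume "\<not> ?thesis"
        then have z: "\<And>k. k \<noteq> i \<Longrightarrow> \<beta> k = 0" by blast
        then have "(\<Sum>k\<in>UNIV. \<beta> k) = \<beta> i" by (subst sum.remove[of _ i]) auto
        then have "\<beta> i = \<nu>" using \<beta> by simp
        then have "\<beta> = \<beta>0" using z by (auto simp: \<beta>0_def fun_eq_iff)
        then show False using \<beta> by simp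
      qed
      then obtain k where "k \<noteq> i" "\<beta> k \<noteq> 0" by blast
      then have "hcoeff (\<beta> k) (?z $ k) = 0" using hcoeff_zero[of "\<beta> k"] by (simp add: zk del: vector_scaleR_component)
      then have "(\<Prod>k\<in>UNIV. hcoeff (\<beta> k) (?z $ k)) = 0" by (meson UNIV_I finite prod_zero)
      then show "?T \<beta> = 0" by simp
    qed
  qed
  also have "\<dots> = (\<Prod>k\<in>UNIV. hermite_fun (\<beta>0 k) (x $ k) * hcoeff (\<beta>0 k) (?z $ k))"
    by (simp add: hermite_tensor_def prod.distrib)
  also have "\<dots> = (hermite_fun (\<beta>0 i) (x $ i) * hcoeff (\<beta>0 i) (?z $ i)) *
      (\<Prod>k\<in>UNIV - {i}. hermite_fun (\<beta>0 k) (x $ k) * hcoeff (\<beta>0 k) (?z $ k))"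
    by (rule prod.remove) auto
  also have "(\<Prod>k\<in>UNIV - {i}. hermite_fun (\<beta>0 k) (x $ k) * hcoeff (\<beta>0 k) (?z $ k)) = cross_gauss i x"
    unfolding cross_gauss_def by (intro prod.cong refl) (simp add: zk \<beta>0_def hermite_fun_0 del: vector_scaleR_component)
  finally show ?thesis by (simp add: zk \<beta>0_def mult_ac del: vector_scaleR_component)
qed

definition axis_centres :: "'n \<Rightarrow> (nat \<Rightarrow> real) \<Rightarrow> nat \<Rightarrow> real^'n" where
  "axis_centres i \<rho> k = (sqrt 2 * \<rho> k) *\<^sub>R axis i 1"

text \<open>The index \<open>Suc n\<close> goes with the scale \<open>4 ^ n\<close>. All packets
  share the transverse factor, which therefore comes out of the sum over packets as well as out of
  the sum over \<nu>.\<close>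

lemma kernel_conv_hermite_packets:
  fixes x :: "real^'n"
  assumes a: "hermite_admissible a" and M: "4 * 4 ^ n < M"
  shows "kernel_conv (hermite_lp_kernel a (Suc n)) (dist_of_fun (\<lambda>y. complex_of_real (packets (axis_centres i \<rho>) y))) x
     = hermite_piece a \<rho> (4 ^ n) M (x $ i) * complex_of_real (cross_gauss i x)"
proof -
  let ?z = "axis_centres i \<rho>"
  let ?H = "\<lambda>\<nu> y. complex_of_real (hermite_kernel \<nu> x y)"
  have int: "integrable lborel (\<lambda>y. complex_of_real (packets ?z y) * ?H \<nu> y)" for \<nu>
  proof -
    obtain B where B: "\<And>y. cmod (?H \<nu> y) \<le> B" using hermite_kernel_bounded_complex by blast
    show ?thesis by (rule integrable_packets[OF _ B]) measurable
  qed
  have val: "(LINT y|lborel. complex_of_real (packets ?z y) * ?H \<nu> y)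
      = complex_of_real (packet_coeff \<rho> \<nu> * (hermite_fun \<nu> (x $ i) * cross_gauss i x))" for \<nu>
  proof -
    obtain B where B: "\<And>y. cmod (?H \<nu> y) \<le> B" using hermite_kernel_bounded_complex by blast
    have "(\<lambda>l. complex_of_real ((1/2) ^ l) * (LINT y|lborel. complex_of_real (bump (?z l) y) * ?H \<nu> y))
       sums (LINT y|lborel. complex_of_real (packets ?z y) * ?H \<nu> y)"
      by (rule packets_sums[OF _ B]) measurable
    moreover have "complex_of_real ((1/2) ^ l) * (LINT y|lborel. complex_of_real (bump (?z l) y) * ?H \<nu> y)
      = complex_of_real (((1/2) ^ l * hcoeff \<nu> (sqrt 2 * \<rho> l)) * (hermite_fun \<nu> (x $ i) * cross_gauss i x))" for l
      unfolding of_real_mult[symmetric] integral_complex_of_real axis_centres_def integral_bump_hermite_kernel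
      by (simp only: mult.assoc)
    ultimately have "(\<lambda>l. complex_of_real (((1/2) ^ l * hcoeff \<nu> (sqrt 2 * \<rho> l)) * (hermite_fun \<nu> (x $ i) * cross_gauss i x)))
       sums (LINT y|lborel. complex_of_real (packets ?z y) * ?H \<nu> y)" by (simp only:)
    moreover have "(\<lambda>l. complex_of_real (((1/2) ^ l * hcoeff \<nu> (sqrt 2 * \<rho> l)) * (hermite_fun \<nu> (x $ i) * cross_gauss i x)))
       sums complex_of_real (packet_coeff \<rho> \<nu> * (hermite_fun \<nu> (x $ i) * cross_gauss i x))"
      by (intro sums_of_real sums_mult2 packet_coeff_sums)
    ultimately show ?thesis by (rule sums_unique2)
  qed
  have K: "hermite_lp_kernel a (Suc n) x y = (\<Sum>\<nu><M. a (real \<nu> / 4 ^ n) * ?H \<nu> y)" for y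
  proof -
    have "a (real \<nu> / 4 ^ n) = 0" if "\<nu> \<notin> {..<M}" for \<nu>
    proof -
      have "real (4 * 4 ^ n) < real \<nu>" using that M by (subst of_nat_less_iff) simp
      then have "4 < real \<nu> / 4 ^ n" by (simp add: field_simps)
      then show ?thesis using admissible_support[OF a, of "real \<nu> / 4 ^ n"] by force
    qed
    then show ?thesis unfolding hermite_lp_kernel_def by (simp, intro suminf_finite) auto
  qed
  have "kernel_conv (hermite_lp_kernel a (Suc n)) (dist_of_fun (\<lambda>y. complex_of_real (packets ?z y))) x
     = (LINT y|lborel. complex_of_real (packets ?z y) * (\<Sum>\<nu><M. a (real \<nu> / 4 ^ n) * ?H \<nu> y))"
    by (simp add: kernel_conv_def pairing_def dist_of_fun_def K)
  also have "\<dots> = (LINT y|lborel. (\<Sum>\<nu><M. a (real \<nu> / 4 ^ n) * (complex_of_real (packets ?z y) * ?H \<nu> y)))"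
    by (simp only: sum_distrib_left mult.left_commute)
  also have "\<dots> = (\<Sum>\<nu><M. LINT y|lborel. a (real \<nu> / 4 ^ n) * (complex_of_real (packets ?z y) * ?H \<nu> y))"
    by (intro Bochner_Integration.integral_sum integrable_mult_right int)
  also have "\<dots> = (\<Sum>\<nu><M. a (real \<nu> / 4 ^ n) * complex_of_real (packet_coeff \<rho> \<nu> * (hermite_fun \<nu> (x $ i) * cross_gauss i x)))"
    by (simp only: integral_mult_right_zero val)
  also have "\<dots> = hermite_piece a \<rho> (4 ^ n) M (x $ i) * complex_of_real (cross_gauss i x)"
    unfolding hermite_piece_def sum_distrib_right by (simp only: of_real_mult mult.assoc)
  finally show ?thesis .
qed

text \<open>The integral of the \<open>p\<close>-th power factors. Each of the transverse factors is
  bounded below on the unit interval, where \<open>gauss 0\<close> is at least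
  \<open>exp (- 1 / 2)\<close>.\<close>

lemma Lp_qnorm_axis_product:
  fixes u :: "real \<Rightarrow> complex" and i :: "'n::finite"
  assumes p: "p > 0" and [measurable]: "u \<in> borel_measurable borel" and v: "v \<ge> 0"
    and u: "ennreal (v powr p) \<le> (\<integral>\<^sup>+t. ennreal (cmod (u t) powr p) \<partial>lborel)"
  shows "ennreal (v * exp (- 1 / 2) ^ (CARD('n) - 1)) \<le> Lp_qnorm p (\<lambda>x::real^'n. u (x $ i) * complex_of_real (cross_gauss i x))"
proof -
  let ?e = "exp (- 1 / 2) :: real"
  let ?f = "\<lambda>k t. if k = i then ennreal (cmod (u t) powr p) else ennreal (gauss 0 t powr p)"
  have G: "ennreal (?e powr p) \<le> (\<integral>\<^sup>+t. ennreal (gauss 0 t powr p) \<partial>lborel)"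
  proof -
    have "?e powr p \<le> gauss 0 t powr p" if "t \<in> {0..1}" for t
    proof -
      have "t\<^sup>2 \<le> 1" using that by (simp add: power_le_one)
      then show ?thesis using p by (intro powr_mono2) (auto simp: gauss_def)
    qed
    then have "(\<integral>\<^sup>+t. ennreal (?e powr p) * indicator {0..1::real} t \<partial>lborel) \<le> (\<integral>\<^sup>+t. ennreal (gauss 0 t powr p) \<partial>lborel)"
      by (intro nn_integral_mono) (auto simp: indicator_def intro!: ennreal_leI)
    then show ?thesis by (simp add: nn_integral_cmult)
  qed
  have pt: "ennreal (cmod (u (x $ i) * complex_of_real (cross_gauss i x)) powr p) = (\<Prod>k\<in>UNIV. ?f k (x $ k))" for x :: "real^'n"
  proof -
    have "cross_gauss i x \<ge> 0" by (simp add: cross_gauss_def prod_nonneg)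
    then have "cmod (u (x $ i) * complex_of_real (cross_gauss i x)) = cmod (u (x $ i)) * cross_gauss i x"
      by (simp add: norm_mult)
    then have "cmod (u (x $ i) * complex_of_real (cross_gauss i x)) powr p = cmod (u (x $ i)) powr p * (\<Prod>k\<in>UNIV - {i}. gauss 0 (x $ k) powr p)"
      by (simp add: powr_mult cross_gauss_def prod_nonneg prod_powr_distrib)
    moreover have "(\<Prod>k\<in>UNIV. ?f k (x $ k)) = ?f i (x $ i) * (\<Prod>k\<in>UNIV - {i}. ?f k (x $ k))" by (rule prod.remove) auto
    moreover have "(\<Prod>k\<in>UNIV - {i}. ?f k (x $ k)) = (\<Prod>k\<in>UNIV - {i}. ennreal (gauss 0 (x $ k) powr p))" by (intro prod.cong) auto
    ultimately show ?thesis by (simp add: prod_ennreal ennreal_mult prod_nonneg)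
  qed
  have "ennreal ((v * ?e ^ (CARD('n) - 1)) powr p) = ennreal (v powr p) * ennreal (?e powr p) ^ (CARD('n) - 1)"
  proof -
    have "(?e ^ m) powr p = (?e powr p) ^ m" for m by (simp add: powr_realpow[symmetric] powr_powr mult.commute)
    then show ?thesis using v by (simp add: powr_mult ennreal_mult ennreal_power)
  qed
  also have "\<dots> \<le> (\<integral>\<^sup>+t. ennreal (cmod (u t) powr p) \<partial>lborel) * (\<integral>\<^sup>+t. ennreal (gauss 0 t powr p) \<partial>lborel) ^ (CARD('n) - 1)"
    by (intro mult_mono u power_mono G) auto
  also have "\<dots> = (\<Prod>k\<in>(UNIV::'n set). \<integral>\<^sup>+t. ?f k t \<partial>lborel)"
    by (subst prod.remove[of UNIV i]) (auto simp: card_Diff_singleton)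
  also have "\<dots> = (\<integral>\<^sup>+x. (\<Prod>k\<in>UNIV. ?f k ((x :: real^'n) $ k)) \<partial>lborel)"
    by (rule nn_integral_vec_prod[symmetric]) measurable
  finally have "epow (ennreal ((v * ?e ^ (CARD('n) - 1)) powr p)) (1 / p) \<le> Lp_qnorm p (\<lambda>x::real^'n. u (x $ i) * complex_of_real (cross_gauss i x))"
    unfolding Lp_qnorm_def pt using p by (intro epow_mono) auto
  then show ?thesis using p v by (simp add: epow_ennreal powr_powr)
qed

section \<open>Divergence of the Hermite-Besov quasi-norm and the conclusion\<close>

text \<open>\<open>2 \<le> B\<close> yields the separation factor 4 and the growth
  \<open>4 ^ k\<close> of the scales; \<open>2 \<le> \<alpha> * real B\<close> makes the smoothness
  weight outgrow the packet weights. Single terms of the series are then unbounded, so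
  \<open>q\<close> does not affect the divergence.\<close>

theorem packets_hermite_besov_infinite:
  fixes i :: "'n::finite"
  assumes a: "hermite_admissible a" and p: "p > 0" and q: "q > 0" and \<alpha>: "\<alpha> > 0"
    and B: "2 \<le> B" "2 \<le> \<alpha> * real B"
  shows "hermite_besov_qnorm a \<alpha> p q
     (dist_of_fun (\<lambda>x::real^'n. complex_of_real (packets (axis_centres i (\<lambda>k. 2 ^ (B * k))) x))) = \<infinity>"
proof -
  let ?\<rho> = "\<lambda>k. 2 ^ (B * k) :: real"
  let ?f = "dist_of_fun (\<lambda>x::real^'n. complex_of_real (packets (axis_centres i ?\<rho>) x))"
  have sep: "4 * ?\<rho> k \<le> ?\<rho> l" if "k < l" for k l
  proof -
    have "B * k + 2 \<le> B * l" using that B(1) mult_le_mono2[of "Suc k" l B] by simp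
    then have "(2::real) ^ (B * k + 2) \<le> 2 ^ (B * l)" by (intro power_increasing) auto
    then show ?thesis by (simp add: power_add)
  qed
  have grow: "4 ^ k \<le> ?\<rho> k" for k
  proof -
    have "(4::real) ^ k = 2 ^ (2 * k)" by (simp add: power_mult)
    also have "\<dots> \<le> 2 ^ (B * k)" using B(1) by (intro power_increasing) auto
    finally show ?thesis .
  qed
  obtain \<delta> K where \<delta>: "\<delta> > 0" and low: "\<And>k M. K \<le> k \<Longrightarrow> 4 * (?\<rho> k)\<^sup>2 < real M \<Longrightarrow>
       ennreal ((\<delta> / 2 ^ k) powr p) \<le> (\<integral>\<^sup>+t. ennreal (cmod (hermite_piece a ?\<rho> ((?\<rho> k)\<^sup>2) M t) powr p) \<partial>lborel)"
    by (rule hermite_piece_lower[where \<rho> = ?\<rho>, OF a _ sep grow p]) auto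
  define \<gamma> where "\<gamma> = \<delta> * exp (- 1 / 2) ^ (CARD('n) - 1)"
  have \<gamma>: "\<gamma> > 0" using \<delta> by (simp add: \<gamma>_def)
  let ?S = "\<Sum>j. epow (ennreal (2 powr (\<alpha> * real j)) * Lp_qnorm p (kernel_conv (hermite_lp_kernel a j) ?f)) q"
  have big: "ennreal ((\<gamma> * 2 ^ k) powr q) \<le> ?S" if k: "K \<le> k" for k
  proof -
    let ?M = "4 * 4 ^ (B * k) + 1 :: nat"
    have sq: "(?\<rho> k)\<^sup>2 = 4 ^ (B * k)" by (simp add: power2_eq_square flip: power_mult_distrib)
    have "4 * (?\<rho> k)\<^sup>2 < real ?M" by (simp add: sq)
    from low[OF k this] have "ennreal ((\<delta> / 2 ^ k) powr p) \<le> (\<integral>\<^sup>+t. ennreal (cmod (hermite_piece a ?\<rho> (4 ^ (B * k)) ?M t) powr p) \<partial>lborel)"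
      by (simp only: sq)
    then have "ennreal (\<delta> / 2 ^ k * exp (- 1 / 2) ^ (CARD('n) - 1))
        \<le> Lp_qnorm p (\<lambda>x::real^'n. hermite_piece a ?\<rho> (4 ^ (B * k)) ?M (x $ i) * complex_of_real (cross_gauss i x))"
      using \<delta> by (intro Lp_qnorm_axis_product[OF p]) auto
    also have "(\<lambda>x::real^'n. hermite_piece a ?\<rho> (4 ^ (B * k)) ?M (x $ i) * complex_of_real (cross_gauss i x))
        = kernel_conv (hermite_lp_kernel a (Suc (B * k))) ?f"
      by (rule ext, rule kernel_conv_hermite_packets[symmetric, OF a]) simp
    finally have Lp: "ennreal (\<gamma> / 2 ^ k) \<le> Lp_qnorm p (kernel_conv (hermite_lp_kernel a (Suc (B * k))) ?f)"
      by (simp add: \<gamma>_def)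
    \<comment> \<open>The smoothness weight is at least \<open>4 ^ k\<close>, against the loss
      \<open>2 ^ k\<close> in the amplitude of the packet.\<close>
    have "\<gamma> * 2 ^ k = 4 ^ k * (\<gamma> / 2 ^ k)"
      by (simp add: field_simps flip: power_mult_distrib)
    also have "\<dots> \<le> 2 powr (\<alpha> * real (Suc (B * k))) * (\<gamma> / 2 ^ k)"
    proof (rule mult_right_mono)
      have "2 * real k \<le> \<alpha> * real B * real k" using B(2) by (intro mult_right_mono) auto
      then have "2 * real k \<le> \<alpha> * real (Suc (B * k))" using \<alpha> by (simp add: algebra_simps)
      then have "2 powr (2 * real k) \<le> 2 powr (\<alpha> * real (Suc (B * k)))" by (intro powr_mono) auto
      moreover have "2 powr (2 * real k) = (4::real) ^ k"
        using powr_realpow[of "2::real" "2 * k"] by (simp add: power_mult)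
      ultimately show "4 ^ k \<le> 2 powr (\<alpha> * real (Suc (B * k)))" by simp
    qed (use \<gamma> in simp)
    finally have "(\<gamma> * 2 ^ k) powr q \<le> (2 powr (\<alpha> * real (Suc (B * k))) * (\<gamma> / 2 ^ k)) powr q"
      using \<gamma> q by (intro powr_mono2) auto
    then have "ennreal ((\<gamma> * 2 ^ k) powr q) \<le> epow (ennreal (2 powr (\<alpha> * real (Suc (B * k))) * (\<gamma> / 2 ^ k))) q"
      using \<gamma> by (subst epow_ennreal) (auto intro!: ennreal_leI)
    also have "\<dots> \<le> epow (ennreal (2 powr (\<alpha> * real (Suc (B * k)))) * Lp_qnorm p (kernel_conv (hermite_lp_kernel a (Suc (B * k))) ?f)) q"
      using q \<gamma> by (subst ennreal_mult) (auto intro!: epow_mono mult_left_mono Lp simp del: of_nat_Suc)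
    also have "\<dots> \<le> ?S"
      using sum_le_suminf[OF summableI, of "{Suc (B * k)}" "\<lambda>j. epow (ennreal (2 powr (\<alpha> * real j)) * Lp_qnorm p (kernel_conv (hermite_lp_kernel a j) ?f)) q"]
      by simp
    finally show ?thesis .
  qed
  have "?S = \<infinity>"
  proof (rule ccontr)
    assume "?S \<noteq> \<infinity>"
    then obtain s where s: "?S = ennreal s" "s \<ge> 0" by (cases ?S) auto
    obtain k0 :: nat where k0: "s powr (1 / q) / \<gamma> < real k0" using reals_Archimedean2 by blast
    define k where "k = max K k0"
    have "ennreal ((\<gamma> * 2 ^ k) powr q) \<le> ennreal s" using big[of k] s by (simp add: k_def)
    then have "(\<gamma> * 2 ^ k) powr q \<le> s" using s(2) by (simp add: ennreal_le_iff)
    then have "((\<gamma> * 2 ^ k) powr q) powr (1 / q) \<le> s powr (1 / q)" using q by (intro powr_mono2) auto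
    then have "\<gamma> * 2 ^ k \<le> s powr (1 / q)" using q \<gamma> by (simp add: powr_powr)
    then have "2 ^ k \<le> s powr (1 / q) / \<gamma>" using \<gamma> by (simp add: field_simps)
    moreover have "real k0 \<le> real k" by (simp add: k_def)
    moreover have "real k < 2 ^ k" by (rule of_nat_less_two_power)
    ultimately show False using k0 by linarith
  qed
  then show ?thesis by (simp add: hermite_besov_qnorm_def besov_seq_qnorm_def)
qed

theorem theorem5p6:
  fixes \<phi>\<^sub>0 :: "real^'n \<Rightarrow> complex" and a :: "real \<Rightarrow> complex" and \<alpha> p q :: real
  assumes "resolution_generator \<phi>\<^sub>0" and "hermite_admissible a"
    and "p > 0" and "q > 0"
    and "\<alpha> > real CARD('n) * max (1 / p - 1) 0"
  shows "\<exists>f :: real^'n \<Rightarrow> complex.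
           tempered_function f \<and>
           dist_of_fun f \<in> besov \<phi>\<^sub>0 \<alpha> p q \<and>
           hermite_besov_qnorm a \<alpha> p q (dist_of_fun f) = \<infinity> \<and>
           dist_of_fun f \<notin> hermite_besov a \<alpha> p q"
proof -
  have "0 \<le> real CARD('n) * max (1 / p - 1) 0" by simp
  then have \<alpha>: "\<alpha> > 0" using assms(5) by linarith
  obtain B0 :: nat where B0: "2 / \<alpha> \<le> real B0" using real_arch_simple by blast
  define B where "B = max 2 B0"
  have "2 / \<alpha> \<le> real B" using B0 by (simp add: B_def)
  then have B: "2 \<le> B" "2 \<le> \<alpha> * real B" using \<alpha> by (simp_all add: B_def field_simps)
  \<comment> \<open>\<open>undefined\<close> stands for an arbitrary coordinate. The function
    depends on the data only through \<alpha>, which determines \<open>B\<close>.\<close>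
  let ?z = "axis_centres undefined (\<lambda>k. 2 ^ (B * k)) :: nat \<Rightarrow> real^'n"
  let ?f = "\<lambda>x. complex_of_real (packets ?z x)"
  have inf: "hermite_besov_qnorm a \<alpha> p q (dist_of_fun ?f) = \<infinity>"
    by (rule packets_hermite_besov_infinite[OF assms(2-4) \<alpha> B])
  then have "dist_of_fun ?f \<notin> hermite_besov a \<alpha> p q" by (simp add: hermite_besov_def)
  then show ?thesis
    using inf tempered_function_packets[of ?z] packets_in_besov[OF assms(1,3,4), of ?z \<alpha>] by blast
qed

end
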